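(* Let $p,q\ge2$ and let $W$ be an invertible curve singularity. The compactified Milnor fiber $\widehat{M}_W$ and a tessellation on it (by lifts of the two cells of $\mathbb{P}^1_{a,b,c}=[\widehat M_W/G_W]$ cut out by the equator) are explicitly described as follows. (1) (Fermat, $W=F_{p,q}=x^p+y^q$) $\widehat{M}_{F_{p,q}}$ is given by a $(2pq-2p)$-gon with edges identified in the $\pm(2q-1)$ pattern. An odd-numbered edge corresponds to an oriented path from the $a$-vertex to the $c$-vertex in the quotient. (2) (Chain, $W=C_{p,q}=x^p+xy^q$) $\widehat{M}_{C_{p,q}}$ is given by a $(2pq)$-gon with edges identified in the $\pm(2p-1)$ pattern. An odd-numbered edge corresponds to an oriented path from the $b$-vertex to the $c$-vertex in the quotient. (3) (Loop, $W=L_{p,q}=x^py+xy^q$) $\widehat{M}_{L_{p,q}}$ is given by a $2(pq-1)$-gon with edges identified in the $\pm(2p-1)$ pattern. An odd-numbered edge corresponds to an oriented path from the $b$-vertex to the $c$-vertex in the quotient.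
   Context: $M_W=W^{-1}(1)\subset\mathbb{C}^2$ is the Milnor fiber; $\widehat{M}_W$ is the closed Riemann surface obtained by filling its punctures; $G_W=\{(\lambda_1,\lambda_2)\in(\mathbb{C}^* )^2:W(\lambda_1x,\lambda_2y)=W(x,y)\}$ acts on $\widehat{M}_W$ with quotient $\mathbb{P}^1_{a,b,c}$, the orbifold sphere with orbifold points ("$a$-, $b$-, $c$-vertices") of orders $(a,b,c)=(p,q,\frac{pq}{\gcd(p,q)})$ for Fermat, $(pq,q,\frac{pq}{\gcd(p-1,q)})$ for chain, $(pq-1,pq-1,\frac{pq-1}{\gcd(p-1,q-1)})$ for loop. In the coordinate on $\mathbb{P}^1$ given by $x^p$ (Fermat, chain) or $x^py$ (loop), the $a$-, $b$-, $c$-vertices are $0,1,\infty$. The equator through the three orbifold points divides $\mathbb{P}^1_{a,b,c}$ into two cells, whose lifts tessellate $\widehat{M}_W$; polygon edges are lifts of the segment of the equator joining the two named vertices. Pattern convention: for a $2m$-gon with boundary edges $a_1,\dots,a_{2m}$ ordered and oriented counterclockwise (indices mod $2m$), the edges are identified in the $\pm(2r-1)$ pattern if, for every $k$, $a_{2k}$ is identified with $(a_{2k+2r-1})^{op}$ and $a_{2k-1}$ is identified with $(a_{2k-2r})^{op}$, where $a^{op}$ is the orientation reversal of the edge $a$.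
   Formalization: In (2) and (3) the formal theorem has each odd-numbered counterclockwise edge run from the c-vertex to the b-vertex, not from b to c: the ±(2p-1) pattern gives gcd(p-1,q) start points and p end points for chain, while there are p b-points and gcd(p-1,q) c-points. *)

theory Defs
  imports "HOL-Analysis.Analysis"
begin

section \<open>Invertible curve singularities, Milnor fibers, symmetries\<close>

definition fermat :: "nat \<Rightarrow> nat \<Rightarrow> complex \<times> complex \<Rightarrow> complex" where
  "fermat p q = (\<lambda>(x, y). x ^ p + y ^ q)"

definition chain_sing :: "nat \<Rightarrow> nat \<Rightarrow> complex \<times> complex \<Rightarrow> complex" where
  "chain_sing p q = (\<lambda>(x, y). x ^ p + x * y ^ q)"

definition loop_sing :: "nat \<Rightarrow> nat \<Rightarrow> complex \<times> complex \<Rightarrow> complex" where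
  "loop_sing p q = (\<lambda>(x, y). x ^ p * y + x * y ^ q)"

definition milnor_fiber :: "(complex \<times> complex \<Rightarrow> complex) \<Rightarrow> (complex \<times> complex) set" where
  "milnor_fiber W = {z. W z = 1}"

definition symmetries :: "(complex \<times> complex \<Rightarrow> complex) \<Rightarrow> (complex \<times> complex) set" where
  "symmetries W = {(l1, l2). l1 \<noteq> 0 \<and> l2 \<noteq> 0 \<and> (\<forall>x y. W (l1 * x, l2 * y) = W (x, y))}"


section \<open>Closed Riemann surfaces and the filling of punctures\<close>

text \<open>A chart is a pair of an open set and a map to the complex plane; the values of the map
  outside that set are irrelevant.\<close>

definition closed_riemann_surface ::
    "'a topology \<Rightarrow> ('a set \<times> ('a \<Rightarrow> complex)) set \<Rightarrow> bool" where
  "closed_riemann_surface X A \<longleftrightarrow>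
     Hausdorff_space X \<and> compact_space X \<and> connected_space X \<and>
     (\<Union>(U, \<phi>)\<in>A. U) = topspace X \<and>
     (\<forall>(U, \<phi>)\<in>A. openin X U \<and> open (\<phi> ` U) \<and>
        homeomorphic_map (subtopology X U) (top_of_set (\<phi> ` U)) \<phi>) \<and>
     (\<forall>(U, \<phi>)\<in>A. \<forall>(V, \<psi>)\<in>A. (\<lambda>w. \<psi> (inv_into U \<phi> w)) holomorphic_on \<phi> ` (U \<inter> V))"

text \<open>The surface \<open>X\<close> with atlas \<open>A\<close> is the Milnor fiber with its punctures filled by the finitely
  many points of \<open>S\<close>: the map \<open>\<kappa>\<close> is a homeomorphism from the complement of \<open>S\<close> onto the Milnor
  fiber whose two coordinates are holomorphic in the charts. Since the Milnor fibers in question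
  are smooth affine curves, such a \<open>\<kappa>\<close> is biholomorphic, so that \<open>(X, A, S, \<kappa>)\<close> is unique up to
  unique isomorphism.\<close>

definition compactified_milnor_fiber ::
    "(complex \<times> complex \<Rightarrow> complex) \<Rightarrow> 'a topology \<Rightarrow> ('a set \<times> ('a \<Rightarrow> complex)) set \<Rightarrow>
     'a set \<Rightarrow> ('a \<Rightarrow> complex \<times> complex) \<Rightarrow> bool" where
  "compactified_milnor_fiber W X A S \<kappa> \<longleftrightarrow>
     closed_riemann_surface X A \<and> finite S \<and> S \<subseteq> topspace X \<and>
     homeomorphic_map (subtopology X (topspace X - S)) (top_of_set (milnor_fiber W)) \<kappa> \<and>
     (\<forall>(U, \<phi>)\<in>A. (\<lambda>w. fst (\<kappa> (inv_into U \<phi> w))) holomorphic_on \<phi> ` (U - S) \<and>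
                 (\<lambda>w. snd (\<kappa> (inv_into U \<phi> w))) holomorphic_on \<phi> ` (U - S))"


section \<open>The quotient sphere\<close>

abbreviation riemann_sphere :: "complex option topology" where
  "riemann_sphere \<equiv> Alexandroff_compactification euclidean"

definition a_vertex :: "complex option" where "a_vertex = Some 0"
definition b_vertex :: "complex option" where "b_vertex = Some 1"
definition c_vertex :: "complex option" where "c_vertex = None"

text \<open>The equator is the extended real line. It bounds two closed cells.\<close>

definition equator :: "complex option set" where
  "equator = insert None (Some ` \<real>)"

definition upper_cell :: "complex option set" where
  "upper_cell = insert None (Some ` {z. 0 \<le> Im z})"

definition lower_cell :: "complex option set" where
  "lower_cell = insert None (Some ` {z. Im z \<le> 0})"

text \<open>The segments of the equator that join two of the orbifold points and avoid the third.\<close>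

definition segment_ac :: "complex option set" where
  "segment_ac = insert None (Some ` complex_of_real ` {..0})"

definition segment_bc :: "complex option set" where
  "segment_bc = insert None (Some ` complex_of_real ` {1..})"

text \<open>The map \<open>\<rho>\<close> extends the action of the symmetry group from the Milnor fiber to its
  compactification, and \<open>pr\<close> is the quotient map of that action, given on the Milnor fiber by
  the coordinate function \<open>h\<close>. Both \<open>\<rho>\<close> and \<open>pr\<close> are determined by continuity, the complement
  of \<open>S\<close> being dense.\<close>

definition symmetry_quotient ::
    "(complex \<times> complex \<Rightarrow> complex) \<Rightarrow> (complex \<times> complex \<Rightarrow> complex) \<Rightarrow> 'a topology \<Rightarrow>
     'a set \<Rightarrow> ('a \<Rightarrow> complex \<times> complex) \<Rightarrow> ('a \<Rightarrow> complex option) \<Rightarrow> bool" where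
  "symmetry_quotient W h X S \<kappa> pr \<longleftrightarrow>
     quotient_map X riemann_sphere pr \<and>
     (\<forall>z\<in>topspace X - S. pr z = Some (h (\<kappa> z))) \<and>
     (\<exists>\<rho>. (\<forall>g\<in>symmetries W. homeomorphic_map X X (\<rho> g) \<and> \<rho> g ` S = S \<and>
              (\<forall>z\<in>topspace X - S.
                 \<kappa> (\<rho> g z) = (fst g * fst (\<kappa> z), snd g * snd (\<kappa> z)))) \<and>
          (\<forall>z\<in>topspace X. \<forall>w\<in>topspace X. pr z = pr w \<longleftrightarrow> (\<exists>g\<in>symmetries W. \<rho> g z = w)))"


section \<open>Tessellations by lifts of the two cells\<close>

definition tessellation_by_lifts ::
    "'a topology \<Rightarrow> ('a \<Rightarrow> complex option) \<Rightarrow> 'a set set \<Rightarrow> bool" where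
  "tessellation_by_lifts X f \<T> \<longleftrightarrow>
     finite \<T> \<and> \<Union>\<T> = topspace X \<and>
     (\<forall>T\<in>\<T>. \<exists>H\<in>{upper_cell, lower_cell}.
        homeomorphic_map (subtopology X T) (subtopology riemann_sphere H) f) \<and>
     (\<forall>T\<in>\<T>. \<forall>T'\<in>\<T>. T \<noteq> T' \<longrightarrow> f ` (T \<inter> T') \<subseteq> equator)"


section \<open>Polygons with identified edges\<close>

text \<open>The regular \<open>n\<close>-gon inscribed in the unit circle. Vertices and edges are indexed by the
  integers, with period \<open>n\<close>; edges are numbered and oriented counterclockwise.\<close>

definition polygon_vertex :: "nat \<Rightarrow> int \<Rightarrow> complex" where
  "polygon_vertex n k = cis (2 * pi * real_of_int k / real n)"

definition polygon :: "nat \<Rightarrow> complex set" where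
  "polygon n = convex hull (range (polygon_vertex n))"

definition edge :: "nat \<Rightarrow> int \<Rightarrow> real \<Rightarrow> complex" where
  "edge n k = linepath (polygon_vertex n k) (polygon_vertex n (k + 1))"

text \<open>The pairs of points glued by the \<open>\<plusminus>(2r - 1)\<close> pattern.\<close>

definition edge_pattern :: "nat \<Rightarrow> int \<Rightarrow> complex \<Rightarrow> complex \<Rightarrow> bool" where
  "edge_pattern n r z w \<longleftrightarrow>
     (\<exists>k::int. \<exists>t\<in>{0..1::real}.
        (z = edge n (2 * k) t \<and> w = reversepath (edge n (2 * k + 2 * r - 1)) t) \<or>
        (z = edge n (2 * k - 1) t \<and> w = reversepath (edge n (2 * k - 2 * r)) t))"

definition glues_polygon :: "nat \<Rightarrow> int \<Rightarrow> 'a topology \<Rightarrow> (complex \<Rightarrow> 'a) \<Rightarrow> bool" where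
  "glues_polygon n r X \<Phi> \<longleftrightarrow>
     quotient_map (top_of_set (polygon n)) X \<Phi> \<and>
     (\<forall>z\<in>polygon n. \<forall>w\<in>polygon n. \<Phi> z = \<Phi> w \<longleftrightarrow> equivclp (edge_pattern n r) z w)"

definition path_along ::
    "(real \<Rightarrow> complex option) \<Rightarrow> complex option set \<Rightarrow> complex option \<Rightarrow> complex option \<Rightarrow> bool" where
  "path_along g J u v \<longleftrightarrow>
     homeomorphic_map (top_of_set {0..1}) (subtopology riemann_sphere J) g \<and> g 0 = u \<and> g 1 = v"

text \<open>The surface \<open>X\<close> is the \<open>n\<close>-gon with edges identified in the \<open>\<plusminus>(2r - 1)\<close> pattern; polygon
  and surface are compatibly tessellated by lifts of the two cells of the sphere; and each
  odd-numbered edge is a lift of the segment \<open>J\<close>, traversed from \<open>u\<close> to \<open>v\<close>. (For the even-numbered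
  edges, this follows with \<open>u\<close> and \<open>v\<close> exchanged.)

  The last condition makes the gluing map preserve orientations. The polygon lies to the left of
  its counterclockwise edges, and the lower cell lies to the left of the two oriented segments for
  which this predicate is meant, from \<open>0\<close> to \<open>\<infinity>\<close> along the negative reals and from \<open>\<infinity>\<close> to \<open>1\<close> along the positive
  reals.\<close>

definition polygon_presentation ::
    "'a topology \<Rightarrow> ('a \<Rightarrow> complex option) \<Rightarrow> nat \<Rightarrow> int \<Rightarrow>
     complex option set \<Rightarrow> complex option \<Rightarrow> complex option \<Rightarrow> bool" where
  "polygon_presentation X pr n r J u v \<longleftrightarrow>
     (\<exists>\<Phi> \<T>.
        glues_polygon n r X \<Phi> \<and>
        tessellation_by_lifts (top_of_set (polygon n)) (pr \<circ> \<Phi>) \<T> \<and>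
        tessellation_by_lifts X pr ((`) \<Phi> ` \<T>) \<and>
        (\<forall>k. odd k \<longrightarrow>
           path_along (pr \<circ> \<Phi> \<circ> edge n k) J u v \<and>
           (\<exists>T\<in>\<T>. path_image (edge n k) \<subseteq> T \<and> (pr \<circ> \<Phi>) ` T = lower_cell)))"

text \<open>Pitfall: the gluing pattern fixes the direction of the odd-numbered edges. Let \<open>n = 2m\<close>.
  The pattern identifies the starting points of the odd-numbered edges in \<open>gcd (r - 1) m\<close> classes
  and their end points in \<open>gcd r m\<close> classes. For the chain singularity with \<open>m = p q\<close> and \<open>r = p\<close>
  these are \<open>gcd (p - 1) q\<close> and \<open>p\<close> points, while the surface has \<open>p\<close> points over \<open>1\<close> and
  \<open>gcd (p - 1) q\<close> points over \<open>\<infinity>\<close>. For the loop singularity with \<open>m = p q - 1\<close> and \<open>r = p\<close> they are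
  \<open>gcd (p - 1) (q - 1)\<close> points and one point, while the surface has one point over \<open>1\<close> and
  \<open>gcd (p - 1) (q - 1)\<close> points over \<open>\<infinity>\<close>. Hence, in both cases, the oriented path from the
  \<open>b\<close>-vertex to the \<open>c\<close>-vertex corresponds to an odd-numbered edge with its counterclockwise
  orientation reversed, i.e. the counterclockwise edge runs from the \<open>c\<close>-vertex to the
  \<open>b\<close>-vertex. Renumbering the edges by one would exchange this direction together with the sign
  of the pattern.\<close>

end

theory Submission
  imports Defs
begin

text \<open>Write \<open>W = x\<^sup>A y\<^sup>B + x\<^sup>C y\<^sup>D\<close>, where the matrix \<open>M = (A B; C D)\<close> has positive determinant, and
  \<open>s = x\<^sup>A y\<^sup>B\<close>. On the Milnor fiber \<open>x\<^sup>C y\<^sup>D = 1 - s\<close>, so that \<open>(log x, log y) = M\<^sup>-\<^sup>1 (log s, log (1 - s))\<close>.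
  On each closed half plane the logarithms have branches, which differ by
  \<open>(2 \<pi> i a, 2 \<pi> i b)\<close>; hence the lifts of the two cells are indexed by \<open>(a, b) \<in> \<int>\<^sup>2\<close> modulo the lattice
  \<open>M \<int>\<^sup>2\<close>, and crossing a segment of the equator changes \<open>(a, b)\<close> by a fixed vector. A lift
  extends continuously to the three vertices because the fibers of \<open>pr\<close> there are finite and punctured
  half discs are connected. Two lifts that meet over a vertex are joined by a chain of neighbours around
  it, because small punctured discs in the surface are connected. So the surface is the
  quotient of the disjoint union of the cells by the gluings along segments, and it remains to
  assemble the same cells in the regular polygon, leaving open only the gluings along the edges.\<close>

section \<open>The two cells of the sphere\<close>

text \<open>Crossing ab changes neither winding number, ac changes only the first and bc only the
  second. So \<open>(1, 0)\<close> is a turn about a point over the \<open>a\<close>-vertex, and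
  \<open>(0, 1)\<close>, up to sign, one about a point over the \<open>b\<close>-vertex. Modulo the
  lattice and \<open>(1, 0)\<close>, the group \<int>^2 becomes cyclic of order gcd(C, D). For chain
  and loop, C = 1: a single fan of triangles around the only point over the \<open>a\<close>-vertex
  exhausts the surface, and its outer edges lie over bc. There \<open>(0, 1)\<close> is congruent to
  \<open>(-p, 0)\<close>, so crossing bc moves the position in the fan by a fixed amount, which is
  the edge pattern. For Fermat, C = 0 and D = q: there are q points over the
  \<open>a\<close>-vertex, and one fan does not suffice. The polygon is then assembled from the p
  stars around the points over the \<open>b\<close>-vertex, which are joined at one of the points
  over the \<open>a\<close>-vertex. Both constructions need explicit maps of the cells to triangles
  that agree along the equator. This is the purpose of the barycentric coordinates.\<close>

definition cell :: "bool \<Rightarrow> complex option set" where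
  "cell e = (if e then upper_cell else lower_cell)"

definition segment_ab :: "complex option set" where
  "segment_ab = Some ` complex_of_real ` {0..1}"

definition vertices :: "complex option set" where
  "vertices = {a_vertex, b_vertex, c_vertex}"

lemma Some_in_cell: "Some w \<in> cell e \<longleftrightarrow> (if e then 0 \<le> Im w else Im w \<le> 0)"
  by (auto simp: cell_def upper_cell_def lower_cell_def)

lemma None_in_cell [simp]: "None \<in> cell e"
  by (auto simp: cell_def upper_cell_def lower_cell_def)

lemma equator_subset_cell: "equator \<subseteq> cell e"
  by (auto simp: equator_def Some_in_cell complex_is_Real_iff)

lemma cell_Int: "z \<in> cell True \<Longrightarrow> z \<in> cell False \<Longrightarrow> z \<in> equator"
  by (cases z) (auto simp: equator_def Some_in_cell complex_is_Real_iff)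

lemma equator_eq: "equator = segment_ab \<union> segment_ac \<union> segment_bc"
proof -
  have "Some (complex_of_real x) \<in> segment_ab \<union> segment_ac \<union> segment_bc" for x
    by (cases "x \<le> 0"; cases "x \<le> 1")
      (auto simp: segment_ab_def segment_ac_def segment_bc_def)
  then show ?thesis
    by (auto simp: equator_def segment_ab_def segment_ac_def segment_bc_def Reals_def)
qed

section \<open>Neighbourhoods of the vertices in the sphere and in its cells\<close>

lemma topspace_riemann_sphere: "topspace riemann_sphere = UNIV"
  by (auto simp: UNIV_option_conv)

lemma Hausdorff_riemann_sphere: "Hausdorff_space riemann_sphere"
  by (simp add: Hausdorff_space_Alexandroff_compactification locally_compact_space_euclidean)

lemma nhds_Some:
  assumes "openin riemann_sphere N" "Some w \<in> N"
  obtains r where "r > 0" "\<And>w'. dist w' w < r \<Longrightarrow> Some w' \<in> N"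
proof -
  have "open {w. Some w \<in> N}"
    using openin_continuous_map_preimage[OF continuous_map_Some assms(1)] by simp
  then show ?thesis
    using assms(2) that by (auto simp: open_dist)
qed

lemma nhds_None:
  assumes "openin riemann_sphere N" "None \<in> N"
  obtains r where "r > 0" "\<And>w. r < norm w \<Longrightarrow> Some w \<in> N"
proof -
  obtain C where C: "compact C" "N = insert None (Some ` (- C))"
    using assms by (auto simp: openin_Alexandroff_compactification Compl_eq_Diff_UNIV)
  obtain r where r: "r > 0" "\<And>w. w \<in> C \<Longrightarrow> norm w \<le> r"
    using compact_imp_bounded[OF C(1)] by (auto simp: bounded_pos)
  show ?thesis
    by (rule that[of r]) (use r C in force)+
qed

lemma openin_ball_None: "openin riemann_sphere (insert None (Some ` {w. r < norm w}))"
proof -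
  have "{w::complex. r < norm w} = UNIV - cball 0 r" by auto
  then show ?thesis
    unfolding openin_Alexandroff_compactification
    by (intro disjI2 exI[of _ "cball 0 r"]) auto
qed

lemma closedin_cell: "closedin riemann_sphere (cell e)"
proof -
  have "openin euclidean {w. \<not> (if e then 0 \<le> Im w else Im w \<le> 0)}"
    by (cases e) (auto simp: not_le open_halfspace_Im_lt open_halfspace_Im_gt)
  moreover have "cell e = topspace riemann_sphere - Some ` {w. \<not> (if e then 0 \<le> Im w else Im w \<le> 0)}"
    unfolding topspace_riemann_sphere
  proof (rule set_eqI)
    show "z \<in> cell e \<longleftrightarrow> z \<in> UNIV - Some ` {w. \<not> (if e then 0 \<le> Im w else Im w \<le> 0)}" for z
      by (cases z; cases e) (auto simp: Some_in_cell)
  qed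
  ultimately show ?thesis
    unfolding closedin_Alexandroff_compactification
    by (intro disjI2 exI[of _ "{w. \<not> (if e then 0 \<le> Im w else Im w \<le> 0)}"] conjI)
qed

lemma compactin_cell: "compactin riemann_sphere (cell e)"
  by (rule closedin_compact_space[OF _ closedin_cell]) simp

lemma compact_space_cell: "compact_space (subtopology riemann_sphere (cell e))"
  by (simp add: compactin_cell compact_space_subtopology)

lemma topspace_cell: "topspace (subtopology riemann_sphere (cell e)) = cell e"
  by (simp only: topspace_subtopology topspace_riemann_sphere) simp

text \<open>Identities between lifts are first known off the vertices; the points found here carry
  them to the vertices by continuity.\<close>

lemma segment_accumulates:
  assumes "J = segment_ab \<or> J = segment_ac \<or> J = segment_bc" "v \<in> J" "v \<in> vertices"
    and N: "openin riemann_sphere N" "v \<in> N"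
  shows "\<exists>z\<in>N \<inter> J. z \<notin> vertices"
proof (cases v)
  case None
  then obtain r where r: "r > 0" "\<And>w. r < norm w \<Longrightarrow> Some w \<in> N"
    using nhds_None N by metis
  have "Some (complex_of_real (r + 2)) \<in> N" "Some (complex_of_real (- r - 2)) \<in> N"
    using r by (auto simp: norm_of_real simp del: of_real_add of_real_diff of_real_minus)
  moreover have "J = segment_ac \<or> J = segment_bc"
    using assms None by (auto simp: segment_ab_def)
  moreover have "Some (complex_of_real (r + 2)) \<in> segment_bc"
    "Some (complex_of_real (- r - 2)) \<in> segment_ac"
    using r by (auto simp: segment_ac_def segment_bc_def simp del: of_real_add of_real_diff of_real_minus)
  moreover have "complex_of_real (r + 2) \<noteq> 0" "complex_of_real (r + 2) \<noteq> 1"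
      "complex_of_real (-r - 2) \<noteq> 0" "complex_of_real (-r - 2) \<noteq> 1"
    using r unfolding of_real_eq_0_iff of_real_eq_1_iff by auto
  then have "Some (complex_of_real (r + 2)) \<notin> vertices"
    "Some (complex_of_real (- r - 2)) \<notin> vertices"
    by (simp_all add: vertices_def a_vertex_def b_vertex_def c_vertex_def)
  ultimately show ?thesis by blast
next
  case (Some w)
  then obtain r where r: "r > 0" "\<And>w'. dist w' w < r \<Longrightarrow> Some w' \<in> N"
    using nhds_Some N by metis
  \<comment> \<open>Less than 1, so that a step of length \<open>d\<close> from one of 0 and 1 does
    not end at the other.\<close>
  define d where "d = min (r / 2) (1 / 2)"
  have d: "0 < d" "d < r" "d < 1" using r by (auto simp: d_def min_def)
  have w: "w = 0 \<or> w = 1"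
    using assms Some by (auto simp: vertices_def a_vertex_def b_vertex_def c_vertex_def)
  have N: "Some (w + complex_of_real d) \<in> N" "Some (w - complex_of_real d) \<in> N"
    using r d by (auto simp: dist_norm)
  have V: "Some (complex_of_real x) \<in> vertices \<longleftrightarrow> x = 0 \<or> x = 1" for x
    by (simp add: vertices_def a_vertex_def b_vertex_def c_vertex_def)
  have J: "Some (complex_of_real x) \<in> segment_ab \<longleftrightarrow> 0 \<le> x \<and> x \<le> 1"
      "Some (complex_of_real x) \<in> segment_ac \<longleftrightarrow> x \<le> 0"
      "Some (complex_of_real x) \<in> segment_bc \<longleftrightarrow> 1 \<le> x" for x
    by (auto simp: segment_ab_def segment_ac_def segment_bc_def)
  obtain x where x: "w = complex_of_real x" "x = 0 \<or> x = 1"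
    using w by (metis of_real_0 of_real_1)
  have N': "Some (complex_of_real (x + d)) \<in> N" "Some (complex_of_real (x - d)) \<in> N"
    using N x by auto
  have "x \<ge> 1 \<or> x \<le> 0" using x by auto
  have vJ: "Some (complex_of_real x) \<in> J" using assms Some x by auto
  have "Some (complex_of_real (x + d)) \<in> J \<and> x + d \<notin> {0, 1} \<or> Some (complex_of_real (x - d)) \<in> J \<and> x - d \<notin> {0,1}"
  proof -
    have "J = segment_ab \<and> x = 0 \<or> J = segment_ab \<and> x = 1 \<or> J = segment_ac \<and> x = 0 \<or> J = segment_bc \<and> x = 1"
      using assms(1) vJ x(2) by (elim disjE) (simp_all add: J[of 0, simplified] J[of 1, simplified])
    then show ?thesis using d by (elim disjE conjE) (simp_all only: J, auto)
  qed
  then show ?thesis using N' V by (metis IntI insertCI)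
qed

lemma connected_polar:
  fixes w :: complex
  assumes "connected A" "connected B"
  shows "connected ((\<lambda>(r, t). w + complex_of_real r * cis t) ` (A \<times> B))"
  by (intro connected_continuous_image connected_Times assms continuous_intros
        continuous_on_cis | simp add: split_beta)+

lemma half_plane_polar:
  "(if e then 0 \<le> Im w else Im w \<le> 0) \<longleftrightarrow>
    (\<exists>t\<in>(if e then {0..pi} else {-pi..0}). w = complex_of_real (norm w) * cis t)"
proof
  assume L: "if e then 0 \<le> Im w else Im w \<le> 0"
  show "\<exists>t\<in>(if e then {0..pi} else {-pi..0}). w = complex_of_real (norm w) * cis t"
  proof (cases e)
    case True
    have "w = rcis (norm w) (Arg w)" by (simp add: rcis_cmod_Arg)
    moreover have "0 \<le> Arg w" "Arg w \<le> pi"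
      using L True Arg_le_pi  by (auto simp: Arg_less_0)
    ultimately show ?thesis using True by (auto simp: rcis_def)
  next
    case False
    have "cnj w = rcis (norm w) (Arg (cnj w))" by (metis rcis_cmod_Arg complex_mod_cnj)
    then have "w = rcis (norm w) (- Arg (cnj w))"
      by (metis complex_cnj_cnj complex_cnj_complex_of_real complex_cnj_mult cis_cnj rcis_def)
    moreover have "0 \<le> Arg (cnj w)" "Arg (cnj w) \<le> pi"
      using L False Arg_le_pi by (auto simp: Arg_less_0)
    ultimately show ?thesis using False
      by (auto simp: rcis_def intro!: bexI[of _ "- Arg (cnj w)"])
  qed
next
  assume "\<exists>t\<in>(if e then {0..pi} else {-pi..0}). w = complex_of_real (norm w) * cis t"
  then obtain t where t: "t\<in>(if e then {0..pi} else {-pi..0})" "w = complex_of_real (norm w) * cis t"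
    by blast
  have I: "Im w = norm w * sin t" by (subst t(2)) simp
  have S: "if e then 0 \<le> sin t else 0 \<le> sin (- t)"
    using t(1) sin_ge_zero[of t] sin_ge_zero[of "-t"] by (cases e) (auto simp del: sin_minus)
  show "if e then 0 \<le> Im w else Im w \<le> 0"
    using S unfolding I by (cases e) (auto intro: mult_nonneg_nonneg mult_nonneg_nonpos)
qed

text \<open>The polar image of a rectangle is connected. The set of radii is left free: bounded
  intervals give the punctured half discs at 0 and 1, unbounded ones those at \<infinity>.\<close>

lemma connected_half_annulus:
  assumes "connected A" "A \<subseteq> {0<..}"
  shows "connected {w'. norm (w' - complex_of_real x) \<in> A \<and> (if e then 0 \<le> Im w' else Im w' \<le> 0)}"
proof -
  let ?B = "if e then {0..pi} else {-pi..0}"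
  have "{w'. norm (w' - complex_of_real x) \<in> A \<and> (if e then 0 \<le> Im w' else Im w' \<le> 0)}
      = (\<lambda>(r, t). complex_of_real x + complex_of_real r * cis t) ` (A \<times> ?B)" (is "?l = ?r")
  proof (intro equalityI subsetI)
    fix w' assume "w' \<in> ?l"
    then have w: "norm (w' - complex_of_real x) \<in> A"
      "if e then 0 \<le> Im (w' - complex_of_real x) else Im (w' - complex_of_real x) \<le> 0" by auto
    from w(2)[unfolded half_plane_polar] obtain t where
      "t \<in> ?B" "w' - complex_of_real x = complex_of_real (norm (w' - complex_of_real x)) * cis t" by blast
    then show "w' \<in> ?r"
      using w(1) by (intro image_eqI[of _ _ "(norm (w' - complex_of_real x), t)"]) (auto simp: algebra_simps)
  next
    fix w' assume "w' \<in> ?r"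
    then obtain r t where rt: "r \<in> A" "t \<in> ?B" "w' = complex_of_real x + complex_of_real r * cis t"
      by (force simp del: if_split)
    have "0 < r" using rt assms(2) by auto
    then have n: "norm (w' - complex_of_real x) = r" by (simp add: rt norm_mult)
    have "if e then 0 \<le> Im (w' - complex_of_real x) else Im (w' - complex_of_real x) \<le> 0"
      unfolding half_plane_polar using rt n by (intro bexI[of _ t]) auto
    then show "w' \<in> ?l" using n rt by auto
  qed
  moreover have "connected ?B" by auto
  ultimately show ?thesis using connected_polar[OF assms(1), of ?B] by simp
qed

text \<open>Connectedness within one cell is what forces a lift to have only one limit at a
  vertex.\<close>

lemma punctured_cell_locally_connected:
  assumes "v \<in> vertices" "openin riemann_sphere N" "v \<in> N"
  shows "\<exists>N'. openin riemann_sphere N' \<and> v \<in> N' \<and> N' \<subseteq> N \<and>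
     connectedin riemann_sphere (N' \<inter> cell e - {v})"
proof (cases v)
  case None
  then obtain r where r: "r > 0" "\<And>w. r < norm w \<Longrightarrow> Some w \<in> N"
    using nhds_None assms by metis
  let ?N = "insert None (Some ` {w. r < norm w})"
  have eq: "?N \<inter> cell e - {v} =
     Some ` {w'. norm (w' - complex_of_real 0) \<in> {r<..} \<and> (if e then 0 \<le> Im w' else Im w' \<le> 0)}"
    using None by (auto simp: Some_in_cell)
  have "connectedin riemann_sphere (?N \<inter> cell e - {v})"
    unfolding eq using r(1)
    by (intro connectedin_continuous_map_image[OF continuous_map_Some])
       (unfold connectedin_iff_connected, intro connected_half_annulus, auto)
  moreover have "?N \<subseteq> N" using r None assms by auto
  ultimately show ?thesis using openin_ball_None[of r] None by blast
next
  case (Some w)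
  then obtain x where x: "w = complex_of_real x"
    using assms by (auto simp: vertices_def a_vertex_def b_vertex_def c_vertex_def
          intro: of_real_0[symmetric] of_real_1[symmetric])
  obtain r where r: "r > 0" "\<And>w'. dist w' w < r \<Longrightarrow> Some w' \<in> N"
    using nhds_Some assms Some by metis
  have eq: "Some ` ball w r \<inter> cell e - {v} =
     Some ` {w'. norm (w' - complex_of_real x) \<in> {0<..<r} \<and> (if e then 0 \<le> Im w' else Im w' \<le> 0)}"
    using Some x by (auto simp: Some_in_cell dist_norm norm_minus_commute)
  have "connectedin riemann_sphere (Some ` ball w r \<inter> cell e - {v})"
    unfolding eq using r(1)
    by (intro connectedin_continuous_map_image[OF continuous_map_Some])
       (unfold connectedin_iff_connected, intro connected_half_annulus, auto)
  moreover have "Some ` ball w r \<subseteq> N" using r by (auto simp: dist_commute)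
  moreover have "v \<in> Some ` ball w r" using Some r by auto
  ultimately show ?thesis
    by (intro exI[of _ "Some ` ball w r"]) auto
qed

section \<open>Barycentric coordinates on the cells\<close>

text \<open>The triangle with corners 0, 1, \<open>w\<close> has sides 1, \<open>norm w\<close>,
  \<open>norm (w - 1)\<close>. Each coordinate is the sum of two sides minus the third, divided by
  the perimeter. So nonnegativity is the triangle inequality, and a coordinate vanishes exactly when
  the triangle degenerates in one of its three ways. Complex conjugation preserves the coordinates,
  so the same formulas serve both cells. The value 0 at \<infinity> is the limit.\<close>

definition bary_a :: "complex option \<Rightarrow> real" where
  "bary_a = case_option 0 (\<lambda>w. (1 - norm w + norm (w - 1)) / (1 + norm w + norm (w - 1)))"

definition bary_b :: "complex option \<Rightarrow> real" where
  "bary_b = case_option 0 (\<lambda>w. (1 + norm w - norm (w - 1)) / (1 + norm w + norm (w - 1)))"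

definition bary_c :: "complex option \<Rightarrow> real" where
  "bary_c z = 1 - bary_a z - bary_b z"

lemma continuous_map_case_option:
  fixes f :: "complex \<Rightarrow> 'b::topological_space"
  assumes "continuous_on UNIV f" "(f \<longlongrightarrow> l) at_infinity"
  shows "continuous_map riemann_sphere euclidean (case_option l f)"
  unfolding continuous_map_def
proof (intro conjI allI impI)
  fix U :: "'b set" assume "openin euclidean U"
  then have U: "open U" by simp
  have o: "open {w. f w \<in> U}"
    using continuous_open_preimage[OF assms(1) open_UNIV U] by (simp add: vimage_def)
  show "openin riemann_sphere {x \<in> topspace riemann_sphere. case_option l f x \<in> U}"
  proof (cases "l \<in> U")
    case True
    then have "eventually (\<lambda>w. f w \<in> U) at_infinity"
      using assms(2) U by (simp add: tendsto_def)
    then obtain r where r: "\<And>w. norm w \<ge> r \<Longrightarrow> f w \<in> U"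
      by (auto simp: eventually_at_infinity)
    have "bounded (- {w. f w \<in> U})"
      unfolding bounded_iff using r by (metis ComplD linear mem_Collect_eq)
    moreover have "closed (- {w. f w \<in> U})" using o by (simp add: closed_def)
    moreover have "{x \<in> topspace riemann_sphere. case_option l f x \<in> U}
        = insert None (Some ` (topspace euclidean - (- {w. f w \<in> U})))"
    proof (rule set_eqI)
      show "z \<in> {x \<in> topspace riemann_sphere. case_option l f x \<in> U} \<longleftrightarrow>
          z \<in> insert None (Some ` (topspace euclidean - (- {w. f w \<in> U})))" for z
        using True by (cases z) auto
    qed
    ultimately show ?thesis
      unfolding openin_Alexandroff_compactification
      by (intro disjI2 exI[of _ "- {w. f w \<in> U}"]) (simp add: compact_eq_bounded_closed)
  next
    case False
    then have "{x \<in> topspace riemann_sphere. case_option l f x \<in> U} = Some ` {w. f w \<in> U}"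
      by (auto split: option.splits)
    then show ?thesis using o by simp
  qed
qed auto

lemma bary_limit:
  fixes g :: "complex \<Rightarrow> real"
  assumes "\<And>w. \<bar>g w\<bar> \<le> 2"
  shows "((\<lambda>w. g w / (1 + norm w + norm (w - 1))) \<longlongrightarrow> 0) at_infinity"
proof (rule Lim_null_comparison)
  show "\<forall>\<^sub>F w in at_infinity. norm (g w / (1 + norm w + norm (w - 1))) \<le> 2 * inverse (norm w)"
    unfolding eventually_at_infinity
  proof (intro exI[of _ 1] allI impI)
    fix w :: complex assume "1 \<le> norm w"
    then have "\<bar>g w\<bar> / (1 + norm w + norm (w - 1)) \<le> 2 / norm w"
      by (intro frac_le assms) auto
    then show "norm (g w / (1 + norm w + norm (w - 1))) \<le> 2 * inverse (norm w)"
      by (simp add: divide_inverse[symmetric] abs_of_nonneg add_nonneg_nonneg)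
  qed
  show "((\<lambda>w::complex. 2 * inverse (norm w)) \<longlongrightarrow> 0) at_infinity"
    by (intro tendsto_mult_right_zero tendsto_inverse_0_at_top filterlim_norm_at_top)
qed

lemma continuous_bary_a: "continuous_map riemann_sphere euclideanreal bary_a"
  and continuous_bary_b: "continuous_map riemann_sphere euclideanreal bary_b"
proof -
  have S: "1 + norm w + norm (w - 1) \<noteq> 0" for w :: complex
    by (smt (verit) norm_ge_zero)
  have "\<bar>1 - norm w + norm (w - 1)\<bar> \<le> 2" "\<bar>1 + norm w - norm (w - 1)\<bar> \<le> 2" for w :: complex
    using norm_triangle_ineq4[of w 1] norm_triangle_ineq2[of w 1] by (simp_all add: norm_minus_commute)
  then show "continuous_map riemann_sphere euclideanreal bary_a"
      "continuous_map riemann_sphere euclideanreal bary_b"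
    unfolding bary_a_def bary_b_def
    by (intro continuous_map_case_option bary_limit continuous_intros S ballI; blast)+
qed

lemma bary_sum: "bary_a z + bary_b z + bary_c z = 1"
  by (simp add: bary_c_def)

lemma bary_c_Some: "bary_c (Some w) = (norm w + norm (w - 1) - 1) / (1 + norm w + norm (w - 1))"
proof -
  have S: "1 + norm w + norm (w - 1) \<noteq> 0"
    by (smt (verit) norm_ge_zero)
  have "(1 - norm w + norm (w - 1)) / (1 + norm w + norm (w - 1)) +
      (1 + norm w - norm (w - 1)) / (1 + norm w + norm (w - 1)) +
      (norm w + norm (w - 1) - 1) / (1 + norm w + norm (w - 1)) = 1"
    by (simp only: add_divide_distrib[symmetric]) (use S in simp)
  then show ?thesis by (simp add: bary_c_def bary_a_def bary_b_def)
qed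

lemma bary_a_Some: "bary_a (Some w) = (1 - norm w + norm (w - 1)) / (1 + norm w + norm (w - 1))"
  and bary_b_Some: "bary_b (Some w) = (1 + norm w - norm (w - 1)) / (1 + norm w + norm (w - 1))"
  by (simp_all add: bary_a_def bary_b_def)

lemma continuous_bary_c: "continuous_map riemann_sphere euclideanreal bary_c"
  unfolding bary_c_def by (intro continuous_intros continuous_bary_a continuous_bary_b)

lemma bary_nonneg: "0 \<le> bary_a z" "0 \<le> bary_b z" "0 \<le> bary_c z"
proof -
  have "0 \<le> bary_a z \<and> 0 \<le> bary_b z \<and> 0 \<le> bary_c z"
  proof (cases z)
    case None
    then show ?thesis by (simp add: bary_c_def bary_a_def bary_b_def)
  next
    case (Some w)
    have "norm w \<le> 1 + norm (w - 1)" "norm (w - 1) \<le> 1 + norm w" "1 \<le> norm w + norm (w - 1)"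
      using norm_triangle_ineq[of 1 "w - 1"] norm_triangle_ineq4[of w 1] norm_triangle_ineq4[of w "w - 1"]
      by auto
    then show ?thesis
      unfolding Some bary_a_Some bary_b_Some bary_c_Some
      by (intro conjI divide_nonneg_nonneg) auto
  qed
  then show "0 \<le> bary_a z" "0 \<le> bary_b z" "0 \<le> bary_c z" by auto
qed

lemma bary_vertex [simp]:
  "bary_a a_vertex = 1" "bary_b a_vertex = 0" "bary_c a_vertex = 0"
  "bary_a b_vertex = 0" "bary_b b_vertex = 1" "bary_c b_vertex = 0"
  "bary_a c_vertex = 0" "bary_b c_vertex = 0" "bary_c c_vertex = 1"
  by (simp_all add: bary_c_def bary_a_def bary_b_def a_vertex_def b_vertex_def c_vertex_def)

lemma norm_diff_one_sq: "(norm (w - 1))\<^sup>2 = (norm w)\<^sup>2 - 2 * Re w + 1"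
  unfolding cmod_power2 by (simp add: power2_eq_square algebra_simps)

text \<open>A coordinate vanishes when a triangle inequality is an equality. By
  \<open>norm_diff_one_sq\<close>, \<open>Re w\<close> is then \<open>norm w\<close> or
  \<open>- norm w\<close>, so that \<open>w\<close> is real, and the lengths of the sides locate
  it.\<close>

lemma bary_faces:
  shows "bary_a z = 0 \<longleftrightarrow> z \<in> segment_bc"
    and "bary_b z = 0 \<longleftrightarrow> z \<in> segment_ac"
    and "bary_c z = 0 \<longleftrightarrow> z \<in> segment_ab"
proof -
  have "(bary_a z = 0 \<longleftrightarrow> z \<in> segment_bc) \<and> (bary_b z = 0 \<longleftrightarrow> z \<in> segment_ac) \<and>
    (bary_c z = 0 \<longleftrightarrow> z \<in> segment_ab)"
  proof (cases z)
    case None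
    then show ?thesis
      by (simp add: bary_c_def bary_a_def bary_b_def segment_ab_def segment_bc_def segment_ac_def)
  next
    case (Some w)
    have S: "1 + norm w + norm (w - 1) \<noteq> 0"
      by (smt (verit) norm_ge_zero)
    note sq = norm_diff_one_sq[of w]
    have real: "w = complex_of_real (Re w)" if "\<bar>Re w\<bar> = norm w"
      using that cmod_power2[of w] by (simp add: complex_eq_iff) (metis add_cancel_left_right power2_abs power2_eq_iff_nonneg zero_eq_power2)
    have "bary_b z = 0 \<longleftrightarrow> norm (w - 1) = 1 + norm w"
      using S by (auto simp: Some bary_b_Some)
    moreover have "norm (w - 1) = 1 + norm w \<longleftrightarrow> z \<in> segment_ac"
    proof
      assume "norm (w - 1) = 1 + norm w"
      then have "Re w = - norm w" using sq by (simp add: power2_eq_square algebra_simps)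
      then show "z \<in> segment_ac"
        using real by (auto simp: Some segment_ac_def intro!: image_eqI[of _ _ "Re w"])
    next
      assume "z \<in> segment_ac"
      then obtain x where x: "w = complex_of_real x" "x \<le> 0"
        by (auto simp: Some segment_ac_def)
      have "norm w = \<bar>x\<bar>" "norm (w - 1) = \<bar>x - 1\<bar>"
        by (metis x(1) norm_of_real, metis x(1) norm_of_real of_real_1 of_real_diff)
      then show "norm (w - 1) = 1 + norm w"
        using x by simp
    qed
    moreover have "bary_a z = 0 \<longleftrightarrow> norm w = 1 + norm (w - 1)"
      using S by (auto simp: Some bary_a_Some)
    moreover have "norm w = 1 + norm (w - 1) \<longleftrightarrow> z \<in> segment_bc"
    proof
      assume a: "norm w = 1 + norm (w - 1)"
      then have "Re w = norm w" using sq by (simp add: power2_eq_square algebra_simps)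
      moreover have "1 \<le> norm w" using a by simp
      ultimately show "z \<in> segment_bc"
        using real by (auto simp: Some segment_bc_def intro!: image_eqI[of _ _ "Re w"])
    next
      assume "z \<in> segment_bc"
      then obtain x where x: "w = complex_of_real x" "1 \<le> x"
        by (auto simp: Some segment_bc_def)
      have "norm w = \<bar>x\<bar>" "norm (w - 1) = \<bar>x - 1\<bar>"
        by (metis x(1) norm_of_real, metis x(1) norm_of_real of_real_1 of_real_diff)
      then show "norm w = 1 + norm (w - 1)"
        using x by simp
    qed
    moreover have "bary_c z = 0 \<longleftrightarrow> 1 = norm w + norm (w - 1)"
      using S by (auto simp: Some bary_c_Some)
    moreover have "1 = norm w + norm (w - 1) \<longleftrightarrow> z \<in> segment_ab"
    proof
      assume a: "1 = norm w + norm (w - 1)"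
      then have d: "norm (w - 1) = 1 - norm w" by simp
      have "Re w = norm w" using sq unfolding d by (simp add: power2_eq_square algebra_simps)
      moreover have "norm w \<le> 1" using a by (smt (verit) norm_ge_zero)
      ultimately show "z \<in> segment_ab"
        using real by (auto simp: Some segment_ab_def intro!: image_eqI[of _ _ "Re w"])
    next
      assume "z \<in> segment_ab"
      then obtain x where x: "w = complex_of_real x" "0 \<le> x" "x \<le> 1"
        by (auto simp: Some segment_ab_def)
      have "norm w = \<bar>x\<bar>" "norm (w - 1) = \<bar>x - 1\<bar>"
        by (metis x(1) norm_of_real, metis x(1) norm_of_real of_real_1 of_real_diff)
      then show "1 = norm w + norm (w - 1)"
        using x by simp
    qed
    ultimately show ?thesis by blast
  qed
  then show "bary_a z = 0 \<longleftrightarrow> z \<in> segment_bc" "bary_b z = 0 \<longleftrightarrow> z \<in> segment_ac"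
    "bary_c z = 0 \<longleftrightarrow> z \<in> segment_ab" by auto
qed

text \<open>The sum of the two coordinates is 2 divided by the perimeter, or 0 at \<infinity>. So
  the coordinates determine the perimeter and both distances, which fix \<open>w\<close> up to
  conjugation; the cell decides the sign of \<open>Im w\<close>.\<close>

lemma bary_inj:
  assumes "z \<in> cell e" "z' \<in> cell e" "bary_a z = bary_a z'" "bary_b z = bary_b z'"
  shows "z = z'"
proof -
  define S where "S = (\<lambda>w::complex. 1 + norm w + norm (w - 1))"
  have S: "S w > 0" for w
    unfolding S_def by (smt (verit) norm_ge_zero)
  have sum: "bary_a (Some w) + bary_b (Some w) = 2 / S w" for w
    by (simp add: bary_a_Some bary_b_Some S_def add_divide_distrib[symmetric])
  have N: "bary_a None = 0" "bary_b None = 0" by (simp_all add: bary_a_def bary_b_def)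
  have ne: "2 / S w \<noteq> 0" for w using S[of w] by simp
  show ?thesis
  proof (cases z; cases z')
    fix w w' assume w: "z = Some w" "z' = Some w'"
    have "2 / S w = 2 / S w'" using assms w sum by metis
    then have SS: "S w = S w'" using S by simp
    have "1 - norm w + norm (w - 1) = 1 - norm w' + norm (w' - 1)"
    proof -
      have "bary_a (Some u) = (1 - norm u + norm (u - 1)) / S u" for u
        by (simp add: bary_a_Some S_def)
      then show ?thesis using assms(3) S[of w'] SS unfolding w by simp
    qed
    with SS have n: "norm w = norm w'" "norm (w - 1) = norm (w' - 1)"
      unfolding S_def by auto
    then have R: "Re w = Re w'" using norm_diff_one_sq[of w] norm_diff_one_sq[of w'] by simp
    then have "(Im w)\<^sup>2 = (Im w')\<^sup>2" using n(1) cmod_power2[of w] cmod_power2[of w'] by simp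
    then have "Im w = Im w' \<or> Im w = - Im w'" by (simp add: power2_eq_iff)
    then have "Im w = Im w'" using assms(1,2) w by (auto simp: Some_in_cell split: if_splits)
    with R show ?thesis using w by (simp add: complex_eq_iff)
  qed (use assms sum ne N in \<open>metis add.right_neutral\<close>)+
qed

lemma bary_surj:
  assumes "0 \<le> x" "0 \<le> y" "x + y \<le> 1"
  obtains z where "z \<in> cell e" "bary_a z = x" "bary_b z = y"
proof (cases "x + y = 0")
  case True
  then show ?thesis using that[of None] assms by (simp add: bary_a_def bary_b_def)
next
  case False
  then have pos: "x + y > 0" using assms by simp
  \<comment> \<open>The prescribed distances from 0 and 1: with perimeter \<open>S\<close>, the
    coordinates satisfy \<open>1 - x = 2 * r / S\<close>, \<open>1 - y = 2 * d / S\<close> and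
    \<open>x + y = 2 / S\<close>.\<close>
  define r d where "r = (1 - x) / (x + y)" and "d = (1 - y) / (x + y)"
  have r0: "0 \<le> r" "0 \<le> d" using assms pos by (auto simp: r_def d_def)
  have "r + d = (2 - (x + y)) / (x + y)" "r - d = (y - x) / (x + y)"
    by (simp_all add: r_def d_def add_divide_distrib[symmetric] diff_divide_distrib[symmetric])
  moreover have "1 \<le> (2 - (x + y)) / (x + y)" "(y - x) / (x + y) \<le> 1" "-1 \<le> (y - x) / (x + y)"
    using assms pos by (simp_all add: pos_le_divide_eq pos_divide_le_eq)
  ultimately have t: "r \<le> 1 + d" "1 \<le> r + d" "d \<le> 1 + r" by linarith+
  have S: "1 + r + d = 2 / (x + y)" using pos by (simp add: r_def d_def field_simps)
  have xy: "(1 - r + d) / (1 + r + d) = x" "(1 + r - d) / (1 + r + d) = y"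
  proof -
    have "r * (x + y) = 1 - x" "d * (x + y) = 1 - y" using pos by (simp_all add: r_def d_def)
    then have "(1 - r + d) * (x + y) = 2 * x" "(1 + r - d) * (x + y) = 2 * y"
      unfolding left_diff_distrib distrib_right[of _ _ "x + y"] by simp_all
    then show "(1 - r + d) / (1 + r + d) = x" "(1 + r - d) / (1 + r + d) = y"
      unfolding S using pos by simp_all
  qed
  \<comment> \<open>The real part given by the law of cosines. The triangle inequalities
    \<open>t\<close> make \<open>r\<^sup>2 - X\<^sup>2\<close> nonnegative, so that an imaginary
    part exists.\<close>
  define X where "X = (1 + r\<^sup>2 - d\<^sup>2) / 2"
  have "(1 - r)\<^sup>2 \<le> d\<^sup>2" "d\<^sup>2 \<le> (1 + r)\<^sup>2"
    using t r0 by (simp_all add: abs_le_square_iff[symmetric])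
  then have "\<bar>X\<bar> \<le> r"
    by (auto simp: X_def power2_eq_square algebra_simps abs_le_iff)
  then have X2: "X\<^sup>2 \<le> r\<^sup>2" using r0 by (simp add: abs_le_square_iff[symmetric])
  define Y where "Y = (if e then sqrt (r\<^sup>2 - X\<^sup>2) else - sqrt (r\<^sup>2 - X\<^sup>2))"
  have Y2: "Y\<^sup>2 = r\<^sup>2 - X\<^sup>2" using X2 by (simp add: Y_def)
  define w where "w = Complex X Y"
  have n: "norm w = r" using Y2 r0 by (simp add: w_def cmod_def)
  have "(norm (w - 1))\<^sup>2 = d\<^sup>2"
    unfolding norm_diff_one_sq n by (simp add: w_def X_def diff_divide_distrib add_divide_distrib)
  then have "norm (w - 1) = d" using r0 by (simp add: power2_eq_iff_nonneg)
  then show ?thesis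
    using n xy X2 by (intro that[of "Some w"])
     (auto simp: bary_a_Some bary_b_Some Some_in_cell w_def Y_def)
qed

section \<open>Sections of branched covers\<close>

text \<open>As a map from a compact to a Hausdorff space, \<open>f\<close> is closed, so near
  \<open>v\<close> the values of \<sigma> are trapped in any given neighbourhood of the fibre. Since
  the fibre is finite, one of its points is a cluster point. Separate it from the other points of
  the fibre: the image of a connected punctured neighbourhood cannot meet both sides, so the cluster
  point is a limit.\<close>

lemma section_extends_to_points:
  assumes X: "compact_space X" and Y: "Hausdorff_space Y"
    and HX: "Hausdorff_space X"
    and f: "continuous_map X Y f" and fin: "\<And>v. v \<in> V \<Longrightarrow> finite {x \<in> topspace X. f x = v}"
    and E: "E \<subseteq> topspace Y" and V: "finite V"
    and cont: "continuous_map (subtopology Y (E - V)) X \<sigma>"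
    and sec: "\<And>y. y \<in> E - V \<Longrightarrow> f (\<sigma> y) = y"
    and conn: "\<And>v N. v \<in> V \<inter> E \<Longrightarrow> openin Y N \<Longrightarrow> v \<in> N \<Longrightarrow>
       \<exists>N'. openin Y N' \<and> v \<in> N' \<and> N' \<subseteq> N \<and> connectedin Y (N' \<inter> E - {v})"
    and acc: "\<And>v N. v \<in> V \<inter> E \<Longrightarrow> openin Y N \<Longrightarrow> v \<in> N \<Longrightarrow> N \<inter> (E - V) \<noteq> {}"
  shows "\<exists>\<tau>. continuous_map (subtopology Y E) X \<tau> \<and> (\<forall>y\<in>E. f (\<tau> y) = y) \<and> (\<forall>y\<in>E - V. \<tau> y = \<sigma> y)"
proof -
  have \<sigma>X: "\<sigma> y \<in> topspace X" if "y \<in> E - V" for y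
    using cont that E by (auto simp: continuous_map_def Pi_iff)
  have nbhd: "\<exists>N. openin Y N \<and> v \<in> N \<and> {x \<in> topspace X. f x \<in> N} \<subseteq> W"
    if "openin X W" "{x \<in> topspace X. f x = v} \<subseteq> W" "v \<in> topspace Y" for v W
  proof -
    have "closed_map X Y f" using continuous_imp_closed_map X Y f by blast
    then have "closedin Y (f ` (topspace X - W))"
      using that(1) by (auto simp: closed_map_def openin_closedin_eq)
    then show ?thesis
      using that by (intro exI[of _ "topspace Y - f ` (topspace X - W)"]) auto
  qed
  have open_del: "openin Y (N - (V - {v}))" if "openin Y N" for N v
  proof -
    have "t1_space Y" using Y Hausdorff_imp_t1_space by blast
    then have "closedin Y ((V - {v}) \<inter> topspace Y)"
      using V by (intro t1_space_closedin_finite[THEN iffD1, rule_format]) auto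
    moreover have "N - (V - {v}) = N - ((V - {v}) \<inter> topspace Y)"
      using openin_subset[OF that] by auto
    ultimately show ?thesis using that by (metis openin_diff)
  qed
  have limit: "\<exists>P. P \<in> topspace X \<and> f P = v \<and>
      (\<forall>O'. openin X O' \<and> P \<in> O' \<longrightarrow> (\<exists>N. openin Y N \<and> v \<in> N \<and> \<sigma> ` (N \<inter> (E - V)) \<subseteq> O'))"
    if v: "v \<in> V \<inter> E" for v
  proof -
    define F where "F = {x \<in> topspace X. f x = v}"
    have F: "finite F" using fin v by (auto simp: F_def)
    have vY: "v \<in> topspace Y" using v E by auto
    \<comment> \<open>A cluster point exists: otherwise finitely many neighbourhoods that the values
      of \<sigma> eventually avoid would cover the fibre.\<close>
    have "\<exists>P\<in>F. \<forall>N O'. openin Y N \<and> v \<in> N \<and> openin X O' \<and> P \<in> O' \<longrightarrow> \<sigma> ` (N \<inter> (E - V)) \<inter> O' \<noteq> {}"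
    proof (rule ccontr)
      assume "\<not> ?thesis"
      then have "\<forall>P\<in>F. \<exists>N O'. openin Y N \<and> v \<in> N \<and> openin X O' \<and> P \<in> O' \<and> \<sigma> ` (N \<inter> (E - V)) \<inter> O' = {}"
        by blast
      then obtain N O' where NO: "\<And>P. P \<in> F \<Longrightarrow> openin Y (N P) \<and> v \<in> N P \<and> openin X (O' P) \<and> P \<in> O' P \<and>
          \<sigma> ` (N P \<inter> (E - V)) \<inter> O' P = {}" by metis
      have "openin X (\<Union>P\<in>F. O' P)" using NO by auto
      moreover have "F \<subseteq> (\<Union>P\<in>F. O' P)" using NO by auto
      ultimately obtain N0 where N0: "openin Y N0" "v \<in> N0" "{x \<in> topspace X. f x \<in> N0} \<subseteq> (\<Union>P\<in>F. O' P)"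
        using nbhd vY unfolding F_def by meson
      have "openin Y (N0 \<inter> (topspace Y \<inter> (\<Inter>P\<in>F. N P)))"
        using NO N0 F by (intro openin_Int openin_Int_Inter) auto
      moreover have "v \<in> N0 \<inter> (topspace Y \<inter> (\<Inter>P\<in>F. N P))" using NO N0 vY by auto
      ultimately obtain y where y: "y \<in> N0 \<inter> (topspace Y \<inter> (\<Inter>P\<in>F. N P))" "y \<in> E - V"
        using acc[OF v] by blast
      have "\<sigma> y \<in> {x \<in> topspace X. f x \<in> N0}" using y \<sigma>X sec by simp
      then have "\<sigma> y \<in> (\<Union>P\<in>F. O' P)" using N0(3) by blast
      then show False using NO y by blast
    qed
    then obtain P where P: "P \<in> F"
      and cl: "\<And>N O'. openin Y N \<Longrightarrow> v \<in> N \<Longrightarrow> openin X O' \<Longrightarrow> P \<in> O' \<Longrightarrow> \<sigma> ` (N \<inter> (E - V)) \<inter> O' \<noteq> {}"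
      by blast
    have "\<exists>N. openin Y N \<and> v \<in> N \<and> \<sigma> ` (N \<inter> (E - V)) \<subseteq> O'" if O': "openin X O'" "P \<in> O'" for O'
    proof -
      have "compactin X {P}" "compactin X (F - {P})"
        using P F by (auto simp: F_def intro: finite_imp_compactin)
      then obtain A B where AB: "openin X A" "openin X B" "P \<in> A" "F - {P} \<subseteq> B" "disjnt A B"
        using HX[unfolded Hausdorff_space_compact_sets, rule_format, of "{P}" "F - {P}"]
        by (auto simp: disjnt_def)
      have "openin X ((A \<inter> O') \<union> B)" using AB O' by auto
      moreover have "F \<subseteq> (A \<inter> O') \<union> B" using AB O' by auto
      ultimately obtain N1 where N1: "openin Y N1" "v \<in> N1" "{x \<in> topspace X. f x \<in> N1} \<subseteq> (A \<inter> O') \<union> B"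
        using nbhd vY unfolding F_def by meson
      \<comment> \<open>The other points of \<open>V\<close> are removed beforehand, so that
        \<open>N \<inter> E - {v}\<close> lies in the domain of \<sigma>.\<close>
      obtain N where N: "openin Y N" "v \<in> N" "N \<subseteq> N1 - (V - {v})" "connectedin Y (N \<inter> E - {v})"
      proof -
        have "openin Y (N1 - (V - {v}))" "v \<in> N1 - (V - {v})" using open_del N1 by auto
        from conn[OF v this] show ?thesis using that by blast
      qed
      have eq: "N \<inter> E - {v} = N \<inter> (E - V)" using N v by blast
      have "connectedin (subtopology Y (E - V)) (N \<inter> (E - V))"
        using N(4) eq by (auto simp: connectedin_subtopology)
      then have c: "connectedin X (\<sigma> ` (N \<inter> (E - V)))"
        using connectedin_continuous_map_image[OF cont] by blast
      have sub: "\<sigma> ` (N \<inter> (E - V)) \<subseteq> (A \<inter> O') \<union> B"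
        using N1(3) N(3) \<sigma>X sec by fastforce
      have ne: "\<sigma> ` (N \<inter> (E - V)) \<inter> (A \<inter> O') \<noteq> {}"
        using cl[OF N(1,2)] AB O' by (meson IntI openin_Int)
      have "\<sigma> ` (N \<inter> (E - V)) \<inter> B = {}"
      proof -
        have "openin X (A \<inter> O')" "(A \<inter> O') \<inter> B \<inter> \<sigma> ` (N \<inter> (E - V)) = {}"
          using AB O' by (auto simp: disjnt_def)
        moreover have "(A \<inter> O') \<inter> \<sigma> ` (N \<inter> (E - V)) \<noteq> {}" using ne by (simp only: Int_commute) simp
        ultimately have "B \<inter> \<sigma> ` (N \<inter> (E - V)) = {}"
          using c[unfolded connectedin, THEN conjunct2, unfolded not_ex, rule_format, of "A \<inter> O'" B]
            AB(2) sub by argo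
        then show ?thesis by (simp only: Int_commute)
      qed
      then show ?thesis using N sub by blast
    qed
    moreover have "P \<in> topspace X" "f P = v" using P by (auto simp: F_def)
    ultimately show ?thesis by blast
  qed
  then obtain P where P: "\<And>v. v \<in> V \<inter> E \<Longrightarrow> P v \<in> topspace X \<and> f (P v) = v \<and>
      (\<forall>O'. openin X O' \<and> P v \<in> O' \<longrightarrow> (\<exists>N. openin Y N \<and> v \<in> N \<and> \<sigma> ` (N \<inter> (E - V)) \<subseteq> O'))"
    by metis
  define \<tau> where "\<tau> = (\<lambda>y. if y \<in> V then P y else \<sigma> y)"
  have \<tau>X: "\<tau> y \<in> topspace X" if "y \<in> E" for y
    using that P \<sigma>X by (auto simp: \<tau>_def)
  have "continuous_map (subtopology Y E) X \<tau>"
    unfolding continuous_map_eq_topcontinuous_at topcontinuous_at_def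
  proof (intro ballI conjI allI impI)
    fix y assume y: "y \<in> topspace (subtopology Y E)"
    then show "y \<in> topspace (subtopology Y E)" .
    show "\<tau> \<in> topspace (subtopology Y E) \<rightarrow> topspace X" using \<tau>X by auto
    fix O' assume O': "openin X O' \<and> \<tau> y \<in> O'"
    show "\<exists>U. openin (subtopology Y E) U \<and> y \<in> U \<and> (\<forall>y\<in>U. \<tau> y \<in> O')"
    proof (cases "y \<in> V")
      case True
      then have "y \<in> V \<inter> E" "P y \<in> O'" using O' y by (auto simp: \<tau>_def)
      then obtain N where N: "openin Y N" "y \<in> N" "\<sigma> ` (N \<inter> (E - V)) \<subseteq> O'"
        using P[of y] O' by meson
      have "openin (subtopology Y E) ((N - (V - {y})) \<inter> E)"
        using open_del[OF N(1)] by (rule openin_subtopology_Int)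
      moreover have "\<tau> x \<in> O'" if "x \<in> (N - (V - {y})) \<inter> E" for x
        using that N(3) O' by (cases "x = y") (auto simp: \<tau>_def)
      ultimately show ?thesis using N y by (intro exI[of _ "(N - (V - {y})) \<inter> E"]) auto
    next
      case False
      then have "openin (subtopology Y (E - V)) {x \<in> topspace (subtopology Y (E - V)). \<sigma> x \<in> O'}"
        using openin_continuous_map_preimage[OF cont] O' by blast
      then obtain T where T: "openin Y T" "{x \<in> topspace (subtopology Y (E - V)). \<sigma> x \<in> O'} = T \<inter> (E - V)"
        by (auto simp: openin_subtopology)
      have "openin Y (T - V)" using open_del[OF T(1), of y] False by simp
      then have "openin (subtopology Y E) ((T - V) \<inter> E)" by (rule openin_subtopology_Int)
      moreover have mem: "x \<in> T \<longleftrightarrow> \<sigma> x \<in> O'" if "x \<in> E - V" for x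
      proof -
        have "x \<in> T \<inter> (E - V) \<longleftrightarrow> \<sigma> x \<in> O'" unfolding T(2)[symmetric] using that E by auto
        then show ?thesis using that by blast
      qed
      then have "y \<in> T" using y False O' by (auto simp: \<tau>_def)
      moreover have "\<tau> x \<in> O'" if "x \<in> (T - V) \<inter> E" for x
        using that mem[of x] by (auto simp: \<tau>_def)
      ultimately show ?thesis using y False by (intro exI[of _ "(T - V) \<inter> E"]) auto
    qed
  qed
  moreover have "\<forall>y\<in>E. f (\<tau> y) = y" using P sec by (auto simp: \<tau>_def)
  ultimately show ?thesis by (intro exI[of _ \<tau>]) (auto simp: \<tau>_def)
qed

text \<open>Split the images of the sections into those whose index is related to \<open>t\<close>
  and the rest. Being finitely many compact sets on each side, they give two closed sets that cover
  \<open>X\<close>. In a small punctured neighbourhood of the common point these are disjoint by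
  \<open>near\<close>; if \<open>t'\<close> were not related to \<open>t\<close>, both would occur
  there by \<open>acc\<close>, against connectedness.\<close>

lemma sections_meeting_over_point:
  assumes HX: "Hausdorff_space X" and f: "continuous_map X Y f"
    and D: "\<And>t. compactin Y (D t)" and cont: "\<And>t. continuous_map (subtopology Y (D t)) X (\<sigma> t)"
    and sec: "\<And>t z. z \<in> D t \<Longrightarrow> f (\<sigma> t z) = z"
    and fin: "finite (range (\<lambda>t. \<sigma> t ` D t))" and cover: "(\<Union>t. \<sigma> t ` D t) = topspace X"
    and Q: "equivp Q"
    and v: "v \<in> D t" "v \<in> D t'" "\<sigma> t v = \<sigma> t' v" and fibre: "finite {x \<in> topspace X. f x = v}"
    and N: "openin Y N" "v \<in> N"
    and near: "\<And>s s' z. z \<in> N - {v} \<Longrightarrow> z \<in> D s \<Longrightarrow> z \<in> D s' \<Longrightarrow> \<sigma> s z = \<sigma> s' z \<Longrightarrow> Q s s'"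
    and conn: "\<And>P W. openin X W \<Longrightarrow> P \<in> W \<Longrightarrow>
       \<exists>U. openin X U \<and> P \<in> U \<and> U \<subseteq> W \<and> connectedin X (U - {P})"
    and acc: "\<And>N s. openin Y N \<Longrightarrow> v \<in> N \<Longrightarrow> v \<in> D s \<Longrightarrow> \<exists>z\<in>N \<inter> D s. z \<noteq> v"
  shows "Q t t'"
proof (rule ccontr)
  assume nQ: "\<not> Q t t'"
  define P where "P = \<sigma> t v"
  have DY: "D s \<subseteq> topspace Y" for s using D compactin_subset_topspace by blast
  have \<sigma>X: "\<sigma> s z \<in> topspace X" if "z \<in> D s" for s z using cover that by blast
  have P: "P \<in> topspace X" "f P = v" using v \<sigma>X sec by (auto simp: P_def)
  have comp: "compactin X (\<sigma> s ` D s)" for s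
    by (rule image_compactin[OF _ cont[of s]]) (simp add: D compactin_subtopology)
  define K where K: "K = (\<lambda>b. \<Union>s\<in>{s. Q t s = b}. \<sigma> s ` D s)"
  have closed: "closedin X (K b)" for b
    unfolding K
  proof (rule closedin_Union)
    show "finite ((\<lambda>s. \<sigma> s ` D s) ` {s. Q t s = b})"
      by (rule finite_subset[OF _ fin]) auto
  qed (use compactin_imp_closedin[OF HX comp] in auto)
  \<comment> \<open>\<open>P\<close> is the only point of \<open>W\<close> over \<open>v\<close>, so
    every other point of \<open>W\<close> lies over \<open>N - {v}\<close>, where
    \<open>near\<close> applies.\<close>
  define W where "W = {x \<in> topspace X. f x \<in> N} - ({x \<in> topspace X. f x = v} - {P})"
  have "closedin X ({x \<in> topspace X. f x = v} - {P})"
    using fibre HX by (intro closedin_Hausdorff_finite) auto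
  then have "openin X W"
    unfolding W_def using openin_continuous_map_preimage[OF f N(1)] by auto
  moreover have "P \<in> W" using P N by (auto simp: W_def)
  ultimately obtain U where U: "openin X U" "P \<in> U" "U \<subseteq> W" "connectedin X (U - {P})"
    using conn by blast
  have meets: "(U - {P}) \<inter> K b \<noteq> {}" if s: "v \<in> D s" "\<sigma> s v = P" "Q t s = b" for s b
  proof -
    have "openin (subtopology Y (D s)) {z \<in> topspace (subtopology Y (D s)). \<sigma> s z \<in> U}"
      using openin_continuous_map_preimage[OF cont U(1)] .
    then obtain T where T: "openin Y T" "{z \<in> topspace (subtopology Y (D s)). \<sigma> s z \<in> U} = T \<inter> D s"
      by (auto simp: openin_subtopology)
    have "v \<in> T" using T s U DY[of s] by auto
    then obtain z where z: "z \<in> T \<inter> D s" "z \<noteq> v" using acc[OF T(1)] s by blast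
    then have "\<sigma> s z \<in> U" using T by blast
    moreover have "\<sigma> s z \<noteq> P" using sec[of z s] z P by auto
    ultimately show ?thesis using z s by (auto simp: K)
  qed
  have "Q t t" using Q by (simp add: equivp_reflp)
  then have m1: "(U - {P}) \<inter> K True \<noteq> {}" using meets[of t] v by (auto simp: P_def)
  have m2: "(U - {P}) \<inter> K False \<noteq> {}" using meets[of t'] v nQ by (auto simp: P_def)
  have "U - {P} \<subseteq> K True \<union> K False"
    using cover openin_subset[OF U(1)] by (force simp: K)
  moreover have "K True \<inter> K False \<inter> (U - {P}) = {}"
  proof (rule ccontr)
    assume "\<not> ?thesis"
    then obtain x where x: "x \<in> U" "x \<noteq> P" "x \<in> K True" "x \<in> K False" by blast
    from x(3) obtain s z where s: "Q t s" "z \<in> D s" "x = \<sigma> s z" by (auto simp: K)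
    from x(4) obtain s' z' where s': "\<not> Q t s'" "z' \<in> D s'" "x = \<sigma> s' z'" by (auto simp: K)
    have zz: "f x = z" "z' = z" using s s' sec by metis+
    have "x \<in> W" using x U by auto
    then have "z \<in> N - {v}" using zz x by (auto simp: W_def)
    then have "Q s s'" using near s s' zz by metis
    then show False using s s' Q by (meson equivp_transp)
  qed
  ultimately show False
    using U(4) closed m1 m2 unfolding connectedin_closedin by blast
qed

text \<open>The preimage of a small disc in a chart. Its connected punctured form serves for lifts
  that meet over a vertex; its infinity shows that no nonempty open set consists of finitely many
  exceptional points.\<close>

lemma closed_riemann_surface_local:
  assumes "closed_riemann_surface X A" "openin X W" "P \<in> W"
  obtains U where "openin X U" "P \<in> U" "U \<subseteq> W" "connectedin X (U - {P})" "infinite U"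
proof -
  have "P \<in> (\<Union>(U, \<phi>)\<in>A. U)"
    using assms openin_subset unfolding closed_riemann_surface_def by blast
  then obtain C \<phi> where C: "(C, \<phi>) \<in> A" "P \<in> C" by blast
  then have op: "openin X C" "open (\<phi> ` C)"
    and "homeomorphic_map (subtopology X C) (top_of_set (\<phi> ` C)) \<phi>"
    using assms(1) by (auto simp: closed_riemann_surface_def)
  then obtain g where g: "homeomorphic_maps (subtopology X C) (top_of_set (\<phi> ` C)) \<phi> g"
    by (auto simp: homeomorphic_map_maps)
  have CX: "topspace (subtopology X C) = C" using op(1) openin_subset by fastforce
  have gphi: "\<And>x. x \<in> C \<Longrightarrow> g (\<phi> x) = x" and phig: "\<And>y. y \<in> \<phi> ` C \<Longrightarrow> \<phi> (g y) = y"
    using g CX by (auto simp: homeomorphic_maps_def)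
  have hm: "homeomorphic_map (subtopology X C) (top_of_set (\<phi> ` C)) \<phi>"
    "homeomorphic_map (top_of_set (\<phi> ` C)) (subtopology X C) g"
    using g homeomorphic_maps_map homeomorphic_maps_sym by blast+
  have cg: "continuous_map (top_of_set (\<phi> ` C)) (subtopology X C) g"
    using g by (simp add: homeomorphic_maps_def)
  have "openin (subtopology X C) (C \<inter> W)" using assms(2) by (auto simp: openin_subtopology)
  then have "openin (top_of_set (\<phi> ` C)) (\<phi> ` (C \<inter> W))"
    using homeomorphic_map_openness[OF hm(1), of "C \<inter> W"] CX by blast
  then have "open (\<phi> ` (C \<inter> W))" using op(2) openin_open_trans by blast
  then obtain r where r: "r > 0" "ball (\<phi> P) r \<subseteq> \<phi> ` (C \<inter> W)"
    using C assms(3) open_contains_ball by blast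
  define U where "U = g ` ball (\<phi> P) r"
  have sub: "ball (\<phi> P) r \<subseteq> \<phi> ` C" using r by blast
  have "openin (top_of_set (\<phi> ` C)) (ball (\<phi> P) r)" using sub by (simp add: openin_open_eq op(2))
  then have "openin (subtopology X C) U"
    unfolding U_def using homeomorphic_map_openness[OF hm(2)] sub by auto
  then have 1: "openin X U" using op(1) openin_trans_full by blast
  have 2: "P \<in> U" unfolding U_def using r gphi C by (metis centre_in_ball image_eqI)
  have 3: "U \<subseteq> W" unfolding U_def using r(2) gphi by force
  have inj: "inj_on g (ball (\<phi> P) r)" using phig sub by (metis inj_on_def subsetD)
  have "U - {P} = g ` (ball (\<phi> P) r - {\<phi> P})"
  proof -
    have "g ` {\<phi> P} = {P}" using gphi C by auto
    then show ?thesis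
      unfolding U_def using inj r(1) inj_on_image_set_diff[OF inj, of "ball (\<phi> P) r" "{\<phi> P}"] by auto
  qed
  moreover have "connected (ball (\<phi> P) r - {\<phi> P})"
    by (rule connected_open_delete) auto
  then have "connectedin (top_of_set (\<phi> ` C)) (ball (\<phi> P) r - {\<phi> P})"
    using sub by (auto simp: connectedin_subtopology)
  ultimately have "connectedin (subtopology X C) (U - {P})"
    using connectedin_continuous_map_image[OF cg] by metis
  then have 4: "connectedin X (U - {P})" by (simp add: connectedin_subtopology)
  have "infinite (ball (\<phi> P) r)"
    using r(1) uncountable_ball countable_finite by blast
  then have 5: "infinite U" unfolding U_def using inj finite_imageD by blast
  show ?thesis using that 1 2 3 4 5 .
qed

section \<open>Branches of the lifts\<close>

text \<open>A logarithm continuous up to the boundary of the chosen half plane, away from 0. On the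
  negative reals its imaginary part is \<open>pi\<close> for the upper half plane and
  \<open>- pi\<close> for the lower one.\<close>

definition half_Ln :: "bool \<Rightarrow> complex \<Rightarrow> complex" where
  "half_Ln e w = (if e then Ln w else cnj (Ln (cnj w)))"

lemma exp_half_Ln: "w \<noteq> 0 \<Longrightarrow> exp (half_Ln e w) = w"
  by (simp add: half_Ln_def exp_cnj[symmetric])

lemma half_Ln_pos: "x > 0 \<Longrightarrow> half_Ln e (complex_of_real x) = complex_of_real (ln x)"
  by (simp add: half_Ln_def Ln_of_real)

lemma half_Ln_neg:
  assumes "x < 0"
  shows "half_Ln True (complex_of_real x) = half_Ln False (complex_of_real x) + 2 * of_real pi * \<i>"
proof -
  have "Im (Ln (complex_of_real x)) = pi" using assms by (simp add: Im_Ln_eq_pi)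
  then show ?thesis by (simp add: half_Ln_def complex_eq_iff)
qed

text \<open>On the closed upper half plane without 0, \<open>Arg\<close> coincides with
  \<open>Arg2pi\<close>, which is continuous there although the cut of \<open>Ln\<close> lies on its
  boundary.\<close>

lemma continuous_on_Ln_upper: "continuous_on ({w. 0 \<le> Im w} - {0}) Ln"
proof -
  have "continuous_on ({w. 0 \<le> Im w} - {0}) (\<lambda>w. complex_of_real (ln (norm w)) + \<i> * complex_of_real (Arg2pi w))"
    by (intro continuous_intros continuous_on_upperhalf_Arg2pi) auto
  moreover have "complex_of_real (ln (norm w)) + \<i> * complex_of_real (Arg2pi w) = Ln w"
    if "w \<in> {w. 0 \<le> Im w} - {0}" for w
  proof -
    have "0 \<le> Arg w" "Arg w < 2 * pi"
      using that Arg_less_0[of w] Arg_le_pi[of w] pi_gt_zero by (auto simp del: pi_gt_zero)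
    moreover have "complex_of_real (norm w) * exp (\<i> * complex_of_real (Arg w)) = w"
      using rcis_cmod_Arg[of w] by (simp add: rcis_def cis_conv_exp)
    ultimately have "Arg2pi w = Arg w" using that by (intro Arg2pi_unique) auto
    then show ?thesis using that by (simp add: complex_eq_iff Arg_eq_Im_Ln)
  qed
  ultimately show ?thesis by (subst (asm) continuous_on_cong[OF refl]) auto
qed

lemma continuous_on_half_Ln:
  "continuous_on ({w. if e then 0 \<le> Im w else Im w \<le> 0} - {0}) (half_Ln e)"
proof (cases e)
  case True
  then show ?thesis using continuous_on_Ln_upper by (simp add: half_Ln_def[abs_def])
next
  case False
  have "continuous_on ({w. Im w \<le> 0} - {0}) (\<lambda>w. cnj (Ln (cnj w)))"
    by (intro continuous_on_cnj continuous_on_compose2[OF continuous_on_Ln_upper] continuous_intros) auto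
  then show ?thesis using False by (simp add: half_Ln_def[abs_def])
qed

definition lattice :: "nat \<Rightarrow> nat \<Rightarrow> nat \<Rightarrow> nat \<Rightarrow> int \<Rightarrow> int \<Rightarrow> bool" where
  "lattice A B C D i j \<longleftrightarrow> (\<exists>a b::int. i = int A * a + int B * b \<and> j = int C * a + int D * b)"

locale exponent_matrix =
  fixes A B C D :: nat
  assumes det: "B * C < A * D"
begin

abbreviation "\<Delta> \<equiv> complex_of_int (int A * int D - int B * int C)"

lemma det_pos: "int A * int D - int B * int C > 0"
  using det by (metis diff_gt_0_iff_gt of_nat_less_iff of_nat_mult)

lemma \<Delta>_nz: "\<Delta> \<noteq> 0"
  using det_pos by (metis of_int_eq_0_iff less_irrefl)

definition angle0 :: "bool \<Rightarrow> int \<Rightarrow> complex \<Rightarrow> complex" where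
  "angle0 e i w = half_Ln e w + 2 * of_int i * of_real pi * \<i>"

text \<open>If \<open>w\<close> lies in one half plane, then \<open>1 - w\<close> lies in the other one.\<close>

definition angle1 :: "bool \<Rightarrow> int \<Rightarrow> complex \<Rightarrow> complex" where
  "angle1 e j w = half_Ln (\<not> e) (1 - w) + 2 * of_int j * of_real pi * \<i>"

definition sect :: "bool \<Rightarrow> int \<Rightarrow> int \<Rightarrow> complex \<Rightarrow> complex \<times> complex" where
  "sect e i j w =
     (exp ((of_nat D * angle0 e i w - of_nat B * angle1 e j w) / \<Delta>),
      exp ((of_nat A * angle1 e j w - of_nat C * angle0 e i w) / \<Delta>))"

lemma exp_angle:
  assumes "w \<noteq> 0" "w \<noteq> 1"
  shows "exp (angle0 e i w) = w" "exp (angle1 e j w) = 1 - w"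
proof -
  have "exp (z + 2 * of_int n * of_real pi * \<i>) = exp z" for z :: complex and n
    using exp_eq[of "z + 2 * of_int n * of_real pi * \<i>" z] by auto
  then show "exp (angle0 e i w) = w" "exp (angle1 e j w) = 1 - w"
    using assms by (simp_all add: angle0_def angle1_def exp_half_Ln)
qed

lemma solve:
  fixes u v x y :: complex
  shows "of_nat A * x + of_nat B * y = u \<and> of_nat C * x + of_nat D * y = v \<longleftrightarrow>
    x = (of_nat D * u - of_nat B * v) / \<Delta> \<and> y = (of_nat A * v - of_nat C * u) / \<Delta>"
    (is "?l \<longleftrightarrow> ?r")
proof -
  have "?r \<longleftrightarrow> x * \<Delta> = of_nat D * u - of_nat B * v \<and> y * \<Delta> = of_nat A * v - of_nat C * u"
    using \<Delta>_nz by (simp add: eq_divide_eq)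
  also have "\<dots> \<longleftrightarrow> ?l"
  proof
    assume r: "x * \<Delta> = of_nat D * u - of_nat B * v \<and> y * \<Delta> = of_nat A * v - of_nat C * u"
    then have "(of_nat A * x + of_nat B * y) * \<Delta> = u * \<Delta>"
      "(of_nat C * x + of_nat D * y) * \<Delta> = v * \<Delta>"
      by (simp_all add: distrib_right mult.assoc) (simp_all add: algebra_simps)
    then show ?l using \<Delta>_nz by (metis mult_right_cancel)
  next
    assume ?l
    then show "x * \<Delta> = of_nat D * u - of_nat B * v \<and> y * \<Delta> = of_nat A * v - of_nat C * u"
      by (auto simp: algebra_simps)
  qed
  finally show ?thesis by blast
qed

lemma sect_solves:
  assumes "w \<noteq> 0" "w \<noteq> 1" "sect e i j w = (x, y)"
  shows "x ^ A * y ^ B = w" "x ^ C * y ^ D = 1 - w"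
proof -
  define \<xi> where "\<xi> = (of_nat D * angle0 e i w - of_nat B * angle1 e j w) / \<Delta>"
  define \<eta> where "\<eta> = (of_nat A * angle1 e j w - of_nat C * angle0 e i w) / \<Delta>"
  have "of_nat A * \<xi> + of_nat B * \<eta> = angle0 e i w" "of_nat C * \<xi> + of_nat D * \<eta> = angle1 e j w"
    using solve[of \<xi> \<eta>] unfolding \<xi>_def \<eta>_def by blast+
  moreover have "x = exp \<xi>" "y = exp \<eta>" using assms(3) by (auto simp: sect_def \<xi>_def \<eta>_def)
  ultimately show "x ^ A * y ^ B = w" "x ^ C * y ^ D = 1 - w"
    using exp_angle[OF assms(1,2)] by (metis exp_add exp_of_nat_mult)+
qed

lemma sect_exhausts:
  assumes "w \<noteq> 0" "w \<noteq> 1" "x ^ A * y ^ B = w" "x ^ C * y ^ D = 1 - w"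
  shows "\<exists>i j. (x, y) = sect e i j w"
proof -
  have "A > 0" "D > 0" using det by (auto intro: gr0I)
  then have "x \<noteq> 0" "y \<noteq> 0" using assms by (auto simp: zero_power)
  then obtain \<xi> \<eta> where xy: "x = exp \<xi>" "y = exp \<eta>" by (metis exp_Ln)
  have "exp (of_nat A * \<xi> + of_nat B * \<eta>) = exp (half_Ln e w)"
       "exp (of_nat C * \<xi> + of_nat D * \<eta>) = exp (half_Ln (\<not> e) (1 - w))"
    using assms xy by (simp_all add: exp_add exp_of_nat_mult exp_half_Ln)
  then obtain i j where
    "of_nat A * \<xi> + of_nat B * \<eta> = angle0 e i w" "of_nat C * \<xi> + of_nat D * \<eta> = angle1 e j w"
    unfolding exp_eq angle0_def angle1_def by (auto simp: algebra_simps)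
  then have "\<xi> = (of_nat D * angle0 e i w - of_nat B * angle1 e j w) / \<Delta>"
     "\<eta> = (of_nat A * angle1 e j w - of_nat C * angle0 e i w) / \<Delta>"
    using solve by blast+
  then show ?thesis unfolding xy sect_def by blast
qed

text \<open>The logarithms of the two points differ by \<open>2 \<pi> i\<close> times the inverse
  matrix applied to \<open>(i - i', j - j')\<close>. This does not depend on \<open>w\<close>, and
  the points agree when both entries of that vector are integers.\<close>

lemma sect_eq_iff:
  "sect e i j w = sect e i' j' w \<longleftrightarrow> lattice A B C D (i - i') (j - j')"
proof -
  let ?x = "\<lambda>u v. (of_nat D * u - of_nat B * v) / \<Delta>" and ?y = "\<lambda>u v. (of_nat A * v - of_nat C * u) / \<Delta>"
  have diff: "?x (angle0 e i w) (angle1 e j w) - ?x (angle0 e i' w) (angle1 e j' w) =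
       ?x (2 * of_int (i - i') * of_real pi * \<i>) (2 * of_int (j - j') * of_real pi * \<i>)"
     "?y (angle0 e i w) (angle1 e j w) - ?y (angle0 e i' w) (angle1 e j' w) =
       ?y (2 * of_int (i - i') * of_real pi * \<i>) (2 * of_int (j - j') * of_real pi * \<i>)"
    unfolding angle0_def angle1_def diff_divide_distrib[symmetric]
    by (intro arg_cong2[of _ _ _ _ "(/)"] refl; simp add: algebra_simps)+
  have e: "exp z = exp z' \<longleftrightarrow> (\<exists>n::int. z - z' = 2 * of_int n * of_real pi * \<i>)" for z z' :: complex
    unfolding exp_eq by (auto simp: algebra_simps)
  have "sect e i j w = sect e i' j' w \<longleftrightarrow>
    (\<exists>a b::int. 2 * of_int a * of_real pi * \<i> =
         ?x (2 * of_int (i - i') * of_real pi * \<i>) (2 * of_int (j - j') * of_real pi * \<i>) \<and>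
       2 * of_int b * of_real pi * \<i> =
         ?y (2 * of_int (i - i') * of_real pi * \<i>) (2 * of_int (j - j') * of_real pi * \<i>))"
    unfolding sect_def prod.inject e diff by metis
  also have "\<dots> \<longleftrightarrow> (\<exists>a b::int.
       of_nat A * (2 * of_int a * of_real pi * \<i>) + of_nat B * (2 * of_int b * of_real pi * \<i>)
          = 2 * of_int (i - i') * of_real pi * \<i> \<and>
       of_nat C * (2 * of_int a * of_real pi * \<i>) + of_nat D * (2 * of_int b * of_real pi * \<i>)
          = 2 * of_int (j - j') * of_real pi * \<i>)"
    unfolding solve ..
  also have "\<dots> \<longleftrightarrow> (\<exists>a b::int. int A * a + int B * b = i - i' \<and> int C * a + int D * b = j - j')"
  proof -
    have "of_nat P * (2 * of_int a * of_real pi * \<i>) + of_nat Q * (2 * of_int b * of_real pi * \<i>)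
          = 2 * of_int k * of_real pi * \<i> \<longleftrightarrow> int P * a + int Q * b = k" for P Q :: nat and a b k :: int
    proof -
      have "of_nat P * (2 * of_int a * of_real pi * \<i>) + of_nat Q * (2 * of_int b * of_real pi * \<i>)
          = (2 * of_real pi * \<i>) * complex_of_int (int P * a + int Q * b)"
        "2 * of_int k * of_real pi * \<i> = (2 * of_real pi * \<i>) * complex_of_int k"
        by (simp_all add: algebra_simps)
      moreover have "2 * of_real pi * \<i> \<noteq> (0::complex)" by simp
      ultimately show ?thesis by (metis mult_left_cancel of_int_eq_iff)
    qed
    then show ?thesis by (simp only: )
  qed
  finally show ?thesis unfolding lattice_def by metis
qed

text \<open>Only the logarithm of a negative number depends on the cell. On ac this is the logarithm
  of \<open>w\<close>, on bc that of \<open>1 - w\<close>. As \<open>1 - w\<close> lies in the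
  opposite half plane, the shift on bc has the opposite sign.\<close>

lemma sect_ab: "0 < x \<Longrightarrow> x < 1 \<Longrightarrow>
    sect True i j (complex_of_real x) = sect False i j (complex_of_real x)"
  and sect_ac: "x < 0 \<Longrightarrow>
    sect True i j (complex_of_real x) = sect False (i + 1) j (complex_of_real x)"
  and sect_bc: "1 < x \<Longrightarrow>
    sect True i (j + 1) (complex_of_real x) = sect False i j (complex_of_real x)"
proof -
  have one: "1 - complex_of_real x = complex_of_real (1 - x)" by simp
  have pos: "angle0 True i (complex_of_real x) = angle0 False i (complex_of_real x)" if "0 < x"
    using that by (simp add: angle0_def half_Ln_pos)
  have pos': "angle1 True j (complex_of_real x) = angle1 False j (complex_of_real x)" if "x < 1"
    using that by (simp add: angle1_def half_Ln_pos one del: of_real_diff)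
  have neg: "angle0 True i (complex_of_real x) = angle0 False (i + 1) (complex_of_real x)" if "x < 0"
    using that by (simp add: angle0_def half_Ln_neg algebra_simps)
  have neg': "angle1 True (j + 1) (complex_of_real x) = angle1 False j (complex_of_real x)" if "1 < x"
    using that by (simp add: angle1_def half_Ln_neg one algebra_simps del: of_real_diff)
  show "0 < x \<Longrightarrow> x < 1 \<Longrightarrow>
    sect True i j (complex_of_real x) = sect False i j (complex_of_real x)"
    using pos pos' by (simp add: sect_def)
  show "x < 0 \<Longrightarrow>
    sect True i j (complex_of_real x) = sect False (i + 1) j (complex_of_real x)"
    using neg pos' by (simp add: sect_def)
  show "1 < x \<Longrightarrow>
    sect True i (j + 1) (complex_of_real x) = sect False i j (complex_of_real x)"
    using pos neg' by (simp add: sect_def)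
qed

lemma continuous_on_sect:
  "continuous_on ({w. if e then 0 \<le> Im w else Im w \<le> 0} - {0, 1}) (sect e i j)"
proof -
  let ?H = "{w. if e then 0 \<le> Im w else Im w \<le> 0} - {0, 1}"
  have "continuous_on ?H (half_Ln e)"
    by (rule continuous_on_subset[OF continuous_on_half_Ln]) auto
  moreover have "continuous_on ?H (\<lambda>w. half_Ln (\<not> e) (1 - w))"
    by (rule continuous_on_compose2[OF continuous_on_half_Ln]) (auto intro!: continuous_intros)
  ultimately show ?thesis
    unfolding sect_def[abs_def] angle0_def angle1_def
    using \<Delta>_nz by (intro continuous_intros) auto
qed

end

section \<open>The lifted triangulation\<close>

text \<open>Neighbouring lifts over a point \<open>z\<close>. A lift is indexed by the cell (\<open>True\<close> for the upper one)
  and the two winding numbers of the chosen branches of \<open>log z\<close> and \<open>log (1 - z)\<close>.\<close>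

inductive adjacent :: "(int \<Rightarrow> int \<Rightarrow> bool) \<Rightarrow> complex option \<Rightarrow> bool \<times> int \<times> int \<Rightarrow> bool \<times> int \<times> int \<Rightarrow> bool"
  for L z where
  period: "L (i - i') (j - j') \<Longrightarrow> adjacent L z (e, i, j) (e, i', j')"
| across_ab: "z \<in> segment_ab \<Longrightarrow> adjacent L z (True, i, j) (False, i, j)"
| across_ac: "z \<in> segment_ac \<Longrightarrow> adjacent L z (True, i, j) (False, i + 1, j)"
| across_bc: "z \<in> segment_bc \<Longrightarrow> adjacent L z (True, i, j + 1) (False, i, j)"

text \<open>The interface between the analysis and the combinatorics. \<open>lift_eqD\<close> says
  that the listed gluings generate all coincidences of lifts over a point. Indices range over all
  integers, which avoids representatives; \<open>L_finite\<close> restores finiteness where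
  compactness needs it.\<close>

locale triangulated_cover =
  fixes X :: "'a topology" and pr :: "'a \<Rightarrow> complex option"
    and lift :: "bool \<Rightarrow> int \<Rightarrow> int \<Rightarrow> complex option \<Rightarrow> 'a" and L :: "int \<Rightarrow> int \<Rightarrow> bool"
  assumes HX: "Hausdorff_space X" and pr: "continuous_map X riemann_sphere pr"
    and lift_cont: "continuous_map (subtopology riemann_sphere (cell e)) X (lift e i j)"
    and pr_lift: "z \<in> cell e \<Longrightarrow> pr (lift e i j z) = z"
    and lift_cover: "(\<Union>e i j. lift e i j ` cell e) = topspace X"
    and lift_period: "L (i - i') (j - j') \<Longrightarrow> z \<in> cell e \<Longrightarrow> lift e i j z = lift e i' j' z"
    and lift_ab: "z \<in> segment_ab \<Longrightarrow> lift True i j z = lift False i j z"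
    and lift_ac: "z \<in> segment_ac \<Longrightarrow> lift True i j z = lift False (i + 1) j z"
    and lift_bc: "z \<in> segment_bc \<Longrightarrow> lift True i (j + 1) z = lift False i j z"
    and lift_eqD: "z \<in> cell e \<Longrightarrow> z \<in> cell e' \<Longrightarrow> lift e i j z = lift e' i' j' z \<Longrightarrow>
       equivclp (adjacent L z) (e, i, j) (e', i', j')"
    and L_finite: "\<exists>K>0. \<forall>i j. L (i - i mod K) (j - j mod K)"

section \<open>Construction of the lifted triangulation\<close>

lemma continuous_maps_agree:
  assumes "Hausdorff_space X" "continuous_map (subtopology Y D) X f" "continuous_map (subtopology Y D') X g"
    and "v \<in> D \<inter> D'" "D \<union> D' \<subseteq> topspace Y"
    and "\<And>N. openin Y N \<Longrightarrow> v \<in> N \<Longrightarrow> \<exists>z\<in>N \<inter> D \<inter> D'. f z = g z"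
  shows "f v = g v"
proof (rule ccontr)
  assume ne: "f v \<noteq> g v"
  have "f v \<in> topspace X" "g v \<in> topspace X"
    using assms(2-5) by (auto simp: continuous_map_def Pi_iff)
  then obtain P Q where PQ: "openin X P" "openin X Q" "f v \<in> P" "g v \<in> Q" "disjnt P Q"
    using ne assms(1) unfolding Hausdorff_space_def by metis
  have "openin (subtopology Y D) {z \<in> topspace (subtopology Y D). f z \<in> P}"
    "openin (subtopology Y D') {z \<in> topspace (subtopology Y D'). g z \<in> Q}"
    using assms(2,3) PQ openin_continuous_map_preimage by blast+
  then obtain T T' where T: "openin Y T" "{z \<in> topspace (subtopology Y D). f z \<in> P} = T \<inter> D"
     "openin Y T'" "{z \<in> topspace (subtopology Y D'). g z \<in> Q} = T' \<inter> D'"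
    unfolding openin_subtopology by metis
  have mem: "x \<in> T \<longleftrightarrow> f x \<in> P" if "x \<in> D" for x
  proof -
    have "x \<in> T \<inter> D \<longleftrightarrow> f x \<in> P" unfolding T(2)[symmetric] using that assms(5) by auto
    then show ?thesis using that by blast
  qed
  have mem': "x \<in> T' \<longleftrightarrow> g x \<in> Q" if "x \<in> D'" for x
  proof -
    have "x \<in> T' \<inter> D' \<longleftrightarrow> g x \<in> Q" unfolding T(4)[symmetric] using that assms(5) by auto
    then show ?thesis using that by blast
  qed
  have "openin Y (T \<inter> T')" "v \<in> T \<inter> T'" using T(1,3) mem mem' PQ assms(4) by auto
  then obtain z where "z \<in> T \<inter> T' \<inter> D \<inter> D'" "f z = g z" using assms(6) by blast
  then show False using mem mem' PQ(5) by (auto simp: disjnt_iff)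
qed

lemma segment_subset_cell: "segment_ab \<subseteq> cell e" "segment_ac \<subseteq> cell e" "segment_bc \<subseteq> cell e"
  using equator_subset_cell[of e] equator_eq by auto

lemma vertex_in_cell: "v \<in> vertices \<Longrightarrow> v \<in> cell e"
  using equator_subset_cell[of e] by (auto simp: vertices_def a_vertex_def b_vertex_def c_vertex_def equator_def)

lemma vertices_in_segments [simp]:
  "a_vertex \<in> segment_ab" "b_vertex \<in> segment_ab" "c_vertex \<notin> segment_ab"
  "a_vertex \<in> segment_ac" "b_vertex \<notin> segment_ac" "c_vertex \<in> segment_ac"
  "a_vertex \<notin> segment_bc" "b_vertex \<in> segment_bc" "c_vertex \<in> segment_bc"
  by (simp_all add: bary_faces[symmetric])

lemma vertices_distinct [simp]:
  "a_vertex \<noteq> b_vertex" "a_vertex \<noteq> c_vertex" "b_vertex \<noteq> c_vertex"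
  "b_vertex \<noteq> a_vertex" "c_vertex \<noteq> a_vertex" "c_vertex \<noteq> b_vertex"
  by (simp_all add: a_vertex_def b_vertex_def c_vertex_def)

lemma vertex_on_segment:
  assumes "v \<in> vertices" obtains J where "J = segment_ab \<or> J = segment_ac \<or> J = segment_bc" "v \<in> J"
  using assms vertices_in_segments unfolding vertices_def by blast

lemma closedin_segments:
  "closedin riemann_sphere segment_ab" "closedin riemann_sphere segment_ac" "closedin riemann_sphere segment_bc"
proof -
  have "closedin riemann_sphere {z \<in> topspace riemann_sphere. f z \<in> {0}}"
    if "continuous_map riemann_sphere euclideanreal f" for f
    by (rule closedin_continuous_map_preimage[OF that]) simp
  from this[OF continuous_bary_c] this[OF continuous_bary_b] this[OF continuous_bary_a]
  show "closedin riemann_sphere segment_ab" "closedin riemann_sphere segment_ac" "closedin riemann_sphere segment_bc"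
    unfolding topspace_riemann_sphere by (simp_all add: bary_faces)
qed

lemma continuous_map_the:
  "continuous_map (subtopology riemann_sphere (Some ` D)) (top_of_set D) the"
proof -
  have "homeomorphic_map euclidean (subtopology riemann_sphere (range Some)) Some"
    using embedding_map_Some[of "euclidean :: complex topology"] by (simp add: embedding_map_def)
  then obtain g where g: "homeomorphic_maps euclidean (subtopology riemann_sphere (range Some)) Some g"
    by (auto simp: homeomorphic_map_maps)
  then have "continuous_map (subtopology riemann_sphere (range Some)) euclidean g" "\<And>w. g (Some w) = w"
    by (auto simp: homeomorphic_maps_def)
  moreover have "subtopology riemann_sphere (Some ` D) = subtopology (subtopology riemann_sphere (range Some)) (Some ` D)"
    by (simp add: subtopology_subtopology Int_absorb1 image_mono)
  ultimately have "continuous_map (subtopology riemann_sphere (Some ` D)) (top_of_set D) g"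
    by (auto simp: continuous_map_from_subtopology continuous_map_in_subtopology)
  then show ?thesis
    by (rule continuous_map_eq) (use \<open>\<And>w. g (Some w) = w\<close> in auto)
qed

text \<open>The adjugate matrix shows that the determinant annihilates the quotient of \<int>^2 by
  the lattice.\<close>

lemma (in exponent_matrix) lattice_mod:
  "lattice A B C D (i - i mod (int A * int D - int B * int C)) (j - j mod (int A * int D - int B * int C))"
proof -
  define m where "m = int A * int D - int B * int C"
  have "i - i mod m = int A * (int D * (i div m) - int B * (j div m)) + int B * (int A * (j div m) - int C * (i div m))"
    "j - j mod m = int C * (int D * (i div m) - int B * (j div m)) + int D * (int A * (j div m) - int C * (i div m))"
    unfolding minus_mod_eq_mult_div by (simp_all add: m_def algebra_simps)
  then show ?thesis unfolding lattice_def m_def[symmetric] by blast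
qed

lemma (in exponent_matrix) triangulated_cover_of_quotient:
  assumes cm: "compactified_milnor_fiber W X Ch S \<kappa>" and quot: "symmetry_quotient W h X S \<kappa> pr"
    and W: "\<And>x y. W (x, y) = x ^ A * y ^ B + x ^ C * y ^ D"
    and h: "\<And>x y. h (x, y) = x ^ A * y ^ B"
    and fin: "finite {z. W z = 1 \<and> h z \<in> {0, 1}}"
  shows "\<exists>lift. triangulated_cover X pr lift (lattice A B C D)"
proof -
  have pr: "continuous_map X riemann_sphere pr"
    using quot quotient_imp_continuous_map by (auto simp: symmetry_quotient_def)
  have pr_h: "pr x = Some (h (\<kappa> x))" if "x \<in> topspace X - S" for x
    using quot that by (auto simp: symmetry_quotient_def)
  let ?L = "lattice A B C D"
  have rs: "closed_riemann_surface X Ch" and S: "finite S" "S \<subseteq> topspace X"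
    and "homeomorphic_map (subtopology X (topspace X - S)) (top_of_set (milnor_fiber W)) \<kappa>"
    using cm by (auto simp: compactified_milnor_fiber_def)
  then obtain g where g: "homeomorphic_maps (subtopology X (topspace X - S)) (top_of_set (milnor_fiber W)) \<kappa> g"
    by (auto simp: homeomorphic_map_maps)
  have HX: "Hausdorff_space X" and cX: "compact_space X"
    using rs by (auto simp: closed_riemann_surface_def)
  have gX: "g w \<in> topspace X - S" "\<kappa> (g w) = w" if "w \<in> milnor_fiber W" for w
    using g that by (auto simp: homeomorphic_maps_def continuous_map_def Pi_iff)
  have \<kappa>W: "\<kappa> x \<in> milnor_fiber W" "g (\<kappa> x) = x" if "x \<in> topspace X - S" for x
    using g that by (auto simp: homeomorphic_maps_def continuous_map_def Pi_iff)
  have gcont: "continuous_map (top_of_set (milnor_fiber W)) X g"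
    using g by (auto simp: homeomorphic_maps_def continuous_map_in_subtopology)
  have vert: "Some w \<in> vertices \<longleftrightarrow> w = 0 \<or> w = 1" "None \<in> vertices" for w
    by (auto simp: vertices_def a_vertex_def b_vertex_def c_vertex_def)
  \<comment> \<open>A point over a vertex is either one of the filled punctures or a point of the
    Milnor fiber where \<open>h\<close> is 0 or 1; the value \<infinity> occurs at punctures
    only.\<close>
  have Ffin: "finite {x \<in> topspace X. pr x \<in> vertices}"
  proof (rule finite_subset)
    show "{x \<in> topspace X. pr x \<in> vertices} \<subseteq> S \<union> g ` {z. W z = 1 \<and> h z \<in> {0, 1}}"
    proof
      fix x assume x: "x \<in> {x \<in> topspace X. pr x \<in> vertices}"
      show "x \<in> S \<union> g ` {z. W z = 1 \<and> h z \<in> {0, 1}}"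
      proof (cases "x \<in> S")
        case False
        then have "x \<in> topspace X - S" using x by auto
        then have "h (\<kappa> x) \<in> {0, 1}" "W (\<kappa> x) = 1" "g (\<kappa> x) = x"
          using pr_h[of x] x vert \<kappa>W[of x] by (auto simp: milnor_fiber_def)
        then show ?thesis by (metis (mono_tags, lifting) UnI2 image_eqI mem_Collect_eq)
      qed simp
    qed
  qed (use S fin in auto)
  have fibre: "finite {x \<in> topspace X. pr x = v}" if "v \<in> vertices" for v
    by (rule finite_subset[OF _ Ffin]) (use that in auto)
  have sect_W: "sect e i j w \<in> milnor_fiber W" "h (sect e i j w) = w" if "w \<noteq> 0" "w \<noteq> 1" for e i j w
  proof -
    obtain x y where "sect e i j w = (x, y)" by fastforce
    then show "sect e i j w \<in> milnor_fiber W" "h (sect e i j w) = w"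
      using sect_solves[OF that] by (auto simp: milnor_fiber_def W h)
  qed
  define \<sigma> where "\<sigma> = (\<lambda>e i j z. g (sect e i j (the z)))"
  have ne: "\<exists>w. z = Some w \<and> w \<noteq> 0 \<and> w \<noteq> 1 \<and> (if e then 0 \<le> Im w else Im w \<le> 0)"
    if "z \<in> cell e - vertices" for z e
    using that vert by (cases z) (auto simp: Some_in_cell)
  have \<sigma>_pr: "pr (\<sigma> e i j z) = z" if zc: "z \<in> cell e - vertices" for e i j z
  proof -
    obtain w where w: "z = Some w" "w \<noteq> 0" "w \<noteq> 1" using ne[OF zc] by blast
    show ?thesis
      using pr_h[OF gX(1)[OF sect_W(1)[OF w(2,3)]]] gX(2)[OF sect_W(1)[OF w(2,3)]] sect_W(2)[OF w(2,3)]
      by (simp add: w \<sigma>_def)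
  qed
  have \<sigma>_eq: "\<sigma> e i j z = \<sigma> e' i' j' z \<longleftrightarrow> sect e i j (the z) = sect e' i' j' (the z)"
    if zc: "z \<in> cell e - vertices" for e i j e' i' j' z
  proof -
    obtain w where w: "z = Some w" "w \<noteq> 0" "w \<noteq> 1" using ne[OF zc] by blast
    show ?thesis
      using gX(2)[OF sect_W(1)[OF w(2,3)]] unfolding w \<sigma>_def option.sel by metis
  qed
  have \<sigma>_cont: "continuous_map (subtopology riemann_sphere (cell e - vertices)) X (\<sigma> e i j)" for e i j
  proof -
    let ?H = "{w. if e then 0 \<le> Im w else Im w \<le> 0} - {0, 1}"
    have eq: "cell e - vertices = Some ` ?H"
    proof (intro equalityI subsetI)
      fix z assume "z \<in> cell e - vertices"
      then obtain w where "z = Some w" "w \<noteq> 0" "w \<noteq> 1" "if e then 0 \<le> Im w else Im w \<le> 0"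
        using ne by blast
      then show "z \<in> Some ` ?H" by (intro image_eqI[of _ _ w]) auto
    qed (auto simp: Some_in_cell vert)
    have "continuous_map (top_of_set ?H) (top_of_set (milnor_fiber W)) (sect e i j)"
      using continuous_on_sect[of e i j] sect_W by (auto simp: continuous_map_in_subtopology)
    from continuous_map_compose[OF continuous_map_compose[OF continuous_map_the this] gcont]
    show ?thesis unfolding eq \<sigma>_def by (simp add: o_def)
  qed
  have "\<exists>\<tau>. continuous_map (subtopology riemann_sphere (cell e)) X \<tau> \<and> (\<forall>y\<in>cell e. pr (\<tau> y) = y) \<and>
      (\<forall>y\<in>cell e - vertices. \<tau> y = \<sigma> e i j y)" for e i j
  proof (rule section_extends_to_points[OF cX Hausdorff_riemann_sphere HX pr fibre _ _ \<sigma>_cont \<sigma>_pr])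
    show "cell e \<subseteq> topspace riemann_sphere" by (simp only: topspace_riemann_sphere) simp
    show "finite vertices" by (simp add: vertices_def)
    show "\<exists>N'. openin riemann_sphere N' \<and> v \<in> N' \<and> N' \<subseteq> N \<and> connectedin riemann_sphere (N' \<inter> cell e - {v})"
      if "v \<in> vertices \<inter> cell e" "openin riemann_sphere N" "v \<in> N" for v N
      using punctured_cell_locally_connected that by blast
    show "N \<inter> (cell e - vertices) \<noteq> {}"
      if v: "v \<in> vertices \<inter> cell e" "openin riemann_sphere N" "v \<in> N" for v N
    proof -
      obtain J where J: "J = segment_ab \<or> J = segment_ac \<or> J = segment_bc" "v \<in> J"
        using vertex_on_segment v by blast
      then show ?thesis using segment_accumulates[OF J _ v(2,3)] v segment_subset_cell[of e] by blast
    qed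
  qed
  then obtain lift where lift: "\<And>e i j. continuous_map (subtopology riemann_sphere (cell e)) X (lift e i j)"
    "\<And>e i j z. z \<in> cell e \<Longrightarrow> pr (lift e i j z) = z"
    "\<And>e i j z. z \<in> cell e - vertices \<Longrightarrow> lift e i j z = \<sigma> e i j z" by metis
  \<comment> \<open>An identity between two lifts on a segment without its ends extends to the ends,
    as \<open>X\<close> is Hausdorff.\<close>
  have agree: "lift e i j z = lift e' i' j' z"
    if J: "J = segment_ab \<or> J = segment_ac \<or> J = segment_bc" "z \<in> J"
      and eq: "\<And>z. z \<in> J - vertices \<Longrightarrow> lift e i j z = lift e' i' j' z" for J z e e' i i' j j'
  proof (cases "z \<in> vertices")
    case True
    show ?thesis
    proof (rule continuous_maps_agree[OF HX lift(1) lift(1)])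
      show "z \<in> cell e \<inter> cell e'" using True vertex_in_cell by auto
      show "cell e \<union> cell e' \<subseteq> topspace riemann_sphere" by (simp only: topspace_riemann_sphere) simp
      fix N assume "openin riemann_sphere N" "z \<in> N"
      then obtain x where "x \<in> N \<inter> J" "x \<notin> vertices" using segment_accumulates J True by metis
      then show "\<exists>z\<in>N \<inter> cell e \<inter> cell e'. lift e i j z = lift e' i' j' z"
        using eq[of x] J(1) segment_subset_cell[of e] segment_subset_cell[of e'] by blast
    qed
  qed (use eq J in blast)
  have period: "lift e i j z = lift e i' j' z" if "?L (i - i') (j - j')" "z \<in> cell e" for e i j i' j' z
  proof -
    have eq: "lift e i j z = lift e i' j' z" if z: "z \<in> cell e - vertices" for z
      using lift(3) z \<sigma>_eq[OF z] sect_eq_iff \<open>?L (i - i') (j - j')\<close> by simp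
    show ?thesis
    proof (cases "z \<in> vertices")
      case True
      then obtain J where J: "J = segment_ab \<or> J = segment_ac \<or> J = segment_bc" "z \<in> J"
        by (rule vertex_on_segment)
      show ?thesis
        by (rule agree[OF J eq]) (use J(1) segment_subset_cell[of e] in blast)
    qed (use eq that in blast)
  qed
  have real: "\<exists>x. z = Some (complex_of_real x) \<and> x \<noteq> 0 \<and> x \<noteq> 1 \<and> (z \<in> segment_ab \<longleftrightarrow> 0 < x \<and> x < 1) \<and>
      (z \<in> segment_ac \<longleftrightarrow> x < 0) \<and> (z \<in> segment_bc \<longleftrightarrow> 1 < x)"
    if "z \<in> equator - vertices" for z
    using that by (auto simp: equator_def Reals_def vert segment_ab_def segment_ac_def segment_bc_def less_le)
  have seg: "lift True i j z = lift False i' j' z \<longleftrightarrow> sect True i j (the z) = sect False i' j' (the z)"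
    if "z \<in> equator - vertices" for z i j i' j'
    using that equator_subset_cell \<sigma>_eq lift(3)
    by (metis DiffD1 DiffD2 DiffI subsetD)
  have ab: "lift True i j z = lift False i j z" if z: "z \<in> segment_ab" for i j z
  proof (rule agree[OF _ z])
    show "lift True i j z = lift False i j z" if "z \<in> segment_ab - vertices" for z
    proof -
      have z: "z \<in> equator - vertices" "z \<in> segment_ab" using that equator_eq by auto
      then show ?thesis using real[OF z(1)] unfolding seg[OF z(1)] by (auto simp: sect_ab)
    qed
  qed simp
  have ac: "lift True i j z = lift False (i + 1) j z" if z: "z \<in> segment_ac" for i j z
  proof (rule agree[OF _ z])
    show "lift True i j z = lift False (i + 1) j z" if "z \<in> segment_ac - vertices" for z
    proof -
      have z: "z \<in> equator - vertices" "z \<in> segment_ac" using that equator_eq by auto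
      then show ?thesis using real[OF z(1)] unfolding seg[OF z(1)] by (auto simp: sect_ac)
    qed
  qed simp
  have bc: "lift True i (j + 1) z = lift False i j z" if z: "z \<in> segment_bc" for i j z
  proof (rule agree[OF _ z])
    show "lift True i (j + 1) z = lift False i j z" if "z \<in> segment_bc - vertices" for z
    proof -
      have z: "z \<in> equator - vertices" "z \<in> segment_bc" using that equator_eq by auto
      then show ?thesis using real[OF z(1)] unfolding seg[OF z(1)] by (auto simp: sect_bc)
    qed
  qed simp
  have same: "?L (i - i') (j - j')" if "z \<in> cell e - vertices" "lift e i j z = lift e i' j' z" for e i j i' j' z
    using that lift(3) \<sigma>_eq[OF that(1)] sect_eq_iff by metis
  \<comment> \<open>The point \<open>v\<close> is kept apart from \<open>z\<close> for the sake of
    vertices: when \<open>z\<close> is near a vertex \<open>v\<close>, every segment through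
    \<open>z\<close> also passes through \<open>v\<close>, so adjacencies at \<open>z\<close> are
    adjacencies at \<open>v\<close>.\<close>
  have mixed: "equivclp (adjacent ?L v) (True, i, j) (False, i', j')"
    if z: "z \<in> equator - vertices" and eq: "lift True i j z = lift False i' j' z"
      and v: "z \<in> segment_ab \<Longrightarrow> v \<in> segment_ab" "z \<in> segment_ac \<Longrightarrow> v \<in> segment_ac"
        "z \<in> segment_bc \<Longrightarrow> v \<in> segment_bc" for i j i' j' z v
  proof -
    \<comment> \<open>After one crossing at \<open>z\<close>, two lower lifts agree at
      \<open>z\<close>; by \<open>same\<close> they then differ by a period.\<close>
    have step: ?thesis if "adjacent ?L v (True, i, j) (False, i'', j'')" "lift True i j z = lift False i'' j'' z" for i'' j''
    proof -
      have "?L (i'' - i') (j'' - j')"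
        using same[of z False] z equator_subset_cell eq that(2) by (metis DiffD1 DiffD2 DiffI subsetD)
      then have "adjacent ?L v (False, i'', j'') (False, i', j')" by (rule adjacent.period)
      then show ?thesis
        using that(1) by (blast intro: equivclp_trans r_into_equivclp)
    qed
    consider "z \<in> segment_ab" | "z \<in> segment_ac" | "z \<in> segment_bc" using z equator_eq by auto
    then show ?thesis
    proof cases
      case 1 then show ?thesis using step across_ab v ab by metis
    next
      case 2 then show ?thesis using step across_ac v ac by metis
    next
      case 3
      have "adjacent ?L v (True, i, j) (False, i, j - 1)" using across_bc[of v ?L i "j - 1"] v 3 by simp
      then show ?thesis using step bc[OF 3, of i "j - 1"] by simp
    qed
  qed
  have near: "equivclp (adjacent ?L v) (e, i, j) (e', i', j')"
    if z: "z \<notin> vertices" "z \<in> cell e" "z \<in> cell e'" and eq: "lift e i j z = lift e' i' j' z"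
      and v: "z \<in> segment_ab \<Longrightarrow> v \<in> segment_ab" "z \<in> segment_ac \<Longrightarrow> v \<in> segment_ac"
        "z \<in> segment_bc \<Longrightarrow> v \<in> segment_bc" for e i j e' i' j' z v
  proof (cases "e = e'")
    case True
    have "?L (i - i') (j - j')" using True same[of z e] z eq by simp
    then show ?thesis unfolding True[symmetric] by (intro r_into_equivclp adjacent.period)
  next
    case False
    then have z': "z \<in> equator - vertices" using cell_Int[of z] z by (cases e) auto
    show ?thesis
    proof (cases e)
      case True
      then show ?thesis using mixed[OF z' _ v] eq False by simp
    next
      case F: False
      then have "equivclp (adjacent ?L v) (e', i', j') (e, i, j)" using mixed[OF z' _ v] eq False by simp
      then show ?thesis by (rule equivclp_sym)
    qed
  qed
  define m where "m = int A * int D - int B * int C"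
  have m: "m > 0" "\<And>i j. ?L (i - i mod m) (j - j mod m)"
    using det_pos lattice_mod by (auto simp: m_def)
  let ?im = "\<lambda>(e, i, j). lift e i j ` cell e"
  have finim: "finite (range ?im)"
  proof (rule finite_subset)
    show "range ?im \<subseteq> ?im ` (UNIV \<times> {0..<m} \<times> {0..<m})"
    proof clarify
      fix e i j
      have "lift e i j ` cell e = lift e (i mod m) (j mod m) ` cell e"
        by (intro image_cong refl period m)
      then show "lift e i j ` cell e \<in> ?im ` (UNIV \<times> {0..<m} \<times> {0..<m})"
        using m(1) by (intro image_eqI[of _ _ "(e, i mod m, j mod m)"]) auto
    qed
  qed simp
  have liftX: "lift e i j z \<in> topspace X" if "z \<in> cell e" for e i j z
    using continuous_map_image_subset_topspace[OF lift(1)[of e i j]] that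
    unfolding topspace_cell by blast
  have comp: "compactin X (?im t)" for t
  proof -
    obtain e i j where t: "t = (e, i, j)" by (metis prod_cases3)
    show ?thesis unfolding t prod.case
      by (rule image_compactin[OF _ lift(1)]) (simp add: compactin_subtopology compactin_cell)
  qed
  define im where "im = ?im"
  have im: "finite (range im)" "\<And>t. closedin X (im t)" "\<And>e i j. im (e, i, j) = lift e i j ` cell e"
    using finim compactin_imp_closedin[OF HX comp] by (auto simp: im_def)
  \<comment> \<open>The finitely many images are closed. A nonempty open complement would be
    infinite, but only points over the vertices and points of \<open>S\<close> can escape the
    lifts.\<close>
  have cover: "(\<Union>t. im t) = topspace X"
  proof (rule ccontr)
    assume "(\<Union>t. im t) \<noteq> topspace X"
    moreover have "im t \<subseteq> topspace X" for t using im(2) by (rule closedin_subset)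
    ultimately obtain P where P: "P \<in> topspace X - (\<Union>t. im t)" by blast
    have "closedin X (\<Union>t. im t)"
    proof (rule closedin_Union[OF im(1)])
      show "closedin X T" if "T \<in> range im" for T
        using that im(2) by blast
    qed
    then have "openin X (topspace X - (\<Union>t. im t))" by blast
    then obtain U where U: "openin X U" "U \<subseteq> topspace X - (\<Union>t. im t)" "infinite U"
      using closed_riemann_surface_local[OF rs _ P] by metis
    have "U \<subseteq> {x \<in> topspace X. pr x \<in> vertices} \<union> S"
    proof
      fix x assume x: "x \<in> U"
      show "x \<in> {x \<in> topspace X. pr x \<in> vertices} \<union> S"
      proof (rule ccontr)
        assume n: "x \<notin> {x \<in> topspace X. pr x \<in> vertices} \<union> S"
        have xX: "x \<in> topspace X - S" "pr x \<notin> vertices" using x U n by auto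
        obtain a b where ab: "\<kappa> x = (a, b)" by fastforce
        define w where "w = h (\<kappa> x)"
        have prx: "pr x = Some w" using pr_h xX by (simp add: w_def)
        then have w: "w \<noteq> 0" "w \<noteq> 1" using xX vert by auto
        have "a ^ A * b ^ B = w" "a ^ C * b ^ D = 1 - w"
          using \<kappa>W[OF xX(1)] W[of a b] h[of a b] unfolding w_def ab by (auto simp: milnor_fiber_def algebra_simps)
        then obtain e :: bool and i j where e: "Some w \<in> cell e" "(a, b) = sect e i j w"
          using sect_exhausts[OF w] Some_in_cell by (metis linear)
        have "lift e i j (Some w) = x"
          using lift(3)[of "Some w" e i j] e xX prx \<kappa>W[OF xX(1)] ab by (simp add: \<sigma>_def)
        then have "x \<in> (\<Union>t. im t)" using e im(3)[of e i j] by blast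
        then show False using x U by blast
      qed
    qed
    then show False using U(3) Ffin S finite_subset by blast
  qed
  show ?thesis
  proof (intro exI[of _ lift], unfold_locales)
    show "Hausdorff_space X" "continuous_map X riemann_sphere pr" by fact+
    show "(\<Union>e i j. lift e i j ` cell e) = topspace X"
      unfolding cover[symmetric] by (auto simp: im_def)
    show "\<exists>K>0. \<forall>i j. ?L (i - i mod K) (j - j mod K)" using m by blast
    show "equivclp (adjacent ?L z) (e, i, j) (e', i', j')"
      if hyp: "z \<in> cell e" "z \<in> cell e'" "lift e i j z = lift e' i' j' z" for e e' i j i' j' z
    proof (cases "z \<in> vertices")
      case False
      then show ?thesis using near[of z e e'] hyp by blast
    next
      case True
      \<comment> \<open>The side opposite to the vertex. Off it lie no other vertices and only
        points of segments through \<open>z\<close>.\<close>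
      define opp where "opp = (if z = a_vertex then segment_bc else if z = b_vertex then segment_ac else segment_ab)"
      have z: "z = a_vertex \<and> opp = segment_bc \<or> z = b_vertex \<and> opp = segment_ac \<or> z = c_vertex \<and> opp = segment_ab"
        using True by (auto simp: opp_def vertices_def)
      have opp1: "closedin riemann_sphere opp" using z closedin_segments by metis
      have opp2: "z \<notin> opp" "vertices - {z} \<subseteq> opp" using z by (auto simp: vertices_def)
      have opp3: "x \<in> segment_ab \<Longrightarrow> z \<in> segment_ab" "x \<in> segment_ac \<Longrightarrow> z \<in> segment_ac"
        "x \<in> segment_bc \<Longrightarrow> z \<in> segment_bc" if "x \<notin> opp" for x
        using z that by auto
      let ?lift = "\<lambda>(e, i, j). lift e i j" and ?D = "\<lambda>(e, i, j). cell e"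
      show ?thesis
      proof (rule sections_meeting_over_point[where \<sigma> = ?lift and D = ?D and f = pr and Y = riemann_sphere
            and v = z and N = "topspace riemann_sphere - opp", OF HX pr])
        show "equivp (equivclp (adjacent ?L z))" by (simp add: equivp_evquivclp)
        show "finite {x \<in> topspace X. pr x = z}" using fibre True by blast
        show "openin riemann_sphere (topspace riemann_sphere - opp)" using opp1 by blast
        show "z \<in> topspace riemann_sphere - opp" using opp2(1) by (simp only: topspace_riemann_sphere) simp
        show "\<exists>U. openin X U \<and> P \<in> U \<and> U \<subseteq> W \<and> connectedin X (U - {P})"
          if "openin X W" "P \<in> W" for P W
          using closed_riemann_surface_local[OF rs that] by metis
        show "finite (range (\<lambda>t. ?lift t ` ?D t))"
          using finim by (simp add: case_prod_unfold)
        show "(\<Union>t. ?lift t ` ?D t) = topspace X"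
          using cover by (simp add: im_def case_prod_unfold)
        show "\<exists>x\<in>N \<inter> ?D s. x \<noteq> z" if N: "openin riemann_sphere N" "z \<in> N" "z \<in> ?D s" for N s
        proof -
          obtain J where J: "J = segment_ab \<or> J = segment_ac \<or> J = segment_bc" "z \<in> J"
            using vertex_on_segment True by blast
          obtain x where "x \<in> N \<inter> J" "x \<notin> vertices" using segment_accumulates[OF J True N(1,2)] by blast
          then show ?thesis using J(1) segment_subset_cell[of "fst s"] True
            by (intro bexI[of _ x]) (auto simp: case_prod_unfold)
        qed
        show "equivclp (adjacent ?L z) s s'"
          if "x \<in> topspace riemann_sphere - opp - {z}" "x \<in> ?D s" "x \<in> ?D s'" "?lift s x = ?lift s' x" for s s' x
        proof -
          obtain e i j e' i' j' where s: "s = (e, i, j)" "s' = (e', i', j')" by (metis prod_cases3)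
          have "x \<notin> vertices" "x \<notin> opp" using that opp2(2) by auto
          then show ?thesis
            using near[of x e e' i j i' j' z] that(2-4) opp3[of x] unfolding s prod.case by blast
        qed
      qed (use hyp lift(1,2) compactin_cell in \<open>auto simp: case_prod_unfold\<close>)
    qed
  qed (use lift period ab ac bc in auto)
qed

section \<open>Gluing a polygon\<close>

text \<open>Serves for the polygon and for the surface. Each section inverts \<open>f\<close> on its
  tile, and \<open>same\<close> says that tiles with a common point off the equator
  coincide.\<close>

lemma tessellation_by_sections:
  assumes f: "continuous_map Y riemann_sphere f"
    and s: "\<And>e i j. continuous_map (subtopology riemann_sphere (cell e)) Y (s e i j)"
    and fs: "\<And>e i j z. z \<in> cell e \<Longrightarrow> f (s e i j z) = z"
    and cover: "(\<Union>(e, i, j). s e i j ` cell e) = topspace Y"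
    and fin: "finite (range (\<lambda>(e, i, j). s e i j ` cell e))"
    and same: "\<And>e i j e' i' j' z. z \<in> cell e \<Longrightarrow> z \<in> cell e' \<Longrightarrow> z \<notin> equator \<Longrightarrow>
        s e i j z = s e' i' j' z \<Longrightarrow> s e i j ` cell e = s e' i' j' ` cell e'"
  shows "tessellation_by_lifts Y f (range (\<lambda>(e, i, j). s e i j ` cell e))"
  unfolding tessellation_by_lifts_def
proof (intro conjI ballI impI)
  show "finite (range (\<lambda>(e, i, j). s e i j ` cell e))" by (fact fin)
  show "\<Union> (range (\<lambda>(e, i, j). s e i j ` cell e)) = topspace Y" using cover by simp
next
  fix T assume "T \<in> range (\<lambda>(e, i, j). s e i j ` cell e)"
  then obtain e i j where T: "T = s e i j ` cell e" by auto
  have TY: "T \<subseteq> topspace Y"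
    unfolding T using continuous_map_image_subset_topspace[OF s] unfolding topspace_cell .
  have "continuous_map (subtopology Y T) (subtopology riemann_sphere (cell e)) f"
    using continuous_map_from_subtopology[OF f] fs by (auto simp: continuous_map_in_subtopology T)
  moreover have "continuous_map (subtopology riemann_sphere (cell e)) (subtopology Y T) (s e i j)"
    unfolding continuous_map_in_subtopology topspace_cell using s by (auto simp: T)
  ultimately have "homeomorphic_maps (subtopology Y T) (subtopology riemann_sphere (cell e)) f (s e i j)"
    unfolding homeomorphic_maps_def topspace_cell using fs by (auto simp: T)
  then have "homeomorphic_map (subtopology Y T) (subtopology riemann_sphere (cell e)) f"
    by (auto simp: homeomorphic_map_maps)
  then show "\<exists>H\<in>{upper_cell, lower_cell}. homeomorphic_map (subtopology Y T) (subtopology riemann_sphere H) f"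
    by (cases e) (auto simp: cell_def)
next
  fix T T'
  assume "T \<in> range (\<lambda>(e, i, j). s e i j ` cell e)" "T' \<in> range (\<lambda>(e, i, j). s e i j ` cell e)" and ne: "T \<noteq> T'"
  then obtain t t' where "T = (\<lambda>(e, i, j). s e i j ` cell e) t" "T' = (\<lambda>(e, i, j). s e i j ` cell e) t'" by blast
  then obtain e i j e' i' j' where T: "T = s e i j ` cell e" "T' = s e' i' j' ` cell e'"
    by (cases t; cases t') simp
  show "f ` (T \<inter> T') \<subseteq> equator"
  proof (rule image_subsetI)
    fix x assume "x \<in> T \<inter> T'"
    then obtain z z' where z: "z \<in> cell e" "x = s e i j z" "z' \<in> cell e'" "x = s e' i' j' z'" by (auto simp: T)
    then have "f x = z" "z' = z" using fs by metis+
    then show "f x \<in> equator" using same[of z e e' i j i' j'] z ne T by metis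
  qed
qed

lemma equivclp_imp_equivp:
  assumes "equivclp r x y" "equivp R" "\<And>x y. r x y \<Longrightarrow> R x y"
  shows "R x y"
  using assms(1)
proof (induction rule: equivclp_induct)
  case base
  then show ?case using assms(2) by (simp add: equivp_reflp)
next
  case (step y z)
  then show ?case using assms(2,3) by (meson equivp_symp equivp_transp)
qed

lemma cis_eq_iff: "cis x = cis y \<longleftrightarrow> (\<exists>n::int. x = y + 2 * of_int n * pi)"
  unfolding cis_conv_exp exp_eq by (simp add: complex_eq_iff)

lemma polygon_vertex_eq_iff:
  assumes "0 < n"
  shows "polygon_vertex n k = polygon_vertex n l \<longleftrightarrow> int n dvd k - l"
proof -
  have "2 * pi * real_of_int k / real n = 2 * pi * real_of_int l / real n + 2 * of_int m * pi \<longleftrightarrow>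
      k - l = int n * m" for m
  proof -
    have "2 * pi * real_of_int k / real n = 2 * pi * real_of_int l / real n + 2 * of_int m * pi \<longleftrightarrow>
      (2 * pi) * real_of_int (k - l) = (2 * pi) * real_of_int (int n * m)"
      using assms by (simp add: field_simps)
    also have "\<dots> \<longleftrightarrow> k - l = int n * m" unfolding mult_cancel_left of_int_eq_iff by simp
    finally show ?thesis .
  qed
  then show ?thesis unfolding polygon_vertex_def cis_eq_iff dvd_def by simp
qed

lemma inj_on_edge:
  assumes "2 \<le> n" shows "inj_on (edge n k) {0..1}"
proof -
  have "polygon_vertex n k \<noteq> polygon_vertex n (k + 1)"
    using assms polygon_vertex_eq_iff[of n k "k + 1"] by auto
  then show ?thesis unfolding edge_def by (rule inj_on_linepath)
qed

section \<open>From tile maps into the polygon to a presentation of the surface\<close>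

context triangulated_cover
begin

lemma finite_images:
  assumes "\<And>e i j i' j' z. L (i - i') (j - j') \<Longrightarrow> z \<in> cell e \<Longrightarrow> s e i j z = s e i' j' z"
  shows "finite (range (\<lambda>(e, i, j). s e i j ` cell e))"
proof -
  obtain K where K: "K > 0" "\<And>i j. L (i - i mod K) (j - j mod K)" using L_finite by blast
  show ?thesis
  proof (rule finite_subset)
    show "range (\<lambda>(e, i, j). s e i j ` cell e) \<subseteq> (\<lambda>(e, i, j). s e i j ` cell e) ` (UNIV \<times> {0..<K} \<times> {0..<K})"
    proof clarify
      fix e i j
      have "s e i j ` cell e = s e (i mod K) (j mod K) ` cell e"
        by (intro image_cong refl assms K(2))
      then show "s e i j ` cell e \<in> (\<lambda>(e, i, j). s e i j ` cell e) ` (UNIV \<times> {0..<K} \<times> {0..<K})"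
        using K(1) by (intro image_eqI[of _ _ "(e, i mod K, j mod K)"]) auto
    qed
  qed simp
qed

text \<open>Off the equator all adjacencies are periods, and these do not change the tile. The
  family \<open>s\<close> is free, so that coincidences of lifts also identify tiles of the
  polygon.\<close>

lemma same_tile:
  assumes period: "\<And>e i j i' j' z. L (i - i') (j - j') \<Longrightarrow> z \<in> cell e \<Longrightarrow> s e i j z = s e i' j' z"
    and z: "z \<in> cell e" "z \<in> cell e'" "z \<notin> equator" and eq: "lift e i j z = lift e' i' j' z"
  shows "s e i j ` cell e = s e' i' j' ` cell e'"
proof -
  let ?R = "\<lambda>t t'. (\<lambda>(e, i, j). s e i j ` cell e) t = (\<lambda>(e, i, j). s e i j ` cell e) t'"
  have "?R (e, i, j) (e', i', j')"
  proof (rule equivclp_imp_equivp[OF lift_eqD[OF z(1,2) eq], where R = ?R])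
    show "equivp ?R" by (rule equivpI) (auto simp: reflp_def symp_def transp_def)
    show "?R t t'" if "adjacent L z t t'" for t t'
      using that
    proof cases
      case (period i i' j j' e)
      then show ?thesis using assms(1)[OF period(3), of _ e] by (auto intro!: image_cong)
    qed (use z(3) equator_eq in auto)
  qed
  then show ?thesis by simp
qed

text \<open>The maps \<open>E\<close> place the cells in the polygon, and \<open>E_eqD\<close>
  forbids them to overlap more than the lifts do. Gluings of lifts must come from equality in the
  polygon or from the edge pattern, and conversely every instance of the pattern must come from a
  gluing. Odd edges are required to lie on tiles \<open>E False\<close> because the presentation
  wants the lower cell on their left.\<close>

theorem polygon_presentationI:
  fixes E :: "bool \<Rightarrow> int \<Rightarrow> int \<Rightarrow> complex option \<Rightarrow> complex"
  assumes n: "2 \<le> n"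
    and E_cont: "\<And>e i j. continuous_map (subtopology riemann_sphere (cell e)) euclidean (E e i j)"
    and E_cover: "(\<Union>e i j. E e i j ` cell e) = polygon n"
    and E_period: "\<And>e i j i' j' z. L (i - i') (j - j') \<Longrightarrow> z \<in> cell e \<Longrightarrow> E e i j z = E e i' j' z"
    and E_ab: "\<And>z i j. z \<in> segment_ab \<Longrightarrow> equivclp (edge_pattern n r) (E True i j z) (E False i j z)"
    and E_ac: "\<And>z i j. z \<in> segment_ac \<Longrightarrow> equivclp (edge_pattern n r) (E True i j z) (E False (i + 1) j z)"
    and E_bc: "\<And>z i j. z \<in> segment_bc \<Longrightarrow> equivclp (edge_pattern n r) (E True i (j + 1) z) (E False i j z)"
    and E_eqD: "\<And>e i j e' i' j' z w. z \<in> cell e \<Longrightarrow> w \<in> cell e' \<Longrightarrow> E e i j z = E e' i' j' w \<Longrightarrow>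
        z = w \<and> lift e i j z = lift e' i' j' w"
    and pattern: "\<And>x y. edge_pattern n r x y \<Longrightarrow> \<exists>e i j e' i' j' z. z \<in> cell e \<and> z \<in> cell e' \<and>
        x = E e i j z \<and> y = E e' i' j' z \<and> lift e i j z = lift e' i' j' z"
    and J: "J \<subseteq> cell False" "u \<in> J" "v \<in> J"
    and edges: "\<And>k. odd k \<Longrightarrow> \<exists>i j. E False i j ` J = path_image (edge n k) \<and>
        E False i j u = edge n k 0 \<and> E False i j v = edge n k 1"
  shows "polygon_presentation X pr n r J u v"
proof -
  define tile where "tile = (\<lambda>(e, i, j). E e i j ` cell e)"
  have En: "E e i j z \<in> polygon n" if "z \<in> cell e" for e i j z using E_cover that by blast
  have ex: "\<exists>e i j z. z \<in> cell e \<and> P = E e i j z" if "P \<in> polygon n" for P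
    using that unfolding E_cover[symmetric] by blast
  \<comment> \<open>The gluing map is forced on every tile; \<open>E_eqD\<close> makes the choice
    unambiguous.\<close>
  define \<Phi> where "\<Phi> = (\<lambda>P. SOME x. \<exists>e i j z. z \<in> cell e \<and> P = E e i j z \<and> x = lift e i j z)"
  have \<Phi>: "\<Phi> (E e i j z) = lift e i j z" if z: "z \<in> cell e" for e i j z
    unfolding \<Phi>_def
  proof (rule some_equality)
    show "\<exists>e' i' j' w. w \<in> cell e' \<and> E e i j z = E e' i' j' w \<and> lift e i j z = lift e' i' j' w"
      using z by blast
    show "x = lift e i j z"
      if x: "\<exists>e' i' j' w. w \<in> cell e' \<and> E e i j z = E e' i' j' w \<and> x = lift e' i' j' w" for x
    proof -
      obtain e' i' j' w where w: "w \<in> cell e'" "E e i j z = E e' i' j' w" "x = lift e' i' j' w"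
        using x by blast
      show ?thesis using E_eqD[OF z w(1,2)] w(3) by metis
    qed
  qed
  have compact_im: "compact (E e i j ` {z \<in> cell e. lift e i j z \<in> C})" if "closedin X C" for e i j C
  proof -
    have "closedin (subtopology riemann_sphere (cell e)) {z \<in> topspace (subtopology riemann_sphere (cell e)). lift e i j z \<in> C}"
      by (rule closedin_continuous_map_preimage[OF lift_cont that])
    then have "compactin (subtopology riemann_sphere (cell e)) {z \<in> cell e. lift e i j z \<in> C}"
      unfolding topspace_cell using compact_space_cell closedin_compact_space by blast
    then have "compactin euclidean (E e i j ` {z \<in> cell e. lift e i j z \<in> C})"
      using image_compactin E_cont by blast
    then show ?thesis by simp
  qed
  \<comment> \<open>Continuity of \<Phi> is obtained from closed sets: preimages are unions of
    compact images of pieces of cells, and by periodicity finitely many of these suffice.\<close>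
  have compact_pre: "compact {P \<in> polygon n. \<Phi> P \<in> C}" if C: "closedin X C" for C
  proof -
    define F where "F = (\<lambda>e i j. E e i j ` {z \<in> cell e. lift e i j z \<in> C})"
    obtain K where K: "K > 0" "\<And>i j. L (i - i mod K) (j - j mod K)" using L_finite by blast
    have mod: "F e i j = F e (i mod K) (j mod K)" for e i j
    proof -
      have 1: "lift e i j z = lift e (i mod K) (j mod K) z" if "z \<in> cell e" for z
        by (rule lift_period[OF K(2) that])
      have "{z \<in> cell e. lift e i j z \<in> C} = {z \<in> cell e. lift e (i mod K) (j mod K) z \<in> C}"
        by (intro Collect_cong conj_cong refl) (metis 1)
      then show ?thesis
        unfolding F_def by (rule image_cong) (use E_period[OF K(2)] in blast)
    qed
    have "{P \<in> polygon n. \<Phi> P \<in> C} = (\<Union>e i j. F e i j)"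
    proof (intro equalityI subsetI)
      fix P assume P: "P \<in> {P \<in> polygon n. \<Phi> P \<in> C}"
      then obtain e i j z where t: "z \<in> cell e" "P = E e i j z" using ex by blast
      then have "lift e i j z \<in> C" using P \<Phi> by simp
      then show "P \<in> (\<Union>e i j. F e i j)" unfolding F_def using t by blast
    next
      fix P assume "P \<in> (\<Union>e i j. F e i j)"
      then obtain e i j z where t: "z \<in> cell e" "P = E e i j z" "lift e i j z \<in> C"
        unfolding F_def by blast
      then show "P \<in> {P \<in> polygon n. \<Phi> P \<in> C}" using En \<Phi> by simp
    qed
    also have "\<dots> = (\<Union>e\<in>UNIV. \<Union>i\<in>{0..<K}. \<Union>j\<in>{0..<K}. F e i j)"
    proof (intro equalityI subsetI)
      fix x assume "x \<in> (\<Union>e i j. F e i j)"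
      then obtain e i j where "x \<in> F e (i mod K) (j mod K)" using mod by blast
      moreover have "i mod K \<in> {0..<K}" "j mod K \<in> {0..<K}" using K(1) by auto
      ultimately show "x \<in> (\<Union>e\<in>UNIV. \<Union>i\<in>{0..<K}. \<Union>j\<in>{0..<K}. F e i j)" by blast
    qed auto
    finally show ?thesis unfolding F_def using compact_im[OF C] by (auto intro!: compact_UN)
  qed
  have liftX: "lift e i j z \<in> topspace X" if "z \<in> cell e" for e i j z using lift_cover that by blast
  have \<Phi>X: "\<Phi> ` polygon n = topspace X"
  proof (intro equalityI subsetI)
    fix x assume "x \<in> \<Phi> ` polygon n"
    then show "x \<in> topspace X" using ex \<Phi> liftX by force
  next
    fix x assume "x \<in> topspace X"
    then obtain e i j z where "z \<in> cell e" "x = lift e i j z" unfolding lift_cover[symmetric] by blast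
    then show "x \<in> \<Phi> ` polygon n" using \<Phi> En by (metis image_eqI)
  qed
  have "{P \<in> polygon n. \<Phi> P \<in> topspace X} = polygon n" using \<Phi>X by auto
  then have comp: "compact (polygon n)" using compact_pre[of "topspace X"] by simp
  have cont: "continuous_map (top_of_set (polygon n)) X \<Phi>"
    unfolding continuous_map_closedin
  proof (intro conjI allI impI)
    fix C assume "closedin X C"
    then show "closedin (top_of_set (polygon n)) {x \<in> topspace (top_of_set (polygon n)). \<Phi> x \<in> C}"
      using compact_pre by (intro closed_subset) (auto intro: compact_imp_closed)
  qed (use \<Phi>X in auto)
  have quot: "quotient_map (top_of_set (polygon n)) X \<Phi>"
    by (rule continuous_imp_quotient_map[OF cont _ HX]) (use comp \<Phi>X in \<open>auto simp: compact_space_subtopology\<close>)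
  have fwd: "equivclp (edge_pattern n r) (E e i j z) (E e' i' j' z)"
    if z: "z \<in> cell e" "z \<in> cell e'" and eq: "lift e i j z = lift e' i' j' z" for e i j e' i' j' z
  proof -
    \<comment> \<open>A period may relate indices of a cell that does not contain \<open>z\<close>,
      where \<open>E\<close> is not controlled. So membership of \<open>z\<close> is carried along
      the chain as part of the relation.\<close>
    define M where "M = (\<lambda>t::bool \<times> int \<times> int. z \<in> cell (fst t))"
    define R where "R = (\<lambda>t t'. (M t \<longleftrightarrow> M t') \<and> (M t \<longrightarrow> equivclp (edge_pattern n r)
       (E (fst t) (fst (snd t)) (snd (snd t)) z) (E (fst t') (fst (snd t')) (snd (snd t')) z)))"
    have "R (e, i, j) (e', i', j')"
    proof (rule equivclp_imp_equivp[OF lift_eqD[OF z eq]])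
      show "equivp R"
        by (rule equivpI) (auto simp: R_def reflp_def symp_def transp_def intro: equivclp_sym equivclp_trans)
      show "R t t'" if "adjacent L z t t'" for t t'
        using that
      proof cases
        case (period i i' j j' e)
        then show ?thesis using E_period[OF period(3), of z e] by (simp add: R_def M_def)
      next
        case (across_ab i j)
        then have "z \<in> cell e" for e using segment_subset_cell[of e] by blast
        then show ?thesis using across_ab E_ab[of z] by (simp add: R_def M_def)
      next
        case (across_ac i j)
        then have "z \<in> cell e" for e using segment_subset_cell[of e] by blast
        then show ?thesis using across_ac E_ac[of z] by (simp add: R_def M_def)
      next
        case (across_bc i j)
        then have "z \<in> cell e" for e using segment_subset_cell[of e] by blast
        then show ?thesis using across_bc E_bc[of z] by (simp add: R_def M_def)
      qed
    qed
    then show ?thesis using z by (simp add: R_def M_def)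
  qed
  have glue: "\<Phi> x = \<Phi> y \<longleftrightarrow> equivclp (edge_pattern n r) x y" if xy: "x \<in> polygon n" "y \<in> polygon n" for x y
  proof
    assume eq: "\<Phi> x = \<Phi> y"
    obtain e i j z e' i' j' w where t: "z \<in> cell e" "x = E e i j z" "w \<in> cell e'" "y = E e' i' j' w"
      using ex xy by metis
    have l: "lift e i j z = lift e' i' j' w" using eq t \<Phi> by metis
    then have "z = w" using pr_lift t by metis
    then show "equivclp (edge_pattern n r) x y" using fwd l t by blast
  next
    assume "equivclp (edge_pattern n r) x y"
    then show "\<Phi> x = \<Phi> y"
    proof (rule equivclp_imp_equivp)
      show "equivp (\<lambda>x y. \<Phi> x = \<Phi> y)" by (rule equivpI) (auto simp: reflp_def symp_def transp_def)
      show "\<Phi> x = \<Phi> y" if "edge_pattern n r x y" for x y using pattern[OF that] \<Phi> by metis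
    qed
  qed
  have pr\<Phi>: "continuous_map (top_of_set (polygon n)) riemann_sphere (pr \<circ> \<Phi>)"
    using cont pr continuous_map_compose by blast
  have tess1: "tessellation_by_lifts (top_of_set (polygon n)) (pr \<circ> \<Phi>) (range tile)"
    unfolding tile_def
  proof (rule tessellation_by_sections[OF pr\<Phi>])
    show "continuous_map (subtopology riemann_sphere (cell e)) (top_of_set (polygon n)) (E e i j)" for e i j
      unfolding continuous_map_in_subtopology topspace_cell using E_cont En by auto
    show "(pr \<circ> \<Phi>) (E e i j z) = z" if "z \<in> cell e" for e i j z using that \<Phi> pr_lift by simp
    have "(\<Union>(e, i, j). E e i j ` cell e) = (\<Union>e i j. E e i j ` cell e)" by force
    then show "(\<Union>(e, i, j). E e i j ` cell e) = topspace (top_of_set (polygon n))"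
      using E_cover by simp
    show "finite (range (\<lambda>(e, i, j). E e i j ` cell e))" by (rule finite_images[where s = E, OF E_period])
    show "E e i j ` cell e = E e' i' j' ` cell e'"
      if "z \<in> cell e" "z \<in> cell e'" "z \<notin> equator" "E e i j z = E e' i' j' z" for e i j e' i' j' z
      using same_tile[where s = E, OF E_period that(1-3)] E_eqD[OF that(1,2,4)] by blast
  qed
  have img: "(`) \<Phi> ` range tile = range (\<lambda>(e, i, j). lift e i j ` cell e)"
  proof -
    have "\<Phi> ` tile t = (\<lambda>(e, i, j). lift e i j ` cell e) t" for t
      using \<Phi> by (cases t) (force simp: tile_def image_image intro!: image_cong)
    then show ?thesis by (auto simp: image_image)
  qed
  have tess2: "tessellation_by_lifts X pr ((`) \<Phi> ` range tile)"
    unfolding img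
  proof (rule tessellation_by_sections[OF pr lift_cont pr_lift])
    have "(\<Union>(e, i, j). lift e i j ` cell e) = (\<Union>e i j. lift e i j ` cell e)" by force
    then show "(\<Union>(e, i, j). lift e i j ` cell e) = topspace X" using lift_cover by simp
    show "finite (range (\<lambda>(e, i, j). lift e i j ` cell e))" by (rule finite_images[where s = lift, OF lift_period])
  qed (assumption | rule same_tile[where s = lift, OF lift_period])+
  have path: "path_along (pr \<circ> \<Phi> \<circ> edge n k) J u v \<and>
           (\<exists>T\<in>range tile. path_image (edge n k) \<subseteq> T \<and> (pr \<circ> \<Phi>) ` T = lower_cell)" if "odd k" for k
  proof -
    obtain i j where ij: "E False i j ` J = path_image (edge n k)"
      "E False i j u = edge n k 0" "E False i j v = edge n k 1" using edges[OF \<open>odd k\<close>] by blast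
    have inv: "(pr \<circ> \<Phi>) (E False i j z) = z" if "z \<in> cell False" for z using that \<Phi> pr_lift by simp
    have sub: "path_image (edge n k) \<subseteq> tile (False, i, j)"
      unfolding ij(1)[symmetric] tile_def using J by auto
    have "tile (False, i, j) \<subseteq> polygon n" using En by (auto simp: tile_def)
    have "continuous_map (top_of_set {0..1}) (top_of_set (polygon n)) (edge n k)"
      using sub \<open>tile (False, i, j) \<subseteq> polygon n\<close>
      by (auto simp: continuous_map_in_subtopology path_image_def edge_def intro!: continuous_intros)
    then have c: "continuous_map (top_of_set {0..1}) riemann_sphere (pr \<circ> \<Phi> \<circ> edge n k)"
      using pr\<Phi> continuous_map_compose by blast
    have im: "(pr \<circ> \<Phi> \<circ> edge n k) ` {0..1} = J"
    proof -
      have "(pr \<circ> \<Phi> \<circ> edge n k) ` {0..1} = (pr \<circ> \<Phi>) ` E False i j ` J"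
        unfolding ij(1) path_image_def by (simp add: image_comp)
      also have "\<dots> = J" using inv J by (force simp: image_image)
      finally show ?thesis .
    qed
    have "homeomorphic_map (top_of_set {0..1}) (subtopology riemann_sphere J) (pr \<circ> \<Phi> \<circ> edge n k)"
    proof (rule continuous_imp_homeomorphic_map)
      show "continuous_map (top_of_set {0..1}) (subtopology riemann_sphere J) (pr \<circ> \<Phi> \<circ> edge n k)"
        unfolding continuous_map_in_subtopology using c im by (auto simp: image_subset_iff_funcset[symmetric])
      show "compact_space (top_of_set {0..1::real})" by (simp add: compact_space_subtopology)
      show "Hausdorff_space (subtopology riemann_sphere J)"
        using Hausdorff_riemann_sphere by (rule Hausdorff_space_subtopology)
      show "(pr \<circ> \<Phi> \<circ> edge n k) ` topspace (top_of_set {0..1}) = topspace (subtopology riemann_sphere J)"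
        unfolding topspace_subtopology topspace_riemann_sphere using im by simp
      have "inj_on (pr \<circ> \<Phi>) (path_image (edge n k))"
        unfolding ij(1)[symmetric]
        by (rule inj_on_inverseI[where g = "E False i j"]) (use inv J in auto)
      then show "inj_on (pr \<circ> \<Phi> \<circ> edge n k) (topspace (top_of_set {0..1}))"
        using inj_on_edge[OF n] unfolding path_image_def by (auto intro: comp_inj_on)
    qed
    moreover have "(pr \<circ> \<Phi> \<circ> edge n k) 0 = u" "(pr \<circ> \<Phi> \<circ> edge n k) 1 = v"
      using inv[of u] inv[of v] J ij by auto
    moreover have "(pr \<circ> \<Phi>) ` tile (False, i, j) = lower_cell"
      using inv by (force simp: tile_def cell_def image_image)
    ultimately show ?thesis using sub unfolding path_along_def by blast
  qed
  show ?thesis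
    unfolding polygon_presentation_def glues_polygon_def
    using quot glue tess1 tess2 path by blast
qed

end

section \<open>The boundary of the regular polygon\<close>

text \<open>The boundary unrolled to the real line, with corners at the integers. Angular positions
  thus become real numbers to which shifts and sector offsets can be added.\<close>

definition polygon_boundary :: "nat \<Rightarrow> real \<Rightarrow> complex" where
  "polygon_boundary n \<tau> = edge n \<lfloor>\<tau>\<rfloor> (frac \<tau>)"

lemma edge_eq: "edge n k t = (1 - t) *\<^sub>R polygon_vertex n k + t *\<^sub>R polygon_vertex n (k + 1)"
  by (simp add: edge_def linepath_def)

lemma polygon_boundary_edge:
  assumes "0 \<le> t" "t \<le> 1"
  shows "polygon_boundary n (of_int k + t) = edge n k t"
proof (cases "t = 1")
  case True
  have "\<lfloor>real_of_int k + 1\<rfloor> = k + 1" "frac (real_of_int k + 1) = 0" by (simp_all add: frac_def)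
  then show ?thesis using True by (simp add: polygon_boundary_def edge_eq)
next
  case False
  then have "\<lfloor>of_int k + t\<rfloor> = k" using assms by (intro floor_unique) auto
  then show ?thesis by (simp add: polygon_boundary_def frac_def)
qed

lemma polygon_vertex_cong: "0 < n \<Longrightarrow> int n dvd k - l \<Longrightarrow> polygon_vertex n k = polygon_vertex n l"
  by (simp add: polygon_vertex_eq_iff)

lemma edge_cong: "0 < n \<Longrightarrow> int n dvd k - l \<Longrightarrow> edge n k = edge n l"
  using polygon_vertex_cong[of n k l] polygon_vertex_cong[of n "k + 1" "l + 1"] by (simp add: edge_def)

lemma polygon_boundary_periodic:
  assumes "0 < n" shows "polygon_boundary n (\<tau> + of_int (int n * i)) = polygon_boundary n \<tau>"
proof -
  have "\<lfloor>\<tau> + of_int (int n * i)\<rfloor> = \<lfloor>\<tau>\<rfloor> + int n * i" by (rule floor_add_int[symmetric])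
  moreover have "frac (\<tau> + of_int (int n * i)) = frac \<tau>" unfolding frac_def calculation by simp
  ultimately show ?thesis
    using edge_cong[OF assms, of "\<lfloor>\<tau>\<rfloor> + int n * i" "\<lfloor>\<tau>\<rfloor>"] by (simp add: polygon_boundary_def)
qed

lemma continuous_on_polygon_boundary: "continuous_on UNIV (polygon_boundary n)"
proof -
  have piece: "continuous_on {of_int k..of_int (k + 1)} (polygon_boundary n)" for k
  proof -
    have "continuous_on {of_int k..of_int (k + 1)} (\<lambda>\<tau>. edge n k (\<tau> - of_int k))"
      unfolding edge_eq by (intro continuous_intros)
    moreover have "edge n k (\<tau> - of_int k) = polygon_boundary n \<tau>" if "\<tau> \<in> {of_int k..of_int (k + 1)}" for \<tau>
      using polygon_boundary_edge[of "\<tau> - of_int k" n k] that by simp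
    ultimately show ?thesis by (subst (asm) continuous_on_cong[OF refl]) auto
  qed
  have "isCont (polygon_boundary n) \<tau>" for \<tau>
  proof -
    \<comment> \<open>Chosen so that \<tau> is interior to two consecutive pieces, also when it is
      an integer.\<close>
    define k where "k = \<lceil>\<tau>\<rceil> - 1"
    have k: "of_int k < \<tau>" "\<tau> < of_int (k + 2)" unfolding k_def by linarith+
    have "continuous_on ({of_int k..of_int (k + 1)} \<union> {of_int (k + 1)..of_int (k + 1 + 1)}) (polygon_boundary n)"
      by (intro continuous_on_closed_Un piece) auto
    moreover have "{of_int k..of_int (k + 1)} \<union> {of_int (k + 1)..of_int (k + 1 + 1)} = {real_of_int k..of_int (k + 2)}"
      by auto
    ultimately have "continuous_on {of_int k..of_int (k + 2)} (polygon_boundary n)" by simp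
    then show ?thesis
      by (rule continuous_on_interior) (use k in auto)
  qed
  then show ?thesis by (simp add: continuous_at_imp_continuous_on)
qed

text \<open>The linear functional that is maximal on the edge \<open>k\<close>; its maximum is \<open>cos (pi / n)\<close>.\<close>

definition edge_height :: "nat \<Rightarrow> int \<Rightarrow> complex \<Rightarrow> real" where
  "edge_height n k z = z \<bullet> cis (pi * of_int (2 * k + 1) / real n)"

lemma edge_height_vertex: "edge_height n k (polygon_vertex n l) = cos (pi * of_int (2 * (l - k) - 1) / real n)"
proof -
  have "edge_height n k (polygon_vertex n l)
      = cos (2 * pi * real_of_int l / real n - pi * of_int (2 * k + 1) / real n)"
    by (simp add: edge_height_def polygon_vertex_def inner_complex_def cos_diff)
  also have "2 * pi * real_of_int l / real n - pi * of_int (2 * k + 1) / real n = pi * of_int (2 * (l - k) - 1) / real n"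
    by (simp add: diff_divide_distrib[symmetric] algebra_simps)
  finally show ?thesis .
qed

text \<open>Seen from the midpoint of edge \<open>k\<close>, the corners have angles that are odd
  multiples of \<open>pi / n\<close>. Modulo \<open>2 * n\<close> the odd numbers closest to 0 are 1
  and \<open>2 * n - 1\<close>, which belong to the two ends of the edge.\<close>

lemma edge_height_vertex_le:
  assumes "0 < n"
  shows "edge_height n k (polygon_vertex n l) \<le> cos (pi / real n)"
    and "edge_height n k (polygon_vertex n l) = cos (pi / real n) \<longleftrightarrow> int n dvd l - k \<or> int n dvd l - (k + 1)"
proof -
  define m where "m = (2 * (l - k) - 1) mod (2 * int n)"
  define s where "s = (2 * (l - k) - 1) div (2 * int n)"
  have ms: "2 * (l - k) - 1 = m + 2 * int n * s" by (simp add: m_def s_def)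
  have m: "0 \<le> m" "m < 2 * int n" using assms by (auto simp: m_def)
  have odd: "odd m"
  proof -
    have "odd (m + 2 * int n * s)" unfolding ms[symmetric] by simp
    then show ?thesis by simp
  qed
  then have m1: "1 \<le> m" "m \<le> 2 * int n - 1" using m by (auto elim: oddE)
  have h: "edge_height n k (polygon_vertex n l) = cos (pi * of_int m / real n)"
  proof -
    have "pi * real_of_int (2 * (l - k) - 1) / real n = pi * of_int m / real n + 2 * pi * of_int s"
      unfolding ms using assms by (simp add: field_simps)
    then have "edge_height n k (polygon_vertex n l) = cos (pi * of_int m / real n + 2 * pi * of_int s)"
      unfolding edge_height_vertex by (rule arg_cong)
    then show ?thesis by (simp add: cos_add cos_int_2pin sin_int_2pin)
  qed
  have n: "real n > 0" using assms by simp
  have "cos (pi * of_int m / real n) \<le> cos (pi / real n) \<and>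
     (cos (pi * of_int m / real n) = cos (pi / real n) \<longleftrightarrow> m = 1 \<or> m = 2 * int n - 1)"
  proof (cases "m \<le> int n")
    case True
    have b: "0 \<le> pi / real n" "pi / real n \<le> pi * of_int m / real n" "pi * of_int m / real n \<le> pi"
      using True m1 n by (auto simp: field_simps)
    have "cos (pi * of_int m / real n) = cos (pi / real n) \<longleftrightarrow> pi * of_int m / real n = pi / real n"
      using b cos_inj_pi by (metis order_trans)
    also have "\<dots> \<longleftrightarrow> m = 1" using n by (simp add: field_simps)
    also have "\<dots> \<longleftrightarrow> m = 1 \<or> m = 2 * int n - 1" using True m1 by auto
    finally show ?thesis using cos_monotone_0_pi_le[OF b] by blast
  next
    case False
    \<comment> \<open>Reflection moves the angle to the interval where the cosine is
      decreasing.\<close>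
    define m' where "m' = 2 * int n - m"
    have b: "0 \<le> pi / real n" "pi / real n \<le> pi * of_int m' / real n" "pi * of_int m' / real n \<le> pi"
    proof -
      have "1 \<le> real_of_int m'" "real_of_int m' \<le> real n" using False m1 unfolding m'_def by linarith+
      then show "0 \<le> pi / real n" "pi / real n \<le> pi * of_int m' / real n" "pi * of_int m' / real n \<le> pi"
        using n by (auto simp: pos_divide_le_eq intro!: divide_right_mono)
    qed
    have "pi * of_int m / real n = 2 * pi - pi * of_int m' / real n"
      using n by (simp add: m'_def field_simps)
    then have c: "cos (pi * of_int m / real n) = cos (pi * of_int m' / real n)"
      by (simp add: cos_2pi_minus)
    have "cos (pi * of_int m' / real n) = cos (pi / real n) \<longleftrightarrow> pi * of_int m' / real n = pi / real n"
      using b cos_inj_pi by (metis order_trans)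
    also have "\<dots> \<longleftrightarrow> m' = 1" using n by (simp add: field_simps)
    also have "\<dots> \<longleftrightarrow> m = 1 \<or> m = 2 * int n - 1" using False m1 by (auto simp: m'_def)
    finally show ?thesis unfolding c using cos_monotone_0_pi_le[OF b] by blast
  qed
  moreover have "m = 1 \<or> m = 2 * int n - 1 \<longleftrightarrow> int n dvd l - k \<or> int n dvd l - (k + 1)"
  proof
    assume "m = 1 \<or> m = 2 * int n - 1"
    then have "l - (k + 1) = int n * s \<or> l - k = int n * (s + 1)" using ms by (auto simp: algebra_simps)
    then show "int n dvd l - k \<or> int n dvd l - (k + 1)" by (metis dvd_triv_left)
  next
    assume "int n dvd l - k \<or> int n dvd l - (k + 1)"
    then show "m = 1 \<or> m = 2 * int n - 1"
    proof
      assume "int n dvd l - k"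
      then obtain d where "l - k = int n * d" by (auto simp: dvd_def)
      then have "2 * (l - k) - 1 = (2 * int n - 1) + (2 * int n) * (d - 1)" by (simp add: algebra_simps)
      then have "m = (2 * int n - 1) mod (2 * int n)" unfolding m_def by (metis mod_mult_self2)
      also have "\<dots> = 2 * int n - 1" using assms by (intro mod_pos_pos_trivial) auto
      finally show ?thesis by simp
    next
      assume "int n dvd l - (k + 1)"
      then obtain d where "l - (k + 1) = int n * d" by (auto simp: dvd_def)
      then have "2 * (l - k) - 1 = 1 + (2 * int n) * d" by (simp add: algebra_simps)
      then have "m = 1 mod (2 * int n)" unfolding m_def by (metis mod_mult_self2)
      then show ?thesis using assms by simp
    qed
  qed
  ultimately show "edge_height n k (polygon_vertex n l) \<le> cos (pi / real n)"
    "edge_height n k (polygon_vertex n l) = cos (pi / real n) \<longleftrightarrow> int n dvd l - k \<or> int n dvd l - (k + 1)"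
    unfolding h by auto
qed

lemma edge_height_linear: "edge_height n k (a *\<^sub>R x + b *\<^sub>R y) = a * edge_height n k x + b * edge_height n k y"
  by (simp add: edge_height_def inner_add_left)

text \<open>The third claim tests only the starting corner of the edge that contains \<tau>: its
  weight \<open>1 - frac \<tau>\<close> is always positive.\<close>

lemma edge_height_boundary:
  assumes "0 < n"
  shows "edge_height n k (polygon_boundary n \<tau>) \<le> cos (pi / real n)"
    and "\<lfloor>\<tau>\<rfloor> = k \<Longrightarrow> edge_height n k (polygon_boundary n \<tau>) = cos (pi / real n)"
    and "edge_height n k (polygon_boundary n \<tau>) = cos (pi / real n) \<Longrightarrow>
       int n dvd \<lfloor>\<tau>\<rfloor> - k \<or> int n dvd \<lfloor>\<tau>\<rfloor> - (k + 1)"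
proof -
  let ?c = "cos (pi / real n)" and ?t = "frac \<tau>"
  let ?h = "\<lambda>l. edge_height n k (polygon_vertex n l)"
  have eq: "edge_height n k (polygon_boundary n \<tau>) = (1 - ?t) * ?h \<lfloor>\<tau>\<rfloor> + ?t * ?h (\<lfloor>\<tau>\<rfloor> + 1)"
    by (simp add: polygon_boundary_def edge_eq edge_height_linear)
  have t: "0 \<le> ?t" "?t < 1" by (auto simp: frac_lt_1)
  have le: "(1 - ?t) * ?h \<lfloor>\<tau>\<rfloor> \<le> (1 - ?t) * ?c" "?t * ?h (\<lfloor>\<tau>\<rfloor> + 1) \<le> ?t * ?c"
    using t edge_height_vertex_le(1)[OF assms] by (auto intro: mult_left_mono)
  have c: "(1 - ?t) * ?c + ?t * ?c = ?c" by (simp add: algebra_simps)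
  show "edge_height n k (polygon_boundary n \<tau>) \<le> ?c" using le c eq by linarith
  show "edge_height n k (polygon_boundary n \<tau>) = ?c" if "\<lfloor>\<tau>\<rfloor> = k"
  proof -
    have "?h k = ?c" "?h (k + 1) = ?c" using edge_height_vertex_le(2)[OF assms] by auto
    then show ?thesis using c by (simp add: eq that)
  qed
  show "int n dvd \<lfloor>\<tau>\<rfloor> - k \<or> int n dvd \<lfloor>\<tau>\<rfloor> - (k + 1)" if "edge_height n k (polygon_boundary n \<tau>) = ?c"
  proof -
    have "(1 - ?t) * ?h \<lfloor>\<tau>\<rfloor> = (1 - ?t) * ?c" using le c eq that by linarith
    then have "?h \<lfloor>\<tau>\<rfloor> = ?c" using t by simp
    then show ?thesis using edge_height_vertex_le(2)[OF assms] by blast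
  qed
qed

section \<open>Polar coordinates on the polygon\<close>

lemma cos_pi_over_pos: "3 \<le> n \<Longrightarrow> 0 < cos (pi / real n)"
proof -
  assume "3 \<le> n"
  then have "real n \<ge> 3" by simp
  then have "pi / real n \<le> pi / 3" by (intro divide_left_mono) auto
  then have "pi / real n < pi / 2" using pi_gt_zero by linarith
  moreover have "0 < pi / real n" using \<open>3 \<le> n\<close> by simp
  ultimately show ?thesis by (intro cos_gt_zero)
qed

text \<open>The radius is recovered from the largest edge height. At equal positive radius, each of
  the two edges is, modulo \<open>n\<close>, the other one or its successor. If they differed, each
  would succeed the other and \<open>n\<close> would divide 2; so they agree, and injectivity of the
  edge finishes.\<close>

lemma scaled_boundary_eq:
  assumes n: "3 \<le> n" and R: "0 \<le> R" "0 \<le> R'"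
    and eq: "R *\<^sub>R polygon_boundary n \<tau> = R' *\<^sub>R polygon_boundary n \<tau>'"
  shows "R = R'" and "R = 0 \<or> (\<exists>i::int. \<tau>' = \<tau> + of_int (int n * i))"
proof -
  have n0: "0 < n" using n by simp
  let ?c = "cos (pi / real n)"
  have c: "0 < ?c" using n by (rule cos_pi_over_pos)
  have scale: "edge_height n k (a *\<^sub>R x) = a * edge_height n k x" for k a x
    by (simp add: edge_height_def)
  have "R1 * ?c \<le> R2 * ?c"
    if "R1 *\<^sub>R polygon_boundary n t1 = R2 *\<^sub>R polygon_boundary n t2" "0 \<le> R2" for R1 R2 t1 t2
  proof -
    have "R1 * ?c = edge_height n \<lfloor>t1\<rfloor> (R1 *\<^sub>R polygon_boundary n t1)"
      using edge_height_boundary(2)[OF n0 refl] by (simp add: scale)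
    also have "\<dots> = R2 * edge_height n \<lfloor>t1\<rfloor> (polygon_boundary n t2)" by (simp add: that(1) scale)
    also have "\<dots> \<le> R2 * ?c" using that(2) edge_height_boundary(1)[OF n0] by (rule mult_left_mono[rotated])
    finally show ?thesis .
  qed
  from this[OF eq R(2)] this[OF eq[symmetric] R(1)] show RR: "R = R'" using c by simp
  show "R = 0 \<or> (\<exists>i::int. \<tau>' = \<tau> + of_int (int n * i))"
  proof (cases "R = 0")
    case False
    then have V: "polygon_boundary n \<tau> = polygon_boundary n \<tau>'" using eq RR by simp
    have d1: "int n dvd \<lfloor>\<tau>'\<rfloor> - \<lfloor>\<tau>\<rfloor> \<or> int n dvd \<lfloor>\<tau>'\<rfloor> - (\<lfloor>\<tau>\<rfloor> + 1)"
      using edge_height_boundary(2)[OF n0 refl, of \<tau>] unfolding V by (rule edge_height_boundary(3)[OF n0])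
    have d2: "int n dvd \<lfloor>\<tau>\<rfloor> - \<lfloor>\<tau>'\<rfloor> \<or> int n dvd \<lfloor>\<tau>\<rfloor> - (\<lfloor>\<tau>'\<rfloor> + 1)"
      using edge_height_boundary(2)[OF n0 refl, of \<tau>'] unfolding V[symmetric] by (rule edge_height_boundary(3)[OF n0])
    have "int n dvd \<lfloor>\<tau>'\<rfloor> - \<lfloor>\<tau>\<rfloor>"
    proof (rule ccontr)
      assume a: "\<not> int n dvd \<lfloor>\<tau>'\<rfloor> - \<lfloor>\<tau>\<rfloor>"
      then have "\<not> int n dvd \<lfloor>\<tau>\<rfloor> - \<lfloor>\<tau>'\<rfloor>" by (metis dvd_minus_iff minus_diff_eq)
      then have "int n dvd (\<lfloor>\<tau>'\<rfloor> - (\<lfloor>\<tau>\<rfloor> + 1)) + (\<lfloor>\<tau>\<rfloor> - (\<lfloor>\<tau>'\<rfloor> + 1))"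
        using a d1 d2 by (intro dvd_add) auto
      then have "int n dvd 2" by simp
      then show False using n zdvd_imp_le by force
    qed
    then obtain i where i: "\<lfloor>\<tau>'\<rfloor> = \<lfloor>\<tau>\<rfloor> + int n * i" by (metis dvd_def diff_add_cancel add.commute)
    have "edge n \<lfloor>\<tau>'\<rfloor> = edge n \<lfloor>\<tau>\<rfloor>" by (rule edge_cong[OF n0]) (simp add: i)
    then have "edge n \<lfloor>\<tau>\<rfloor> (frac \<tau>) = edge n \<lfloor>\<tau>\<rfloor> (frac \<tau>')" using V by (simp add: polygon_boundary_def)
    moreover have "frac \<tau> \<in> {0..1}" "frac \<tau>' \<in> {0..1}" using frac_lt_1[of \<tau>] frac_lt_1[of \<tau>'] by auto
    ultimately have "frac \<tau> = frac \<tau>'" using inj_on_edge[of n "\<lfloor>\<tau>\<rfloor>"] n by (auto dest: inj_onD)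
    then have "\<tau>' = \<tau> + of_int (int n * i)" using i by (simp add: frac_def algebra_simps)
    then show ?thesis by blast
  qed simp
qed

lemma scaled_edge:
  assumes "0 \<le> x" "0 \<le> y"
  shows "x *\<^sub>R polygon_vertex n k + y *\<^sub>R polygon_vertex n (k + 1)
    = (x + y) *\<^sub>R polygon_boundary n (of_int k + y / (x + y))"
proof (cases "x + y = 0")
  case True
  then show ?thesis using assms by (simp add: add_nonneg_eq_0_iff)
next
  case False
  then have s: "x + y > 0" using assms by simp
  have "polygon_boundary n (of_int k + y / (x + y)) = edge n k (y / (x + y))"
    using assms s by (intro polygon_boundary_edge) auto
  moreover have "(x + y) * (1 - y / (x + y)) = x" "(x + y) * (y / (x + y)) = y" using s by (simp_all add: field_simps)
  ultimately show ?thesis by (simp add: edge_eq scaleR_add_right del: times_divide_eq_right)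
qed

lemma boundary_in_polygon: "polygon_boundary n \<tau> \<in> polygon n"
proof -
  have v: "polygon_vertex n k \<in> polygon n" for k unfolding polygon_def by (rule hull_inc) simp
  have "convex (polygon n)" unfolding polygon_def by (rule convex_convex_hull)
  then show ?thesis
    unfolding polygon_boundary_def edge_eq
    by (rule convexD) (use v frac_lt_1[of \<tau>] in \<open>auto simp: less_imp_le\<close>)
qed

text \<open>The centre is the average of all corners, a geometric sum over the roots of
  unity.\<close>

lemma zero_in_polygon:
  assumes "2 \<le> n" shows "0 \<in> polygon n"
proof -
  have n0: "real n > 0" using assms by simp
  define w where "w = cis (2 * pi / real n)"
  have wk: "w ^ k = polygon_vertex n (int k)" for k
    unfolding w_def polygon_vertex_def Complex.DeMoivre by (intro arg_cong[of _ _ cis]) simp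
  have "w \<noteq> 1"
    using wk[of 1] polygon_vertex_eq_iff[of n 1 0] assms by (auto simp: polygon_vertex_def)
  moreover have "w ^ n = 1"
    using wk[of n] polygon_vertex_eq_iff[of n "int n" 0] assms by (auto simp: polygon_vertex_def)
  ultimately have "(\<Sum>k<n. w ^ k) = 0" by (simp add: geometric_sum)
  moreover have "(\<Sum>k<n. (1 / real n) *\<^sub>R w ^ k) \<in> polygon n"
  proof (rule convex_sum)
    show "convex (polygon n)" unfolding polygon_def by (rule convex_convex_hull)
    show "w ^ k \<in> polygon n" for k unfolding wk polygon_def by (rule hull_inc) simp
  qed (use n0 in auto)
  ultimately show ?thesis by (simp add: scaleR_sum_right[symmetric])
qed

lemma scaled_boundary_in_polygon:
  assumes "2 \<le> n" "0 \<le> R" "R \<le> 1" shows "R *\<^sub>R polygon_boundary n \<tau> \<in> polygon n"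
proof -
  have "convex (polygon n)" unfolding polygon_def by (rule convex_convex_hull)
  then have "R *\<^sub>R polygon_boundary n \<tau> + (1 - R) *\<^sub>R 0 \<in> polygon n"
    by (rule convexD) (use assms boundary_in_polygon zero_in_polygon in auto)
  then show ?thesis by simp
qed

text \<open>The argument of \<open>P\<close> selects a sector of the regular polygon; there
  \<open>P\<close> is a nonnegative combination of two neighbouring corners. The edge height bounds
  the sum of the coefficients by 1.\<close>

lemma polygon_polar:
  assumes n: "3 \<le> n" and P: "P \<in> polygon n"
  obtains R \<tau> where "0 \<le> R" "R \<le> 1" "P = R *\<^sub>R polygon_boundary n \<tau>"
proof -
  have n0: "0 < n" "real n > 0" using n by auto
  let ?c = "cos (pi / real n)" and ?a = "2 * pi / real n"
  define \<theta> where "\<theta> = Arg P"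
  define k where "k = \<lfloor>\<theta> / ?a\<rfloor>"
  define \<phi> where "\<phi> = \<theta> - ?a * of_int k"
  have a: "0 < ?a" "?a < pi" using n pi_gt_zero by (auto simp: field_simps)
  have "of_int k \<le> \<theta> / ?a" "\<theta> / ?a < of_int k + 1" unfolding k_def by linarith+
  then have \<phi>: "0 \<le> \<phi>" "\<phi> \<le> ?a"
    unfolding \<phi>_def pos_le_divide_eq[OF a(1)] pos_divide_less_eq[OF a(1)] distrib_right
    by (simp_all only: mult.commute[of _ "of_int k"])
  have s: "0 < sin ?a" using a by (intro sin_gt_zero)
  \<comment> \<open>The sine rule in the triangle spanned by the two corners and the centre.\<close>
  define x where "x = norm P * sin (?a - \<phi>) / sin ?a"
  define y where "y = norm P * sin \<phi> / sin ?a"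
  have xy: "0 \<le> x" "0 \<le> y"
    unfolding x_def y_def using s \<phi> a
    by (auto intro!: divide_nonneg_pos mult_nonneg_nonneg sin_ge_zero)
  have "cis \<phi> = (sin (?a - \<phi>) / sin ?a) *\<^sub>R 1 + (sin \<phi> / sin ?a) *\<^sub>R cis ?a"
    using s by (auto simp: complex_eq_iff sin_diff field_simps)
  then have "norm P *\<^sub>R (cis \<phi> * polygon_vertex n k) =
      x *\<^sub>R polygon_vertex n k + y *\<^sub>R (cis ?a * polygon_vertex n k)"
    by (simp add: x_def y_def algebra_simps)
  moreover have "cis ?a * polygon_vertex n k = polygon_vertex n (k + 1)"
    by (simp add: polygon_vertex_def cis_mult add_divide_distrib algebra_simps)
  moreover have "cis \<phi> * polygon_vertex n k = cis \<theta>"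
    by (simp add: polygon_vertex_def cis_mult \<phi>_def)
  moreover have "norm P *\<^sub>R cis \<theta> = P"
    using rcis_cmod_Arg[of P] by (simp add: rcis_def \<theta>_def scaleR_conv_of_real)
  ultimately have Pxy: "P = x *\<^sub>R polygon_vertex n k + y *\<^sub>R polygon_vertex n (k + 1)" by simp
  have "edge_height n k P \<le> ?c"
  proof -
    have "polygon n \<subseteq> {z. edge_height n k z \<le> ?c}"
      unfolding polygon_def
    proof (rule hull_minimal)
      show "convex {z. edge_height n k z \<le> ?c}"
        unfolding edge_height_def by (subst inner_commute) (rule convex_halfspace_le)
    qed (use edge_height_vertex_le(1)[OF n0(1)] in auto)
    then show ?thesis using P by auto
  qed
  moreover have "edge_height n k P = (x + y) * ?c"
    unfolding Pxy edge_height_linear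
    using edge_height_vertex_le(2)[OF n0(1), of k k] edge_height_vertex_le(2)[OF n0(1), of k "k + 1"]
    by (simp add: algebra_simps)
  ultimately have "(x + y) * ?c \<le> 1 * ?c" by simp
  then have "x + y \<le> 1" using cos_pi_over_pos[OF n] by simp
  then show ?thesis
    using that[of "x + y" "of_int k + y / (x + y)"] xy Pxy scaled_edge[OF xy] by simp
qed

section \<open>Cyclic symmetry groups\<close>

lemma int_step_invariant:
  fixes f :: "int \<Rightarrow> 'b"
  assumes "\<And>k. f k = f (k + 1)" shows "f k = f l"
proof -
  have h: "f k = f (k + int d)" for k d
  proof (induction d)
    case (Suc d)
    then show ?case using assms[of "k + int d"] by (simp add: ac_simps)
  qed simp
  consider d where "l = k + int d" | d where "k = l + int d" by (metis linear zle_iff_zadd)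
  then show ?thesis
  proof cases
    case 1 show ?thesis unfolding 1 by (rule h)
  next
    case 2 show ?thesis unfolding 2 by (rule h[symmetric])
  qed
qed

lemma bary_eq_imp_eq:
  assumes "z \<in> cell e" "w \<in> cell e" "bary_b z = bary_b w" "bary_c z = bary_c w"
  shows "z = w"
  using assms bary_inj[of z e w] bary_sum[of z] bary_sum[of w] by simp

lemma bary_eq_on_equator:
  assumes "z \<in> equator" "w \<in> equator" "bary_b z = bary_b w" "bary_c z = bary_c w"
  shows "z = w"
  using bary_eq_imp_eq[of z True w] assms equator_subset_cell by blast

text \<open>With \<open>even k\<close> for \<open>P\<close>, this describes the side common to the
  triangles \<open>k\<close> and \<open>k + 1\<close> of the fan below.\<close>

lemma side_faces:
  "(if P then bary_b z else bary_c z) = 0 \<Longrightarrow> z \<in> (if P then segment_ac else segment_ab)"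
  "z \<in> (if P then segment_ac else segment_ab) \<Longrightarrow> z \<in> equator"
  by (cases P; simp add: bary_faces equator_eq)+

lemma bary_eq_vertexD:
  "z \<in> cell e \<Longrightarrow> bary_b z = 0 \<Longrightarrow> bary_c z = 0 \<Longrightarrow> z = a_vertex"
  "z \<in> cell e \<Longrightarrow> bary_b z = 1 \<Longrightarrow> bary_c z = 0 \<Longrightarrow> z = b_vertex"
  "z \<in> cell e \<Longrightarrow> bary_b z = 0 \<Longrightarrow> bary_c z = 1 \<Longrightarrow> z = c_vertex"
proof -
  have v: "a_vertex \<in> cell e" "b_vertex \<in> cell e" "c_vertex \<in> cell e"
    by (rule vertex_in_cell; simp add: vertices_def)+
  assume z: "z \<in> cell e"
  show "bary_b z = 0 \<Longrightarrow> bary_c z = 0 \<Longrightarrow> z = a_vertex"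
    "bary_b z = 1 \<Longrightarrow> bary_c z = 0 \<Longrightarrow> z = b_vertex"
    "bary_b z = 0 \<Longrightarrow> bary_c z = 1 \<Longrightarrow> z = c_vertex"
    by (rule bary_eq_imp_eq[OF z]; simp add: v)+
qed

lemma bary_surj':
  assumes "0 \<le> x" "0 \<le> y" "x + y \<le> 1"
  obtains z where "z \<in> cell e" "bary_b z = x" "bary_c z = y"
proof -
  obtain z where "z \<in> cell e" "bary_a z = 1 - x - y" "bary_b z = x"
    by (rule bary_surj[of "1 - x - y" x e]) (use assms in auto)
  then show ?thesis using that[of z] bary_sum[of z] by simp
qed

lemma continuous_map_scaleR:
  fixes c :: "'b::real_normed_vector"
  assumes "continuous_map Y euclideanreal f"
  shows "continuous_map Y euclidean (\<lambda>x. f x *\<^sub>R c)"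
  using assms by (simp add: continuous_map_atin tendsto_scaleR)

text \<open>The triangles of the fan with apex \<open>0\<close>, which is the only \<open>a\<close>-vertex; the corners of the
  polygon with odd numbers are \<open>c\<close>-vertices, the others are \<open>b\<close>-vertices.\<close>

definition fan :: "nat \<Rightarrow> int \<Rightarrow> complex option \<Rightarrow> complex" where
  "fan n k z =
     (if even k then bary_b z *\<^sub>R polygon_vertex n k + bary_c z *\<^sub>R polygon_vertex n (k + 1)
      else bary_c z *\<^sub>R polygon_vertex n k + bary_b z *\<^sub>R polygon_vertex n (k + 1))"

lemma fan_cong:
  assumes "0 < n" "even n" "int n dvd k - l"
  shows "fan n k = fan n l"
proof -
  have "2 dvd int n" using assms(2) by presburger
  then have "2 dvd k - l" using assms(3) by (rule dvd_trans)
  then have "even k = even l" by presburger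
  moreover have "polygon_vertex n k = polygon_vertex n l" "polygon_vertex n (k + 1) = polygon_vertex n (l + 1)"
    using assms by (auto intro!: polygon_vertex_cong)
  ultimately show ?thesis by (auto simp: fan_def)
qed

lemma continuous_map_fan: "continuous_map (subtopology riemann_sphere D) euclidean (fan n k)"
  unfolding fan_def
  by (cases "even k") (auto intro!: continuous_map_add continuous_map_scaleR continuous_map_from_subtopology
      continuous_bary_b continuous_bary_c)

text \<open>At the \<open>a\<close>-vertex the quotient is \<open>0 / 0 = 0\<close>, which is
  harmless because the radius vanishes.\<close>

lemma fan_polar:
  "fan n k z = (bary_b z + bary_c z) *\<^sub>R
     polygon_boundary n (of_int k + (if even k then bary_c z else bary_b z) / (bary_b z + bary_c z))"
  using scaled_edge[OF bary_nonneg(2)[of z] bary_nonneg(3)[of z]] scaled_edge[OF bary_nonneg(3)[of z] bary_nonneg(2)[of z]]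
  by (simp add: fan_def add.commute[of "bary_c z" "bary_b z"])

lemma fan_covers:
  assumes n: "3 \<le> n" shows "(\<Union>k. fan n k ` cell (even k)) = polygon n"
proof (intro equalityI subsetI)
  fix P assume "P \<in> (\<Union>k. fan n k ` cell (even k))"
  then obtain k z where "P = fan n k z" by blast
  then show "P \<in> polygon n"
    unfolding fan_polar using n bary_sum[of z] bary_nonneg[of z] by (auto intro!: scaled_boundary_in_polygon)
next
  fix P assume "P \<in> polygon n"
  then obtain R \<tau> where P: "0 \<le> R" "R \<le> 1" "P = R *\<^sub>R polygon_boundary n \<tau>"
    using polygon_polar[OF n] by blast
  define k x y where "k = \<lfloor>\<tau>\<rfloor>" and "x = R * (1 - frac \<tau>)" and "y = R * frac \<tau>"
  have xy: "0 \<le> x" "0 \<le> y" "x + y \<le> 1" "x + y = R"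
  proof -
    have "R * frac \<tau> \<le> R * 1" using P frac_lt_1[of \<tau>] by (intro mult_left_mono) auto
    then show "0 \<le> x" "0 \<le> y" "x + y \<le> 1" "x + y = R"
      using P by (auto simp: x_def y_def algebra_simps)
  qed
  have PP: "P = x *\<^sub>R polygon_vertex n k + y *\<^sub>R polygon_vertex n (k + 1)"
    unfolding P polygon_boundary_def edge_eq by (simp add: k_def x_def y_def algebra_simps)
  obtain z where z: "z \<in> cell (even k)" "bary_b z = (if even k then x else y)" "bary_c z = (if even k then y else x)"
    by (rule bary_surj'[of "if even k then x else y" "if even k then y else x" "even k"]) (use xy in auto)
  have "P = fan n k z" using z unfolding PP fan_def by auto
  then show "P \<in> (\<Union>k. fan n k ` cell (even k))" using z by blast
qed

text \<open>Angles in triangle \<open>k\<close> range over \<open>[k, k + 1]\<close>. Hence, away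
  from the centre, triangles with a common point have numbers that differ by at most 1 modulo
  \<open>n\<close>, and by 1 only along the common side. As \<open>n\<close> is even, the parity
  that distinguishes the two cells survives a full turn.\<close>

lemma fan_eqD:
  assumes n: "3 \<le> n" "even n"
    and z: "z \<in> cell (even k)" and w: "w \<in> cell (even k')" and eq: "fan n k z = fan n k' w"
  shows "z = w"
    and "z = a_vertex \<or> int n dvd k' - k \<or>
      (int n dvd k' - (k + 1) \<and> z \<in> (if even k then segment_ac else segment_ab)) \<or>
      (int n dvd k - (k' + 1) \<and> z \<in> (if even k' then segment_ac else segment_ab))"
proof -
  define R where "R = bary_b z + bary_c z"
  define x where "x = (if even k then bary_c z else bary_b z)"
  define x' where "x' = (if even k' then bary_c w else bary_b w)"
  have nn: "0 \<le> bary_b z + bary_c z" "0 \<le> bary_b w + bary_c w" using bary_nonneg by simp_all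
  note eq' = scaled_boundary_eq[OF n(1) nn eq[unfolded fan_polar]]
  have R: "R = bary_b w + bary_c w" using eq'(1) by (simp add: R_def)
  have t: "R = 0 \<or> (\<exists>i::int. of_int k' + x' / R = of_int k + x / R + of_int (int n * i))"
    using eq'(2) unfolding eq'(1)[symmetric] R_def[symmetric] x_def[symmetric] x'_def[symmetric] .
  have "z = w \<and> (z = a_vertex \<or> int n dvd k' - k \<or>
      (int n dvd k' - (k + 1) \<and> z \<in> (if even k then segment_ac else segment_ab)) \<or>
      (int n dvd k - (k' + 1) \<and> z \<in> (if even k' then segment_ac else segment_ab)))"
  proof (cases "R = 0")
    case True
    then have "bary_b z = 0" "bary_c z = 0" "bary_b w = 0" "bary_c w = 0"
      using R bary_nonneg[of z] bary_nonneg[of w] unfolding R_def by linarith+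
    then show ?thesis using bary_eq_vertexD(1) z w by metis
  next
    case False
    have R0: "R > 0" using False bary_nonneg[of z] by (simp add: R_def)
    obtain i :: int where i: "of_int k' + x' / R = of_int k + x / R + of_int (int n * i)" using t False by blast
    have x: "0 \<le> x" "x \<le> R" "0 \<le> x'" "x' \<le> R"
      using bary_nonneg[of z] bary_nonneg[of w] R by (auto simp: x_def x'_def R_def)
    \<comment> \<open>The difference of the triangle numbers after removal of full turns; the two
      offsets \<open>x / R\<close> and \<open>x' / R\<close> lie in \<open>[0, 1]\<close>, which
      bounds it by 1.\<close>
    define d where "d = k' - k - int n * i"
    have d: "of_int d * R = x - x'" using i R0 by (simp add: d_def field_simps)
    have "\<bar>of_int d * R\<bar> \<le> 1 * R" unfolding d using x by simp
    then have "\<bar>real_of_int d\<bar> \<le> 1" using R0 by (simp add: abs_mult)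
    then have "d = 0 \<or> d = 1 \<or> d = -1" by linarith
    moreover have ev: "even (int n * i)" using n(2) by simp
    moreover have k': "k' = k + d + int n * i" by (simp add: d_def)
    ultimately consider "d = 0" "even k' = even k" | "d = 1" "even k' = odd k" | "d = -1" "even k' = odd k"
      by auto
    then show ?thesis
    proof cases
      case 1
      then have "bary_b z = bary_b w" "bary_c z = bary_c w"
        using d R unfolding R_def x_def x'_def by (cases "even k"; simp)+
      then have "z = w" using bary_eq_imp_eq z w 1 by simp
      then show ?thesis using 1 k' by simp
    next
      case 2
      then have "x = R" "x' = 0" using d x by simp_all
      then have xx: "(if even k then bary_c z else bary_b z) = R" "(if even k then bary_b w else bary_c w) = 0"
        using 2 unfolding x_def x'_def by (cases "even k"; simp)+
      have "bary_b z = bary_b w \<and> bary_c z = bary_c w \<and> (if even k then bary_b z else bary_c z) = 0"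
      proof (cases "even k")
        case True
        then have "bary_c z = R" "bary_b w = 0" using xx by simp_all
        then have "bary_b z = 0" "bary_c w = bary_c z" using R R_def by linarith+
        then show ?thesis using True \<open>bary_b w = 0\<close> by simp
      next
        case False
        then have "bary_b z = R" "bary_c w = 0" using xx by simp_all
        then have "bary_c z = 0" "bary_b w = bary_b z" using R R_def by linarith+
        then show ?thesis using False \<open>bary_c w = 0\<close> by simp
      qed
      then have b: "bary_b z = bary_b w" "bary_c z = bary_c w" "(if even k then bary_b z else bary_c z) = 0"
        by blast+
      have s: "z \<in> (if even k then segment_ac else segment_ab)" "w \<in> (if even k then segment_ac else segment_ab)"
        by (rule side_faces(1)[OF b(3)], rule side_faces(1)[OF b(3)[unfolded b(1,2)]])
      note zw = side_faces(2)[OF s(1)] side_faces(2)[OF s(2)]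
      have "z = w" by (rule bary_eq_on_equator[OF zw b(1,2)])
      then show ?thesis using s(1) 2 k' by simp
    next
      case 3
      then have "x = 0" "x' = R" using d x by simp_all
      then have xx: "(if even k' then bary_b z else bary_c z) = 0" "(if even k' then bary_c w else bary_b w) = R"
        using 3 unfolding x_def x'_def by (cases "even k"; simp)+
      have "bary_b z = bary_b w \<and> bary_c z = bary_c w \<and> (if even k' then bary_b z else bary_c z) = 0"
      proof (cases "even k'")
        case True
        then have "bary_b z = 0" "bary_c w = R" using xx by simp_all
        then have "bary_b w = 0" "bary_c w = bary_c z" using R R_def by linarith+
        then show ?thesis using True \<open>bary_b z = 0\<close> by simp
      next
        case False
        then have "bary_c z = 0" "bary_b w = R" using xx by simp_all
        then have "bary_c w = 0" "bary_b w = bary_b z" using R R_def by linarith+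
        then show ?thesis using False \<open>bary_c z = 0\<close> by simp
      qed
      then have b: "bary_b z = bary_b w" "bary_c z = bary_c w" "(if even k' then bary_b z else bary_c z) = 0"
        by blast+
      have s: "z \<in> (if even k' then segment_ac else segment_ab)" "w \<in> (if even k' then segment_ac else segment_ab)"
        by (rule side_faces(1)[OF b(3)], rule side_faces(1)[OF b(3)[unfolded b(1,2)]])
      note zw = side_faces(2)[OF s(1)] side_faces(2)[OF s(2)]
      have "z = w" by (rule bary_eq_on_equator[OF zw b(1,2)])
      moreover have "int n dvd k - (k' + 1)" using 3 k' by simp
      ultimately show ?thesis using s(1) by blast
    qed
  qed
  then show "z = w" "z = a_vertex \<or> int n dvd k' - k \<or>
      (int n dvd k' - (k + 1) \<and> z \<in> (if even k then segment_ac else segment_ab)) \<or>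
      (int n dvd k - (k' + 1) \<and> z \<in> (if even k' then segment_ac else segment_ab))" by auto
qed

context triangulated_cover
begin

text \<open>The group of deck transformations is cyclic, generated by the rotation about the
  \<open>a\<close>-vertex.\<close>

theorem cyclic_presentation:
  assumes L: "\<And>i j. L i j \<longleftrightarrow> int m dvd i - int r * j" and m: "2 \<le> m"
  shows "polygon_presentation X pr (2 * m) (int r) segment_bc c_vertex b_vertex"
proof -
  define n where "n = 2 * m"
  have n: "3 \<le> n" "even n" "0 < n" using m unfolding n_def by simp_all
  \<comment> \<open>Modulo the lattice, \<open>(i, j)\<close> is \<open>(i - r j, 0)\<close>. Around
    the \<open>a\<close>-vertex, ab joins lower \<open>s\<close> to upper \<open>s\<close>, and ac
    joins upper \<open>s\<close> to lower \<open>s + 1\<close>; so these triangles get the numbers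
    \<open>2 s - 1\<close>, \<open>2 s\<close> and \<open>2 s + 1\<close> in this order.\<close>
  define num where "num = (\<lambda>e i j. 2 * (i - int r * j) - (if e then 0 else 1::int))"
  have ev: "even (num e i j) = e" for e i j unfolding num_def by (cases e) simp_all
  define E where "E = (\<lambda>e i j. fan n (num e i j))"
  \<comment> \<open>The lift at position \<open>k\<close> of the fan; both \<open>2 s - 1\<close>
    and \<open>2 s\<close> have winding number \<open>s\<close>.\<close>
  define S where "S = (\<lambda>k. lift (even k) ((k + 1) div 2) 0)"
  have lift_S: "lift e i j z = S (num e i j) z" if "z \<in> cell e" for e i j z
  proof -
    have "(num e i j + 1) div 2 = i - int r * j" unfolding num_def by (cases e) simp_all
    then have "S (num e i j) z = lift e (i - int r * j) 0 z" by (simp add: S_def ev)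
    also have "\<dots> = lift e i j z" by (rule lift_period) (use that L in auto)
    finally show ?thesis by simp
  qed
  have S_cong: "S k z = S l z" if kl: "int n dvd k - l" "z \<in> cell (even k)" for k l z
  proof -
    obtain d where "k - l = int n * d" using kl(1) unfolding dvd_def by blast
    then have d: "k = l + 2 * (int m * d)" by (simp add: n_def)
    have e: "even k = even l" unfolding d by simp
    have "(k + 1) div 2 = (l + 1 + 2 * (int m * d)) div 2" unfolding d by (simp add: ac_simps)
    also have "\<dots> = (l + 1) div 2 + int m * d" by simp
    finally have "L ((k + 1) div 2 - (l + 1) div 2) (0 - 0)" by (simp add: L)
    from lift_period[OF this that(2)] show ?thesis unfolding S_def e .
  qed
  have S_next: "S k z = S (k + 1) z" if "z \<in> (if even k then segment_ac else segment_ab)" for k z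
  proof (cases "even k")
    case True
    then obtain s where "k = 2 * s" by (elim evenE)
    then show ?thesis using lift_ac[of z s 0] that by (simp add: S_def add.commute)
  next
    case False
    then obtain s where "k = 2 * s + 1" by (elim oddE)
    then show ?thesis using lift_ab[of z "s + 1" 0] that by (simp add: S_def add.commute)
  qed
  have S_a: "S k a_vertex = S l a_vertex" for k l
    by (rule int_step_invariant[of "\<lambda>k. S k a_vertex"], rule S_next) simp
  have fan_ac: "fan n k z = fan n (k + 1) z" if "z \<in> (if even k then segment_ac else segment_ab)" for k z
  proof -
    have "(if even k then bary_b z else bary_c z) = 0" using that by (cases "even k") (simp_all add: bary_faces)
    then show ?thesis by (cases "even k") (simp_all add: fan_def)
  qed
  have fan_bc: "fan n k z = edge n k (if even k then bary_c z else bary_b z)" if "z \<in> segment_bc" for k z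
  proof -
    have "bary_b z + bary_c z = 1" using that bary_faces(1)[of z] bary_sum[of z] by simp
    then have "bary_b z = 1 - bary_c z" "bary_c z = 1 - bary_b z" by simp_all
    then show ?thesis unfolding fan_def edge_eq by (cases "even k") simp_all
  qed
  have bc01: "bary_b z \<in> {0..1}" "bary_c z = 1 - bary_b z" if "z \<in> segment_bc" for z
    using that bary_faces(1)[of z] bary_sum[of z] bary_nonneg[of z] by auto
  have bc_ex: "\<exists>z. z \<in> segment_bc \<and> bary_b z = t" if t: "t \<in> {0..1}" for t
  proof -
    obtain z where "z \<in> cell True" "bary_b z = t" "bary_c z = 1 - t" 
      by (rule bary_surj'[of t "1 - t" True]) (use t in auto)
    then show ?thesis using bary_faces(1)[of z] bary_sum[of z] by auto
  qed
  have "polygon_presentation X pr n (int r) segment_bc c_vertex b_vertex"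
  proof (rule polygon_presentationI[where E = E])
    show "2 \<le> n" using n by simp
    show "continuous_map (subtopology riemann_sphere (cell e)) euclidean (E e i j)" for e i j
      unfolding E_def by (rule continuous_map_fan)
    show "(\<Union>e i j. E e i j ` cell e) = polygon n"
      unfolding fan_covers[OF n(1), symmetric]
    proof (intro equalityI subsetI)
      fix P assume "P \<in> (\<Union>e i j. E e i j ` cell e)"
      then obtain e i j where "P \<in> fan n (num e i j) ` cell (even (num e i j))" unfolding E_def ev by blast
      then show "P \<in> (\<Union>k. fan n k ` cell (even k))" by blast
    next
      fix P assume "P \<in> (\<Union>k. fan n k ` cell (even k))"
      then obtain k where k: "P \<in> fan n k ` cell (even k)" by blast
      have "num (even k) ((k + 1) div 2) 0 = k" unfolding num_def by presburger
      then have "P \<in> E (even k) ((k + 1) div 2) 0 ` cell (even k)" using k by (simp add: E_def)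
      then show "P \<in> (\<Union>e i j. E e i j ` cell e)" by blast
    qed
    show "E e i j z = E e i' j' z" if "L (i - i') (j - j')" "z \<in> cell e" for e i j i' j' z
    proof -
      have "num e i j - num e i' j' = 2 * (i - i' - int r * (j - j'))" by (simp add: num_def algebra_simps)
      moreover have "2 * int m dvd 2 * (i - i' - int r * (j - j'))"
        using that(1) unfolding L by (rule mult_dvd_mono[OF dvd_refl])
      ultimately have "int n dvd num e i j - num e i' j'" by (simp only: n_def of_nat_mult of_nat_numeral)
      then show ?thesis unfolding E_def using fan_cong n by metis
    qed
    show "equivclp (edge_pattern n (int r)) (E True i j z) (E False i j z)" if "z \<in> segment_ab" for z i j
      using fan_ac[of z "num False i j"] that ev[of False i j] by (simp add: E_def num_def)
    show "equivclp (edge_pattern n (int r)) (E True i j z) (E False (i + 1) j z)" if "z \<in> segment_ac" for z i j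
      using fan_ac[of z "num True i j"] that ev[of True i j] by (simp add: E_def num_def algebra_simps)
    show "equivclp (edge_pattern n (int r)) (E True i (j + 1) z) (E False i j z)" if z: "z \<in> segment_bc" for z i j
    proof -
      \<comment> \<open>Crossing bc leads from triangle \<open>2 s - 1\<close> to triangle
        \<open>2 s - 2 r\<close>, because raising \<open>j\<close> by 1 costs \<open>r\<close> in
        the first index. This is the odd half of the edge pattern.\<close>
      define s where "s = i - int r * j"
      have "E False i j z = edge n (2 * s - 1) (bary_b z)" "E True i (j + 1) z = edge n (2 * s - 2 * int r) (1 - bary_b z)"
        using fan_bc[OF z, of "num False i j"] fan_bc[OF z, of "num True i (j + 1)"] bc01(2)[OF z] ev
        by (simp_all add: E_def num_def s_def algebra_simps)
      then have "edge_pattern n (int r) (E False i j z) (E True i (j + 1) z)"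
        unfolding edge_pattern_def reversepath_def using bc01(1)[OF z] by metis
      then show ?thesis by (blast intro: equivclp_sym r_into_equivclp)
    qed
    show "z = w \<and> lift e i j z = lift e' i' j' w"
      if z: "z \<in> cell e" and w: "w \<in> cell e'" and eq: "E e i j z = E e' i' j' w" for e i j e' i' j' z w
    proof -
      define k k' where "k = num e i j" and "k' = num e' i' j'"
      have zw: "z \<in> cell (even k)" "w \<in> cell (even k')" "fan n k z = fan n k' w"
        using z w eq ev by (simp_all add: k_def k'_def E_def)
      have zw': "z = w" by (rule fan_eqD(1)[OF n(1,2) zw])
      from fan_eqD(2)[OF n(1,2) zw] have "S k z = S k' z"
      proof (elim disjE conjE)
        show "S k z = S k' z" if "z = a_vertex" using S_a that by simp
        show "S k z = S k' z" if "int n dvd k' - k" using S_cong[OF that, of z] zw zw' by simp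
        show "S k z = S k' z" if "int n dvd k' - (k + 1)" "z \<in> (if even k then segment_ac else segment_ab)"
          using S_next[OF that(2)] S_cong[OF that(1), of z] zw zw' by simp
        show "S k z = S k' z" if "int n dvd k - (k' + 1)" "z \<in> (if even k' then segment_ac else segment_ab)"
          using S_next[OF that(2)] S_cong[OF that(1), of z] zw zw' by simp
      qed
      then show ?thesis using lift_S z w zw' by (simp add: k_def k'_def)
    qed
    show "\<exists>e i j e' i' j' z. z \<in> cell e \<and> z \<in> cell e' \<and> x = E e i j z \<and> y = E e' i' j' z \<and>
        lift e i j z = lift e' i' j' z" if pat: "edge_pattern n (int r) x y" for x y
    proof -
      have main: "\<exists>z. z \<in> cell True \<and> z \<in> cell False \<and> edge n (2 * k - 1) t = E False k 0 z \<and>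
         edge n (2 * k - 2 * int r) (1 - t) = E True k 1 z \<and> lift False k 0 z = lift True k 1 z"
        if t: "t \<in> {0..1}" for k t
      proof -
        obtain z where z: "z \<in> segment_bc" "bary_b z = t" using bc_ex[OF t] by blast
        show ?thesis
        proof (intro exI conjI)
          show "z \<in> cell True" "z \<in> cell False" using z segment_subset_cell by blast+
          show "edge n (2 * k - 1) t = E False k 0 z"
            using fan_bc[OF z(1), of "num False k 0"] z by (simp add: E_def num_def)
          show "edge n (2 * k - 2 * int r) (1 - t) = E True k 1 z"
            using fan_bc[OF z(1), of "num True k 1"] z bc01(2)[OF z(1)] by (simp add: E_def num_def algebra_simps)
          show "lift False k 0 z = lift True k 1 z" using lift_bc[OF z(1), of k 0] by simp
        qed
      qed
      from pat obtain k t where t: "t \<in> {0..1}" and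
        "(x = edge n (2 * k) t \<and> y = edge n (2 * k + 2 * int r - 1) (1 - t)) \<or>
         (x = edge n (2 * k - 1) t \<and> y = edge n (2 * k - 2 * int r) (1 - t))"
        unfolding edge_pattern_def reversepath_def by blast
      then show ?thesis
      proof (elim disjE conjE)
        assume "x = edge n (2 * k - 1) t" "y = edge n (2 * k - 2 * int r) (1 - t)"
        then show ?thesis using main[OF t, of k] by metis
      next
        assume xy: "x = edge n (2 * k) t" "y = edge n (2 * k + 2 * int r - 1) (1 - t)"
        have "1 - t \<in> {0..1}" using t by auto
        \<comment> \<open>The even half of the pattern is the odd half read backwards, with
          \<open>k + r\<close> for \<open>k\<close> and \<open>1 - t\<close> for
          \<open>t\<close>.\<close>
        from main[OF this, of "k + int r"] obtain z where "z \<in> cell True" "z \<in> cell False"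
          "y = E False (k + int r) 0 z" "x = E True (k + int r) 1 z"
          "lift False (k + int r) 0 z = lift True (k + int r) 1 z"
          using xy by (auto simp: algebra_simps)
        then show ?thesis by metis
      qed
    qed
    show "segment_bc \<subseteq> cell False" by (rule segment_subset_cell)
    show "c_vertex \<in> segment_bc" "b_vertex \<in> segment_bc" by simp_all
    show "\<exists>i j. E False i j ` segment_bc = path_image (edge n k) \<and>
        E False i j c_vertex = edge n k 0 \<and> E False i j b_vertex = edge n k 1" if "odd k" for k
    proof -
      \<comment> \<open>Odd positions belong to lower cells. On such an edge \<open>bary_b\<close>
        is the parameter, growing from 0 at the \<open>c\<close>-vertex to 1 at the
        \<open>b\<close>-vertex.\<close>
      have num: "num False ((k + 1) div 2) 0 = k" using that by (simp add: num_def, presburger)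
      have E: "E False ((k + 1) div 2) 0 z = edge n k (bary_b z)" if "z \<in> segment_bc" for z
        using fan_bc[OF that, of k] \<open>odd k\<close> unfolding E_def num by simp
      have "bary_b ` segment_bc = {0..1}" using bc01(1) bc_ex by (auto simp: image_iff) metis
      then have "E False ((k + 1) div 2) 0 ` segment_bc = path_image (edge n k)"
        unfolding path_image_def using E by (metis (no_types, lifting) image_cong image_image)
      then show ?thesis using E by (intro exI[of _ "(k + 1) div 2"] exI[of _ 0]) simp
    qed
  qed
  then show ?thesis by (simp add: n_def)
qed

end

section \<open>The Fermat polygon\<close>

text \<open>Where the radius vanishes the angle may jump; the polygon lies in the unit disc, so the
  product still tends to 0.\<close>

lemma continuous_map_scaled_boundary:
  assumes R: "continuous_map Y euclideanreal R" and \<tau>: "\<And>x. x \<in> topspace Y \<Longrightarrow> R x \<noteq> 0 \<Longrightarrow> (\<tau> \<longlongrightarrow> \<tau> x) (atin Y x)"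
  shows "continuous_map Y euclidean (\<lambda>x. R x *\<^sub>R polygon_boundary n (\<tau> x))"
  unfolding continuous_map_atin limitin_canonical_iff
proof
  fix x assume x: "x \<in> topspace Y"
  have Rx: "(R \<longlongrightarrow> R x) (atin Y x)" using R x by (simp add: continuous_map_atin)
  show "((\<lambda>x. R x *\<^sub>R polygon_boundary n (\<tau> x)) \<longlongrightarrow> R x *\<^sub>R polygon_boundary n (\<tau> x)) (atin Y x)"
  proof (cases "R x = 0")
    case False
    have "isCont (polygon_boundary n) (\<tau> x)"
      using continuous_on_polygon_boundary[of n] by (simp add: continuous_on_eq_continuous_at)
    then have "((\<lambda>x. polygon_boundary n (\<tau> x)) \<longlongrightarrow> polygon_boundary n (\<tau> x)) (atin Y x)"
      by (rule isCont_tendsto_compose) (rule \<tau>[OF x False])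
    then show ?thesis using Rx by (rule tendsto_scaleR[rotated])
  next
    case True
    have "polygon n \<subseteq> cball 0 1"
      unfolding polygon_def by (rule hull_minimal) (auto simp: polygon_vertex_def)
    then have "norm (polygon_boundary n t) \<le> 1" for t using boundary_in_polygon[of n t] by auto
    then have "norm (R y *\<^sub>R polygon_boundary n (\<tau> y)) \<le> norm (R y)" for y
      by (simp add: mult_left_le)
    then have "\<forall>\<^sub>F y in atin Y x. norm (R y *\<^sub>R polygon_boundary n (\<tau> y)) \<le> norm (R y)" by simp
    then have "((\<lambda>x. R x *\<^sub>R polygon_boundary n (\<tau> x)) \<longlongrightarrow> 0) (atin Y x)"
      by (rule Lim_null_comparison) (rule tendsto_norm_zero[OF Rx[unfolded True]])
    then show ?thesis using True by simp
  qed
qed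

text \<open>The polygon of the Fermat case is cut into \<open>p\<close> sectors by the segments from the \<open>a\<close>-vertex
  in the centre to every \<open>(2q - 2)\<close>-th corner; the latter are \<open>c\<close>-vertices. Around the \<open>b\<close>-vertex in
  the sector lie \<open>2q\<close> triangles, two of which contain the centre (those with \<open>l = 0\<close>), whereas each of
  the others has an edge of the polygon. The tiles are not straight: in the coordinates
  \<open>R *\<^sub>R polygon_boundary n \<tau>\<close> the \<open>b\<close>-vertex is the point with \<open>R = 1 / 2\<close> and \<open>\<tau>\<close> in the middle of
  the sector, and \<open>wedge_angle\<close> is the difference of \<open>\<tau>\<close> from that middle.\<close>

definition wedge_radius :: "int \<Rightarrow> complex option \<Rightarrow> real" where
  "wedge_radius l z = (if l = 0 then bary_c z + bary_b z / 2 else 1 - bary_b z / 2)"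

text \<open>A sector has \<open>2 q - 2\<close> edges, so its angles run from \<open>1 - q\<close>
  to \<open>q - 1\<close>. In an inner triangle the angle goes from 0 on ab to an extreme value on
  ac. An outer triangle belongs to the edge that begins at \<open>k - q\<close>, where
  \<open>k\<close> is \<open>2 l - 1\<close> for the upper cell and \<open>2 l\<close> for the lower
  one; the position on that edge is contracted linearly towards the \<open>b\<close>-vertex, which
  has angle 0.\<close>

definition wedge_angle :: "nat \<Rightarrow> bool \<Rightarrow> int \<Rightarrow> complex option \<Rightarrow> real" where
  "wedge_angle q e l z =
     (if l = 0 then (if e then real q - 1 else 1 - real q) * (bary_c z / (bary_b z + bary_c z))
      else (1 - bary_b z) * (of_int (2 * l - (if e then 1 else 0)) - real q) + (if e then bary_a z else bary_c z))"

text \<open>\<open>s = 1 - bary_a z\<close> measures the distance from the centre of the polygon,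
  and \<open>g\<close> interpolates between the sides ab, where it is 0, and ac, where it is
  1.\<close>

lemma wedge_inner_shape:
  assumes "wedge_radius 0 z \<noteq> 0"
  obtains s g where "0 < s" "0 \<le> g" "g \<le> 1" "bary_c z = g * s" "bary_b z = s - g * s" "s \<le> 1"
    "wedge_radius 0 z = s * (1 + g) / 2" "\<And>q e. wedge_angle q e 0 z = (if e then real q - 1 else 1 - real q) * g"
proof -
  define s g where "s = bary_b z + bary_c z" and "g = bary_c z / s"
  note nn = bary_nonneg[of z]
  have "s \<noteq> 0" using assms nn by (auto simp: s_def wedge_radius_def add_nonneg_eq_0_iff)
  then have s: "0 < s" using nn by (simp add: s_def)
  have c: "bary_c z = g * s" using s by (simp add: g_def)
  have b: "bary_b z = s - g * s" using c by (simp add: s_def)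
  have "g \<le> 1" using s nn by (simp add: g_def s_def)
  moreover have "0 \<le> g" using s nn by (simp add: g_def)
  moreover have "s \<le> 1" using bary_sum[of z] nn by (simp add: s_def)
  moreover have "wedge_radius 0 z = s * (1 + g) / 2" by (simp add: wedge_radius_def b c field_simps)
  moreover have "wedge_angle q e 0 z = (if e then real q - 1 else 1 - real q) * g" for q e
    by (simp add: wedge_angle_def g_def s_def)
  ultimately show ?thesis using that s c b by blast
qed

text \<open>\<open>r\<close> measures the distance from the \<open>b\<close>-vertex,
  \<open>k\<close> numbers the edges of the sector from 1 to \<open>2 q - 2\<close>, and
  \<open>x / r\<close> is the position along the edge, counterclockwise.\<close>

lemma wedge_outer_shape:
  assumes "0 < l" "l < int q"
  obtains k x r where "0 \<le> r" "r \<le> 1" "bary_b z = 1 - r" "1 \<le> k" "k \<le> 2 * int q - 2"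
    "0 \<le> x" "x \<le> r" "x = (if e then bary_a z else bary_c z)" "k = 2 * l - (if e then 1 else 0)"
    "wedge_radius l z = (1 + r) / 2" "wedge_angle q e l z = r * (of_int k - real q) + x"
    "\<bar>wedge_angle q e l z\<bar> \<le> r * (real q - 1)"
proof -
  define k r x where "k = 2 * l - (if e then 1 else 0)" and "r = 1 - bary_b z"
    and "x = (if e then bary_a z else bary_c z)"
  note nn = bary_nonneg[of z] bary_sum[of z]
  have k: "1 \<le> k" "k \<le> 2 * int q - 2" using assms by (auto simp: k_def)
  have r: "0 \<le> r" "r \<le> 1" "0 \<le> x" "x \<le> r" using nn by (auto simp: r_def x_def)
  have T: "wedge_angle q e l z = r * (of_int k - real q) + x"
    using assms by (simp add: wedge_angle_def r_def k_def x_def)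
  have "real_of_int k \<ge> 1" "real_of_int k \<le> 2 * real q - 2" using k by linarith+
  then have "r * (1 - real q) \<le> r * (of_int k - real q)" "r * (of_int k - real q) \<le> r * (real q - 2)"
    using r by (auto intro!: mult_left_mono)
  then have "\<bar>r * (of_int k - real q) + x\<bar> \<le> r * (real q - 1)"
    using r(3,4) by (simp add: algebra_simps abs_le_iff)
  then have b: "\<bar>wedge_angle q e l z\<bar> \<le> r * (real q - 1)" unfolding T .
  have "wedge_radius l z = (1 + r) / 2" using assms by (simp add: wedge_radius_def r_def field_simps)
  moreover have "bary_b z = 1 - r" by (simp add: r_def)
  ultimately show ?thesis using that r k T b x_def k_def by blast
qed

lemma wedge_angle_bound:
  assumes "2 \<le> q" "0 \<le> l" "l < int q" "wedge_radius l z \<noteq> 0"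
  shows "\<bar>wedge_angle q e l z\<bar> \<le> real q - 1"
proof (cases "l = 0")
  case True
  have "wedge_radius 0 z \<noteq> 0" using True assms by simp
  then obtain s g where g: "0 \<le> g" "g \<le> 1"
    "\<And>q e. wedge_angle q e 0 z = (if e then real q - 1 else 1 - real q) * g"
    by (rule wedge_inner_shape) blast
  have "(real q - 1) * g \<le> (real q - 1) * 1" using g assms by (intro mult_left_mono) auto
  moreover have "0 \<le> (real q - 1) * g" using g assms by auto
  ultimately show ?thesis
    unfolding True g(3) by (cases e) (auto simp: abs_le_iff algebra_simps)
next
  case False
  then have "0 < l" using assms by simp
  from wedge_outer_shape[OF this assms(3), of z e] obtain r where r: "r \<le> 1" "\<bar>wedge_angle q e l z\<bar> \<le> r * (real q - 1)"
    by metis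
  moreover have "r * (real q - 1) \<le> 1 * (real q - 1)" using r assms by (intro mult_right_mono) auto
  ultimately show ?thesis by simp
qed

text \<open>The extreme angles form the two straight sides of a sector; \<open>t\<close> selects the
  counterclockwise one. The whole side belongs to an inner triangle, whereas the last outer triangle
  on that side reaches it at its \<open>c\<close>-vertex only.\<close>

lemma wedge_extreme_angle:
  assumes q: "2 \<le> q" and l: "0 \<le> l" "l < int q" and R: "wedge_radius l z \<noteq> 0"
    and T: "wedge_angle q e l z = (if t then real q - 1 else 1 - real q)"
  shows "bary_b z = 0" "wedge_radius l z = bary_c z"
    "l = 0 \<and> e = t \<or> bary_c z = 1 \<and> e \<noteq> t \<and> l = (if t then int q - 1 else 1)"
proof -
  have "bary_b z = 0 \<and> wedge_radius l z = bary_c z \<and>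
    (l = 0 \<and> e = t \<or> bary_c z = 1 \<and> e \<noteq> t \<and> l = (if t then int q - 1 else 1))"
  proof (cases "l = 0")
    case True
    have "wedge_radius 0 z \<noteq> 0" using True R by simp
    then obtain s g where g: "0 < s" "0 \<le> g" "bary_c z = g * s" "bary_b z = s - g * s"
      "\<And>q e. wedge_angle q e 0 z = (if e then real q - 1 else 1 - real q) * g"
      by (rule wedge_inner_shape) blast
    have q1: "real q - 1 > 0" using q by simp
    have p: "(real q - 1) * g \<ge> 0" using g(2) q1 by simp
    have "(if e then real q - 1 else 1 - real q) * g = (if t then real q - 1 else 1 - real q)"
      using T True g(5) by simp
    then have "e = t \<and> (real q - 1) * g = real q - 1"
      using p q1 by (cases e; cases t; simp; linarith?) (simp_all add: algebra_simps)
    then have "e = t" "g = 1" using q1 by auto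
    then show ?thesis using True g by (simp add: wedge_radius_def)
  next
    case False
    then have "0 < l" using l by simp
    then obtain k x r where k: "0 \<le> r" "r \<le> 1" "bary_b z = 1 - r" "1 \<le> k" "k \<le> 2 * int q - 2"
      "0 \<le> x" "x \<le> r" "x = (if e then bary_a z else bary_c z)" "k = 2 * l - (if e then 1 else 0)"
      "wedge_radius l z = (1 + r) / 2" "wedge_angle q e l z = r * (of_int k - real q) + x"
      "\<bar>wedge_angle q e l z\<bar> \<le> r * (real q - 1)"
      by (rule wedge_outer_shape[OF _ l(2)]) blast
    have q1: "real q - 1 > 0" using q by simp
    have "real q - 1 \<le> r * (real q - 1)" using k(12) T q1 by (auto split: if_splits)
    then have r: "r = 1" using k(2) q1 by simp
    have sum: "bary_a z + bary_c z = 1" using k(3) r bary_sum[of z] by simp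
    have kx: "real_of_int k + x = (if t then 2 * real q - 1 else 1)" using T k(11) r by (auto split: if_splits)
    have x01: "0 \<le> x" "x \<le> 1" using k(6,7) r by auto
    show ?thesis
    proof (cases t)
      case True
      have "real_of_int k \<le> 2 * real q - 2" using k(5) by linarith
      then have "x = 1" "real_of_int k = 2 * real q - 2" using kx True x01 by auto
      then have "k = 2 * int q - 2" by linarith
      then have "\<not> e" "l = int q - 1" using k(9) by (cases e; simp; presburger)+
      then show ?thesis using True k(3,8,10) r \<open>x = 1\<close> by simp
    next
      case False
      have "real_of_int k \<ge> 1" using k(4) by linarith
      then have "x = 0" "real_of_int k = 1" using kx False x01 by auto
      then have "k = 1" by linarith
      then have "e" "l = 1" using k(9) by (cases e; simp; presburger)+
      then show ?thesis using False k(3,8,10) r \<open>x = 0\<close> sum by simp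
    qed
  qed
  then show "bary_b z = 0" "wedge_radius l z = bary_c z"
    "l = 0 \<and> e = t \<or> bary_c z = 1 \<and> e \<noteq> t \<and> l = (if t then int q - 1 else 1)" by blast+
qed

text \<open>Coincidences around the \<open>b\<close>-vertex of one sector: ab joins the two cells
  with the same \<open>l\<close>, bc joins lower \<open>l\<close> to upper \<open>l + 1\<close>
  cyclically, and all cells meet at the vertex itself. Segment ac is absent because it leads out of
  the sector.\<close>

definition wedge_neighbours :: "nat \<Rightarrow> complex option \<Rightarrow> bool \<Rightarrow> int \<Rightarrow> bool \<Rightarrow> int \<Rightarrow> bool" where
  "wedge_neighbours q z e l e' l' \<longleftrightarrow> e = e' \<and> l = l' \<or> bary_c z = 0 \<and> l = l' \<or> bary_b z = 1 \<or>
     bary_a z = 0 \<and> (\<not> e \<and> e' \<and> l' = (l + 1) mod int q \<or> e \<and> \<not> e' \<and> l = (l' + 1) mod int q)"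

lemma wedge_inner_inner:
  assumes q: "2 \<le> q" and R: "wedge_radius 0 z \<noteq> 0" "wedge_radius 0 z = wedge_radius 0 w"
    and T: "wedge_angle q e 0 z = wedge_angle q e' 0 w"
  shows "bary_b z = bary_b w \<and> bary_c z = bary_c w \<and> (e = e' \<or> bary_c z = 0)"
proof -
  obtain s g where z: "0 < s" "0 \<le> g" "g \<le> 1" "bary_c z = g * s" "bary_b z = s - g * s"
    "wedge_radius 0 z = s * (1 + g) / 2" "\<And>q e. wedge_angle q e 0 z = (if e then real q - 1 else 1 - real q) * g"
    using R(1) by (rule wedge_inner_shape) blast
  have "wedge_radius 0 w \<noteq> 0" using R by simp
  then obtain s' g' where w: "0 < s'" "0 \<le> g'" "g' \<le> 1" "bary_c w = g' * s'" "bary_b w = s' - g' * s'"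
    "wedge_radius 0 w = s' * (1 + g') / 2" "\<And>q e. wedge_angle q e 0 w = (if e then real q - 1 else 1 - real q) * g'"
    by (rule wedge_inner_shape) blast
  have q1: "real q - 1 > 0" using q by simp
  have eq: "(if e then real q - 1 else 1 - real q) * g = (if e' then real q - 1 else 1 - real q) * g'"
    using T unfolding z(7) w(7) .
  have gg: "g = g' \<and> (e = e' \<or> g = 0)"
  proof (cases "e = e'")
    case True
    moreover have "(if e then real q - 1 else 1 - real q) \<noteq> 0" using q1 by (cases e) auto
    ultimately show ?thesis using eq by simp
  next
    case False
    then have "(real q - 1) * g = - ((real q - 1) * g')" using eq by (cases e; cases e') (simp_all add: algebra_simps)
    then have "(real q - 1) * (g + g') = 0" by (simp add: algebra_simps)
    then have "g + g' = 0" using q1 by simp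
    then show ?thesis using z(2) w(2) by linarith
  qed
  moreover have "s * (1 + g) = s' * (1 + g')" using R(2) z(6) w(6) by simp
  ultimately have "s = s'" using z(2) by simp
  then show ?thesis using gg z(4,5) w(4,5) by auto
qed

text \<open>Equal radii give the same \<open>r\<close>, and angles are scaled by it. So the edge
  numbers differ by at most 1, and a difference of 1 forces the offset \<open>x\<close> to an end,
  that is, the point to ab or bc.\<close>

lemma wedge_outer_outer:
  assumes l: "0 < l" "l < int q" "0 < l'" "l' < int q"
    and R: "wedge_radius l z = wedge_radius l' w" and T: "wedge_angle q e l z = wedge_angle q e' l' w"
  shows "bary_b z = bary_b w \<and> bary_c z = bary_c w \<and> wedge_neighbours q z e l e' l'"
proof -
  obtain k x r where z: "0 \<le> r" "r \<le> 1" "bary_b z = 1 - r" 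
    "0 \<le> x" "x \<le> r" "x = (if e then bary_a z else bary_c z)" "k = 2 * l - (if e then 1 else 0)"
    "wedge_radius l z = (1 + r) / 2" "wedge_angle q e l z = r * (of_int k - real q) + x"
    by (rule wedge_outer_shape[OF l(1,2)]) blast
  obtain k' x' r' where w: "bary_b w = 1 - r'"
    "0 \<le> x'" "x' \<le> r'" "x' = (if e' then bary_a w else bary_c w)" "k' = 2 * l' - (if e' then 1 else 0)"
    "wedge_radius l' w = (1 + r') / 2" "wedge_angle q e' l' w = r' * (of_int k' - real q) + x'"
    by (rule wedge_outer_shape[OF l(3,4)]) blast
  have r: "r' = r" using R z(8) w(6) by simp
  have bb: "bary_b z = bary_b w" using z(3) w(1) r by simp
  have sz: "bary_a z + bary_c z = r" and sw: "bary_a w + bary_c w = r"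
    using bary_sum[of z] bary_sum[of w] z(3) w(1) r by auto
  note nn = bary_nonneg[of z] bary_nonneg[of w]
  show ?thesis
  proof (cases "r = 0")
    case True
    then show ?thesis using sz sw nn z(3) bb by (simp add: wedge_neighbours_def add_nonneg_eq_0_iff)
  next
    case False
    then have r0: "r > 0" using z(1) by simp
    have d: "of_int (k' - k) * r = x - x'" using T unfolding z(9) w(7) r by (simp add: algebra_simps)
    have "\<bar>of_int (k' - k) * r\<bar> \<le> 1 * r" unfolding d using z(4,5) w(2,3) r by (simp add: abs_le_iff)
    then have "\<bar>real_of_int (k' - k)\<bar> \<le> 1" using r0 by (simp add: abs_mult)
    then have "k' = k \<or> k' = k + 1 \<or> k = k' + 1" by linarith
    then show ?thesis
    proof (elim disjE)
      assume kk: "k' = k"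
      then have e: "e = e'" "l = l'" using z(7) w(5) by (cases e; cases e'; simp; presburger)+
      have "x = x'" using d kk by simp
      then have "bary_c z = bary_c w" using z(6) w(4) sz sw e by (cases e) auto
      then show ?thesis using e bb by (simp add: wedge_neighbours_def)
    next
      assume kk: "k' = k + 1"
      then have x: "x = r" "x' = 0" using d z(4,5) w(2,3) r by auto
      show ?thesis
      proof (cases e)
        case True
        then have e: "\<not> e'" "l' = l" using z(7) w(5) kk by (cases e'; simp; presburger)+
        then have "bary_c z = 0" "bary_c w = 0" using True x z(6) w(4) sz by auto
        then show ?thesis using e bb by (simp add: wedge_neighbours_def)
      next
        case False
        then have e: "e'" "l' = l + 1" using z(7) w(5) kk by (cases e'; simp; presburger)+
        then have "bary_a z = 0" "bary_c z = bary_c w" using False x z(6) w(4) sz sw by auto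
        then show ?thesis using e False bb l(1,4) by (simp add: wedge_neighbours_def)
      qed
    next
      assume kk: "k = k' + 1"
      then have x: "x' = r" "x = 0" using d z(4,5) w(2,3) r by auto
      show ?thesis
      proof (cases e')
        case True
        then have e: "\<not> e" "l' = l" using z(7) w(5) kk by (cases e; simp; presburger)+
        then have "bary_c z = 0" "bary_c w = 0" using True x z(6) w(4) sw by auto
        then show ?thesis using e bb by (simp add: wedge_neighbours_def)
      next
        case False
        then have e: "e" "l = l' + 1" using z(7) w(5) kk by (cases e; simp; presburger)+
        then have "bary_a z = 0" "bary_c z = bary_c w" using False x z(6) w(4) sz sw by auto
        then show ?thesis using e False bb l(2,3) by (simp add: wedge_neighbours_def)
      qed
    qed
  qed
qed

text \<open>Equal radii mean \<open>s * (1 + g) = 1 + r\<close>, and equal angles imply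
  \<open>g \<le> r\<close>. Since \<open>s \<le> 1\<close>, this is possible only for
  \<open>s = 1\<close> and \<open>g = r\<close>: the point lies on bc.\<close>

lemma wedge_inner_outer:
  assumes q: "2 \<le> q" and l: "0 < l'" "l' < int q"
    and R: "wedge_radius 0 z = wedge_radius l' w" and T: "wedge_angle q e 0 z = wedge_angle q e' l' w"
  shows "bary_b z = bary_b w \<and> bary_c z = bary_c w \<and>
    (bary_b z = 1 \<or> bary_a z = 0 \<and> (\<not> e \<and> e' \<and> l' = 1 \<or> e \<and> \<not> e' \<and> l' = int q - 1))"
proof -
  obtain k x r where w: "0 \<le> r" "r \<le> 1" "bary_b w = 1 - r" "1 \<le> k" "k \<le> 2 * int q - 2"
    "0 \<le> x" "x \<le> r" "x = (if e' then bary_a w else bary_c w)" "k = 2 * l' - (if e' then 1 else 0)"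
    "wedge_radius l' w = (1 + r) / 2" "wedge_angle q e' l' w = r * (of_int k - real q) + x"
    "\<bar>wedge_angle q e' l' w\<bar> \<le> r * (real q - 1)"
    by (rule wedge_outer_shape[OF l]) blast
  have "wedge_radius 0 z \<noteq> 0" using R w(1,10) by simp
  then obtain s g where z: "0 < s" "0 \<le> g" "g \<le> 1" "bary_c z = g * s" "bary_b z = s - g * s" "s \<le> 1"
    "wedge_radius 0 z = s * (1 + g) / 2" "\<And>q e. wedge_angle q e 0 z = (if e then real q - 1 else 1 - real q) * g"
    by (rule wedge_inner_shape) blast
  have q1: "real q - 1 > 0" using q by simp
  have "(real q - 1) * g \<le> \<bar>wedge_angle q e 0 z\<bar>"
    unfolding z(8) using q1 by (cases e) (auto simp: abs_le_iff algebra_simps)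
  then have "(real q - 1) * g \<le> (real q - 1) * r" using w(12) T by (simp add: mult.commute)
  then have gr: "g \<le> r" using q1 by simp
  have sr: "s * (1 + g) = 1 + r" using R z(7) w(10) by simp
  have "s * (1 + g) \<le> 1 * (1 + g)" using z(2,6) by (intro mult_right_mono) auto
  then have g: "g = r" using sr gr by simp
  then have s: "s = 1" using sr z(2) by simp
  have bz: "bary_b z = 1 - r" "bary_c z = r" "bary_a z = 0" using z(4,5) g s bary_sum[of z] by auto
  have sw: "bary_a w + bary_c w = r" using bary_sum[of w] w(3) by simp
  show ?thesis
  proof (cases "r = 0")
    case True
    then show ?thesis using bz w(3) sw bary_nonneg[of w] by (simp add: add_nonneg_eq_0_iff)
  next
    case False
    then have r0: "r > 0" using w(1) by simp
    have eq: "(if e then real q - 1 else 1 - real q) * r = r * (of_int k - real q) + x"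
      using T unfolding z(8) w(11) g .
    show ?thesis
    proof (cases e)
      case True
      then have x: "(2 * real q - 1 - of_int k) * r = x" using eq by (simp add: algebra_simps)
      then have "(2 * real q - 1 - of_int k) * r \<le> 1 * r" using w(7) by simp
      then have "2 * real q - 1 - of_int k \<le> 1" using r0 by simp
      then have k: "k = 2 * int q - 2" using w(5) by linarith
      then have e: "\<not> e'" "l' = int q - 1" using w(9) by (cases e'; simp; presburger)+
      have "x = r" using x k by simp
      then show ?thesis using bz w(3,8) e True by simp
    next
      case False
      then have x: "(of_int k - 1) * r + x = 0" using eq by (simp add: algebra_simps)
      moreover have "0 \<le> (of_int k - 1) * r" using w(4) r0 by simp
      ultimately have "x = 0" "(of_int k - 1) * r = 0" using w(6) by linarith+
      then have "k = 1" using r0 by simp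
      then have e: "e'" "l' = 1" using w(9) by (cases e'; simp; presburger)+
      then show ?thesis using bz w(3,8) sw False \<open>x = 0\<close> by simp
    qed
  qed
qed

lemma wedge_eqD:
  assumes q: "2 \<le> q" and l: "0 \<le> l" "l < int q" "0 \<le> l'" "l' < int q"
    and R: "wedge_radius l z \<noteq> 0" "wedge_radius l z = wedge_radius l' w"
    and T: "wedge_angle q e l z = wedge_angle q e' l' w"
  shows "bary_b z = bary_b w" "bary_c z = bary_c w" "wedge_neighbours q z e l e' l'"
proof -
  have "bary_b z = bary_b w \<and> bary_c z = bary_c w \<and> wedge_neighbours q z e l e' l'"
  proof (cases "l = 0")
    case l0: True
    show ?thesis
    proof (cases "l' = 0")
      case True
      then show ?thesis using wedge_inner_inner[of q z w e e'] assms l0 by (auto simp: wedge_neighbours_def)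
    next
      case False
      then have "0 < l'" using l by simp
      then show ?thesis using wedge_inner_outer[of q l' z w e e'] assms l0 by (auto simp: wedge_neighbours_def)
    qed
  next
    case False
    then have l0: "0 < l" using l by simp
    show ?thesis
    proof (cases "l' = 0")
      case True
      have "bary_b w = bary_b z \<and> bary_c w = bary_c z \<and>
        (bary_b w = 1 \<or> bary_a w = 0 \<and> (\<not> e' \<and> e \<and> l = 1 \<or> e' \<and> \<not> e \<and> l = int q - 1))"
        by (rule wedge_inner_outer[OF q l0 l(2)]) (use R T True in simp_all)
      moreover from this have "bary_a w = bary_a z" using bary_sum[of z] bary_sum[of w] by simp
      moreover have "(int q - 1 + 1) mod int q = 0" "(0 + 1) mod int q = 1" using q by simp_all
      ultimately show ?thesis unfolding True wedge_neighbours_def by metis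
    next
      case False
      then have "0 < l'" using l by simp
      then show ?thesis using wedge_outer_outer[OF l0 l(2) _ l(4) R(2) T] by blast
    qed
  qed
  then show "bary_b z = bary_b w" "bary_c z = bary_c w" "wedge_neighbours q z e l e' l'" by blast+
qed

text \<open>Here \<delta> is the angle divided by the half width of a sector. The segments bc
  between inner and outer triangles are given by \<open>2 * R - 1 = \<bar>\<delta>\<bar>\<close>,
  which explains the case distinction.\<close>

lemma wedge_covers:
  assumes q: "2 \<le> q" and R: "0 \<le> R" "R \<le> 1" and \<delta>: "\<bar>\<delta>\<bar> \<le> 1" "\<delta> < 1"
  obtains e l z where "0 \<le> l" "l < int q" "z \<in> cell e" "wedge_radius l z = R"
    "R = 0 \<or> wedge_angle q e l z = (real q - 1) * \<delta>"
proof (cases "2 * R - 1 \<le> \<bar>\<delta>\<bar>")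
  case True
  \<comment> \<open>Solves \<open>R = s * (1 + g) / 2\<close> for an inner triangle with
    \<open>g = \<bar>\<delta>\<bar>\<close>.\<close>
  define s where "s = 2 * R / (1 + \<bar>\<delta>\<bar>)"
  have s: "0 \<le> s" "s \<le> 1" using R True by (auto simp: s_def pos_divide_le_eq)
  have "s * (1 + \<bar>\<delta>\<bar>) = 2 * R" by (simp add: s_def)
  then have sR: "\<bar>\<delta>\<bar> * s + (1 - \<bar>\<delta>\<bar>) * s / 2 = R" by (simp add: field_simps)
  have "(1 - \<bar>\<delta>\<bar>) * s + \<bar>\<delta>\<bar> * s = s" by (simp add: algebra_simps)
  then obtain z where z: "z \<in> cell (0 < \<delta>)" "bary_b z = (1 - \<bar>\<delta>\<bar>) * s" "bary_c z = \<bar>\<delta>\<bar> * s"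
    using bary_surj'[of "(1 - \<bar>\<delta>\<bar>) * s" "\<bar>\<delta>\<bar> * s"  "0 < \<delta>"] s \<delta> by (metis abs_ge_zero diff_ge_0_iff_ge mult_nonneg_nonneg)
  have sum: "bary_b z + bary_c z = s" using z by (simp add: algebra_simps)
  show ?thesis
  proof (rule that[of 0 z "0 < \<delta>"])
    show "wedge_radius 0 z = R" using z sR by (simp add: wedge_radius_def)
    show "R = 0 \<or> wedge_angle q (0 < \<delta>) 0 z = (real q - 1) * \<delta>"
    proof (cases "s = 0")
      case True
      then show ?thesis using sR by simp
    next
      case False
      have "bary_c z / (bary_b z + bary_c z) = bary_c z / s" by (simp only: sum)
      also have "\<dots> = \<bar>\<delta>\<bar>" using z(3) False by simp
      finally have "bary_c z / (bary_b z + bary_c z) = \<bar>\<delta>\<bar>" .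
      then show ?thesis by (cases "0 < \<delta>") (simp_all add: wedge_angle_def algebra_simps)
    qed
  qed (use q z in auto)
next
  case False
  define r where "r = 2 * R - 1"
  have r: "0 < r" "r \<le> 1" "\<bar>\<delta>\<bar> < r" using False R by (auto simp: r_def)
  have q1: "real q - 1 > 0" using q by simp
  \<comment> \<open>Projection from the \<open>b\<close>-vertex to the rim divides the angle by
    \<open>r\<close>; the shift by \<open>q\<close> turns the integer part into the number of the
    edge.\<close>
  define v where "v = (real q - 1) * \<delta> / r"
  define u where "u = v + real q"
  have "\<bar>v\<bar> < real q - 1"
    using r q1 unfolding v_def by (simp add: abs_mult abs_divide pos_divide_less_eq)
  then have u: "1 < u" "u < 2 * real q - 1" unfolding u_def by linarith+
  define k x where "k = \<lfloor>u\<rfloor>" and "x = r * frac u"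
  have k: "1 \<le> k" "k \<le> 2 * int q - 2" using u unfolding k_def by linarith+
  have x: "0 \<le> x" "x \<le> r"
    using r frac_lt_1[of u] mult_left_mono[of "frac u" 1 r] by (auto simp: x_def)
  define e where "e = odd k"
  define l where "l = (k + 1) div 2"
  have kl: "k = 2 * l - (if e then 1 else 0)" unfolding l_def e_def by (cases "odd k"; simp; presburger)
  have l: "0 < l" "l < int q" using k unfolding l_def by linarith+
  define c where "c = (if e then r - x else x)"
  have c: "0 \<le> c" "c \<le> r" using x by (auto simp: c_def)
  obtain z where z: "z \<in> cell e" "bary_b z = 1 - r" "bary_c z = c"
    by (rule bary_surj'[of "1 - r" c e]) (use r c in auto)
  have a: "bary_a z = r - c" using z bary_sum[of z] by simp
  show ?thesis
  proof (rule that[of l z e])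
    show "wedge_radius l z = R" using l z by (simp add: wedge_radius_def r_def field_simps)
    have "wedge_angle q e l z = r * (of_int k - real q) + x"
      using l z a unfolding wedge_angle_def kl by (simp add: c_def)
    also have "\<dots> = r * (u - real q)" by (simp add: x_def k_def frac_def algebra_simps)
    also have "\<dots> = (real q - 1) * \<delta>" using r by (simp add: u_def v_def)
    finally show "R = 0 \<or> wedge_angle q e l z = (real q - 1) * \<delta>" ..
  qed (use l z in auto)
qed

section \<open>Assembling the sectors of the Fermat polygon\<close>

context triangulated_cover
begin

text \<open>Modulo the periods, \<open>i\<close> numbers the sectors and \<open>j\<close> the pairs
  of triangles around the \<open>b\<close>-vertex of a sector. Crossing ac goes from upper
  \<open>(i, j)\<close> to lower \<open>(i + 1, j)\<close>: for \<open>j\<close> divisible by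
  \<open>q\<close> these are inner triangles of adjacent sectors, already joined in the polygon; all
  other crossings of ac produce the edge pattern.\<close>

theorem product_presentation:
  assumes L: "\<And>i j. L i j \<longleftrightarrow> int p dvd i \<and> int q dvd j" and p: "2 \<le> p" and q: "2 \<le> q"
  shows "polygon_presentation X pr (2 * p * q - 2 * p) (int q) segment_ac a_vertex c_vertex"
proof -
  define n where "n = 2 * p * q - 2 * p"
  have n_eq: "n = 2 * (p * (q - 1))" by (simp add: n_def algebra_simps)
  have "2 * 1 \<le> p * (q - 1)" using p q by (intro mult_le_mono) auto
  then have n: "3 \<le> n" "0 < n" "2 \<le> n" unfolding n_eq by linarith+
  have real_n: "real n = 2 * real p * (real q - 1)" unfolding n_eq using q by (simp add: of_nat_diff)
  have q1: "real q - 1 > 0" using q by simp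
  \<comment> \<open>Sector \<open>i\<close> occupies the \<open>2 q - 2\<close> edges that start at
    \<open>2 i (q - 1)\<close>; this is their middle.\<close>
  define mid where "mid = (\<lambda>i. (real q - 1) * (2 * of_int i + 1))"
  define E where "E = (\<lambda>e i j z. wedge_radius (j mod int q) z *\<^sub>R
      polygon_boundary n (mid i + wedge_angle q e (j mod int q) z))"
  have jq: "0 \<le> j mod int q" "j mod int q < int q" for j using q by auto
  have mid_shift: "mid (i + int p * d) = mid i + of_int (int n * d)" for i d
    by (simp add: mid_def real_n algebra_simps)
  have period: "lift e i j z = lift e i' j' z"
    if "int p dvd i - i'" "j mod int q = j' mod int q" "z \<in> cell e" for e i i' j j' z
    by (rule lift_period) (use that in \<open>auto simp: L mod_eq_dvd_iff\<close>)
  have ab: "lift e i j z = lift e' i j z" if "z \<in> segment_ab" for e e' i j z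
    using lift_ab[OF that] by (cases e; cases e') auto
  have at_a: "lift True i j a_vertex = lift True i' j a_vertex" for i i' j
  proof (rule int_step_invariant[of "\<lambda>i. lift True i j a_vertex"])
    show "lift True i j a_vertex = lift True (i + 1) j a_vertex" for i
      using lift_ac[of a_vertex i j] lift_ab[of a_vertex "i + 1" j] by simp
  qed
  have at_b: "lift True i j b_vertex = lift True i j' b_vertex" for i j j'
  proof (rule int_step_invariant[of "\<lambda>j. lift True i j b_vertex"])
    show "lift True i j b_vertex = lift True i (j + 1) b_vertex" for j
      using lift_bc[of b_vertex i j] lift_ab[of b_vertex i j] by simp
  qed
  \<comment> \<open>Tiles of one sector, where sectors may be numbered with a difference of full
    turns.\<close>
  have neighbours: "z = w \<and> lift e i j z = lift e' i' j' w"
    if z: "z \<in> cell e" and w: "w \<in> cell e'" and i: "int p dvd i - i'"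
      and b: "bary_b z = bary_b w" "bary_c z = bary_c w"
      and nb: "wedge_neighbours q z e (j mod int q) e' (j' mod int q)" for z w e i j e' i' j'
  proof -
    have a: "bary_a z = bary_a w" using bary_sum[of z] bary_sum[of w] b by simp
    have eqv: "z = w" if "(z \<in> equator \<and> w \<in> equator)" using bary_eq_on_equator that b by blast
    consider "e = e'" "j mod int q = j' mod int q" | "bary_c z = 0" "j mod int q = j' mod int q" | "bary_b z = 1"
      | "bary_a z = 0" "\<not> e" "e'" "j' mod int q = (j mod int q + 1) mod int q"
      | "bary_a z = 0" "e" "\<not> e'" "j mod int q = (j' mod int q + 1) mod int q"
      using nb unfolding wedge_neighbours_def by blast
    then show ?thesis
    proof cases
      case 1
      then have "z = w" using bary_eq_imp_eq[OF z _ b] w by simp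
      then show ?thesis using period[OF i 1(2) z] 1(1) by simp
    next
      case 2
      then have s: "z \<in> segment_ab" "w \<in> segment_ab" using bary_faces(3) b by metis+
      then have "z = w" using eqv equator_eq by blast
      then show ?thesis using period[OF i 2(2) z] ab[OF s(1), of e i' j' e'] by simp
    next
      case 3
      then have "bary_c z = 0" using bary_sum[of z] bary_nonneg[of z] by linarith
      then have v: "z = b_vertex" "w = b_vertex" using bary_eq_vertexD(2) z w b 3 by metis+
      have "lift e i j b_vertex = lift True i j b_vertex" "lift e' i' j' b_vertex = lift True i' j' b_vertex"
        by (rule ab; simp)+
      moreover have "lift True i j b_vertex = lift True i' j b_vertex"
        by (rule period[OF i refl]) (simp add: vertex_in_cell vertices_def)
      ultimately show ?thesis using v at_b by metis
    next
      case 4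
      then have s: "z \<in> segment_bc" "w \<in> segment_bc" using bary_faces(1) a by metis+
      then have zw: "z = w" using eqv equator_eq by blast
      have "lift e i j z = lift e i' j z" by (rule period[OF i refl z])
      also have "\<dots> = lift True i' (j + 1) z" using lift_bc[OF s(1)] 4 by simp
      also have "\<dots> = lift True i' j' z"
        by (rule period) (use 4 w zw in \<open>auto simp: mod_add_left_eq\<close>)
      finally show ?thesis using 4 zw by simp
    next
      case 5
      then have s: "z \<in> segment_bc" "w \<in> segment_bc" using bary_faces(1) a by metis+
      then have zw: "z = w" using eqv equator_eq by blast
      have "lift e' i' j' w = lift e' i j' w" by (rule period) (use i w in \<open>auto simp: dvd_diff_commute\<close>)
      also have "\<dots> = lift True i (j' + 1) w" using lift_bc[OF s(2)] 5 by simp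
      also have "\<dots> = lift True i j w"
        by (rule period) (use 5 z zw in \<open>auto simp: mod_add_left_eq\<close>)
      finally show ?thesis using 5 zw by simp
    qed
  qed
  \<comment> \<open>On a straight side of the sector, any tile may be replaced by the inner tile of
    that side, so contacts between sectors reduce to those of inner tiles.\<close>
  have extreme: "z \<in> segment_ac \<and> wedge_radius (j mod int q) z = bary_c z \<and> lift e i j z = lift t i 0 z"
    if z: "z \<in> cell e" and R: "wedge_radius (j mod int q) z \<noteq> 0"
      and T: "wedge_angle q e (j mod int q) z = (if t then real q - 1 else 1 - real q)" for z e i j t
  proof -
    note x = wedge_extreme_angle[OF q jq R T]
    have ac: "z \<in> segment_ac" using x(1) bary_faces(2) by blast
    from x(3) have "lift e i j z = lift t i 0 z"
    proof (elim disjE conjE)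
      assume "j mod int q = 0" "e = t"
      then show ?thesis using z by (auto intro!: period)
    next
      assume a: "bary_c z = 1" "e \<noteq> t" "j mod int q = (if t then int q - 1 else 1)"
      then have c: "z = c_vertex" using bary_eq_vertexD(3)[OF z x(1)] by simp
      have cc: "c_vertex \<in> cell e" for e by (simp add: vertex_in_cell vertices_def)
      show ?thesis
      proof (cases t)
        case True
        have "(j + 1) mod int q = (j mod int q + 1) mod int q" by (simp add: mod_add_left_eq)
        then have "(j + 1) mod int q = 0 mod int q" using a True by simp
        then have "lift True i (j + 1) c_vertex = lift True i 0 c_vertex" by (intro period cc) auto
        then show ?thesis using lift_bc[of c_vertex i j] a True c by simp
      next
        case False
        have "lift True i j c_vertex = lift True i (0 + 1) c_vertex"
          by (rule period) (use a False q cc in auto)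
        then show ?thesis using lift_bc[of c_vertex i 0] a False c by simp
      qed
    qed
    then show ?thesis using ac x(2) by blast
  qed
  have step: "z = w \<and> lift e i j z = lift e' i' j' w"
    if z: "z \<in> cell e" and w: "w \<in> cell e'"
      and R: "wedge_radius (j mod int q) z \<noteq> 0" "wedge_radius (j mod int q) z = wedge_radius (j' mod int q) w"
      and T: "wedge_angle q e (j mod int q) z = real q - 1" "wedge_angle q e' (j' mod int q) w = 1 - real q"
      and i: "int p dvd (i + 1) - i'" for z w e i j e' i' j'
  proof -
    have 1: "z \<in> segment_ac \<and> wedge_radius (j mod int q) z = bary_c z \<and> lift e i j z = lift True i 0 z"
      by (rule extreme[OF z R(1)]) (simp add: T)
    have 2: "w \<in> segment_ac \<and> wedge_radius (j' mod int q) w = bary_c w \<and> lift e' i' j' w = lift False i' 0 w"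
      by (rule extreme[OF w]) (use R T in auto)
    have "bary_b z = bary_b w" "bary_c z = bary_c w" using 1 2 R bary_faces(2) by metis+
    then have zw: "z = w" using bary_eq_on_equator 1 2 equator_eq by blast
    have "lift True i 0 z = lift False (i + 1) 0 z" using lift_ac 1 by blast
    also have "\<dots> = lift False i' 0 z" by (rule period[OF i refl]) (use 1 segment_subset_cell in blast)
    finally show ?thesis using 1 2 zw by simp
  qed
  \<comment> \<open>In sector \<open>i\<close> the upper tile \<open>l\<close> has the edge
    \<open>2 (i (q - 1) + l - 1)\<close>, and in sector \<open>i + 1\<close> the lower one has an
    edge whose number is larger by \<open>2 q - 1\<close>: this is the pattern.\<close>
  have ac_edge: "E True i j z = edge n (2 * (i * (int q - 1) + j mod int q - 1)) (bary_a z)"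
       "E False (i + 1) j z = edge n (2 * (i * (int q - 1) + j mod int q - 1) + 2 * int q - 1) (1 - bary_a z)"
    if z: "z \<in> segment_ac" and j: "j mod int q \<noteq> 0" for z i j
  proof -
    define l where "l = j mod int q"
    define k where "k = i * (int q - 1) + l - 1"
    have b: "bary_b z = 0" using z bary_faces(2) by blast
    then have c: "bary_c z = 1 - bary_a z" using bary_sum[of z] by simp
    have a01: "0 \<le> bary_a z" "bary_a z \<le> 1" "0 \<le> 1 - bary_a z" "1 - bary_a z \<le> 1"
      using bary_nonneg[of z] c by auto
    have "E True i j z = polygon_boundary n (of_int (2 * k) + bary_a z)"
      using j b by (simp add: E_def l_def[symmetric] wedge_radius_def wedge_angle_def mid_def k_def algebra_simps)
    then show "E True i j z = edge n (2 * (i * (int q - 1) + j mod int q - 1)) (bary_a z)"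
      unfolding polygon_boundary_edge[OF a01(1,2)] k_def l_def .
    have "E False (i + 1) j z = polygon_boundary n (of_int (2 * k + 2 * int q - 1) + (1 - bary_a z))"
    proof -
      have w: "wedge_angle q False l z = (2 * of_int l - real q) + (1 - bary_a z)"
        using j b c by (simp add: wedge_angle_def l_def[symmetric])
      have arg: "mid (i + 1) + wedge_angle q False l z = of_int (2 * k + 2 * int q - 1) + (1 - bary_a z)"
        unfolding w mid_def k_def by (simp add: algebra_simps)
      have rad: "wedge_radius l z = 1" using j b by (simp add: wedge_radius_def l_def[symmetric])
      show ?thesis by (simp only: E_def l_def[symmetric] rad arg scaleR_one)
    qed
    then show "E False (i + 1) j z = edge n (2 * (i * (int q - 1) + j mod int q - 1) + 2 * int q - 1) (1 - bary_a z)"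
      unfolding polygon_boundary_edge[OF a01(3,4)] k_def l_def .
  qed
  \<comment> \<open>Division by \<open>q - 1\<close>, with the remainder shifted by 1 because
    \<open>l = 0\<close> is reserved for the inner triangles.\<close>
  have index: "\<exists>i j. j mod int q \<noteq> 0 \<and> k = i * (int q - 1) + j mod int q - 1" for k
  proof (intro exI conjI)
    have "0 \<le> k mod (int q - 1)" "k mod (int q - 1) < int q - 1" using q by auto
    then have m: "(k mod (int q - 1) + 1) mod int q = k mod (int q - 1) + 1" by simp
    then show "(k mod (int q - 1) + 1) mod int q \<noteq> 0" using \<open>0 \<le> k mod (int q - 1)\<close> by simp
    show "k = (k div (int q - 1)) * (int q - 1) + (k mod (int q - 1) + 1) mod int q - 1"
      unfolding m using div_mult_mod_eq[of k "int q - 1"] by linarith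
  qed
  have ac_ex: "\<exists>z. z \<in> segment_ac \<and> bary_a z = t" if t: "t \<in> {0..1}" for t
  proof -
    obtain z where "z \<in> cell True" "bary_b z = 0" "bary_c z = 1 - t"
      by (rule bary_surj'[of 0 "1 - t" True]) (use t in auto)
    then show ?thesis using bary_faces(2)[of z] bary_sum[of z] by (intro exI[of _ z]) auto
  qed
  have E_ab: "E True i j z = E False i j z" if "z \<in> segment_ab" for z i j
  proof -
    have c: "bary_c z = 0" using that bary_faces(3) by blast
    then have a: "bary_a z = 1 - bary_b z" using bary_sum[of z] by simp
    have "wedge_angle q True l z = wedge_angle q False l z" for l
      by (simp add: wedge_angle_def a c) (simp add: algebra_simps)
    then show ?thesis by (simp add: E_def)
  qed
  have E_bc: "E True i (j + 1) z = E False i j z" if "z \<in> segment_bc" for z i j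
  proof -
    define l where "l = j mod int q"
    have a: "bary_a z = 0" using that bary_faces(1) by blast
    then have b: "bary_b z = 1 - bary_c z" using bary_sum[of z] by simp
    have l: "0 \<le> l" "l < int q" using jq by (auto simp: l_def)
    have j1: "(j + 1) mod int q = (l + 1) mod int q" by (simp add: l_def mod_add_left_eq)
    show ?thesis
    \<comment> \<open>The last lower outer triangle closes the cycle around the
      \<open>b\<close>-vertex by meeting the upper inner one, so here the two formulas for radius
      and angle must match.\<close>
    proof (cases "l = int q - 1")
      case True
      then have "(j + 1) mod int q = 0" "l \<noteq> 0" using j1 q by auto
      moreover have "wedge_angle q True 0 z = wedge_angle q False l z"
      proof -
        have lq: "real q = 1 + real_of_int l" using True by simp
        show ?thesis using \<open>l \<noteq> 0\<close> by (simp add: wedge_angle_def a b lq algebra_simps)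
      qed
      moreover have "wedge_radius 0 z = wedge_radius l z"
        using \<open>l \<noteq> 0\<close> by (simp add: wedge_radius_def b field_simps)
      ultimately show ?thesis by (simp add: E_def l_def[symmetric])
    next
      case False
      then have "(j + 1) mod int q = l + 1" "l + 1 \<noteq> 0" using j1 l by auto
      moreover have "wedge_angle q True (l + 1) z = wedge_angle q False l z"
        using \<open>l + 1 \<noteq> 0\<close> by (cases "l = 0") (simp_all add: wedge_angle_def a b algebra_simps)
      moreover have "wedge_radius (l + 1) z = wedge_radius l z"
        using \<open>l + 1 \<noteq> 0\<close> by (simp add: wedge_radius_def b field_simps)
      ultimately show ?thesis by (simp add: E_def l_def[symmetric])
    qed
  qed
  have "polygon_presentation X pr n (int q) segment_ac a_vertex c_vertex"
  proof (rule polygon_presentationI[where E = E])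
    show "2 \<le> n" by (fact n(3))
    show "continuous_map (subtopology riemann_sphere (cell e)) euclidean (E e i j)" for e i j
    proof -
      let ?Y = "subtopology riemann_sphere (cell e)"
      define l where "l = j mod int q"
      have lim: "(bary_a \<longlongrightarrow> bary_a x) (atin ?Y x)" "(bary_b \<longlongrightarrow> bary_b x) (atin ?Y x)"
        "(bary_c \<longlongrightarrow> bary_c x) (atin ?Y x)" if "x \<in> topspace ?Y" for x
        using that continuous_map_from_subtopology[OF continuous_bary_a, of "cell e"]
          continuous_map_from_subtopology[OF continuous_bary_b, of "cell e"]
          continuous_map_from_subtopology[OF continuous_bary_c, of "cell e"]
        unfolding continuous_map_atin limitin_canonical_iff by blast+
      show ?thesis
        unfolding E_def l_def[symmetric]
      proof (rule continuous_map_scaled_boundary)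
        show "continuous_map ?Y euclideanreal (wedge_radius l)"
          unfolding continuous_map_atin limitin_canonical_iff wedge_radius_def
          by (cases "l = 0") (auto intro!: tendsto_intros lim simp del: topspace_subtopology)
        fix x assume x: "x \<in> topspace ?Y" and R: "wedge_radius l x \<noteq> 0"
        show "((\<lambda>z. mid i + wedge_angle q e l z) \<longlongrightarrow> mid i + wedge_angle q e l x) (atin ?Y x)"
        proof (cases "l = 0")
          case True
          have nz: "bary_b x + bary_c x \<noteq> 0"
            using R True bary_nonneg[of x] by (auto simp: wedge_radius_def add_nonneg_eq_0_iff)
          show ?thesis
            unfolding wedge_angle_def if_P[OF True] by (intro tendsto_intros lim[OF x] nz)
        next
          case False
          have "((\<lambda>z. if e then bary_a z else bary_c z) \<longlongrightarrow> (if e then bary_a x else bary_c x)) (atin ?Y x)"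
            using lim[OF x] by (cases e) simp_all
          then show ?thesis
            unfolding wedge_angle_def if_not_P[OF False] by (intro tendsto_intros lim[OF x])
        qed
      qed
    qed
    show "(\<Union>e i j. E e i j ` cell e) = polygon n"
    proof (intro equalityI subsetI)
      fix P assume "P \<in> (\<Union>e i j. E e i j ` cell e)"
      then obtain e i j z where "P = E e i j z" by blast
      moreover have "0 \<le> wedge_radius l z" "wedge_radius l z \<le> 1" for l
        using bary_nonneg[of z] bary_sum[of z] by (simp_all add: wedge_radius_def)
      ultimately show "P \<in> polygon n" unfolding E_def using scaled_boundary_in_polygon[OF n(3)] by blast
    next
      fix P assume "P \<in> polygon n"
      then obtain R \<tau> where P: "0 \<le> R" "R \<le> 1" "P = R *\<^sub>R polygon_boundary n \<tau>"
        using polygon_polar[OF n(1)] by blast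
      \<comment> \<open>The position measured in sectors: its integer part is the sector, its
        fractional part is rescaled to \<delta>.\<close>
      define u where "u = \<tau> / (2 * (real q - 1))"
      define i where "i = \<lfloor>u\<rfloor>"
      define \<delta> where "\<delta> = 2 * frac u - 1"
      have d: "\<bar>\<delta>\<bar> \<le> 1" "\<delta> < 1"
        using frac_lt_1[of u] frac_ge_0[of u]
        unfolding \<delta>_def by linarith+
      have "of_int i + (\<delta> + 1) / 2 = u" unfolding i_def \<delta>_def frac_def by (simp add: field_simps)
      moreover have "mid i + (real q - 1) * \<delta> = (2 * (real q - 1)) * (of_int i + (\<delta> + 1) / 2)"
        by (simp add: mid_def field_simps)
      ultimately have \<tau>: "mid i + (real q - 1) * \<delta> = \<tau>" using q1 by (simp add: u_def)
      obtain e l z where z: "0 \<le> l" "l < int q" "z \<in> cell e" "wedge_radius l z = R"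
        "R = 0 \<or> wedge_angle q e l z = (real q - 1) * \<delta>"
        by (rule wedge_covers[OF q P(1,2) d])
      have "l mod int q = l" using z by simp
      then have "P = E e i l z" using z(4,5) unfolding P(3) E_def \<tau>[symmetric] by auto
      then show "P \<in> (\<Union>e i j. E e i j ` cell e)" using z(3) by blast
    qed
    show "E e i j z = E e i' j' z" if Lij: "L (i - i') (j - j')" for e i j i' j' z
    proof -
      have "int p dvd i - i'" using Lij L by blast
      then obtain d where "i - i' = int p * d" unfolding dvd_def by blast
      then have i: "i = i' + int p * d" by simp
      have j: "j mod int q = j' mod int q" using Lij L by (simp add: mod_eq_dvd_iff)
      have "polygon_boundary n (mid i + t) = polygon_boundary n (mid i' + t)" for t
        using polygon_boundary_periodic[OF n(2), of "mid i' + t" d] unfolding i mid_shift by (simp only: ac_simps)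
      then show ?thesis by (simp add: E_def j)
    qed
    show "equivclp (edge_pattern n (int q)) (E True i j z) (E False i j z)" if "z \<in> segment_ab" for z i j
      using E_ab[OF that] by simp
    show "equivclp (edge_pattern n (int q)) (E True i (j + 1) z) (E False i j z)" if "z \<in> segment_bc" for z i j
      using E_bc[OF that] by simp
    show "equivclp (edge_pattern n (int q)) (E True i j z) (E False (i + 1) j z)" if z: "z \<in> segment_ac" for z i j
    \<comment> \<open>Inner triangles: the end of sector \<open>i\<close> is the beginning of sector
      \<open>i + 1\<close>, so the two images are equal. For the other triangles the side ac is an
      edge of the polygon.\<close>
    proof (cases "j mod int q = 0")
      case True
      have b: "bary_b z = 0" using z bary_faces(2) by blast
      have m: "mid (i + 1) + (1 - real q) = mid i + (real q - 1)" by (simp add: mid_def algebra_simps)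
      have "E True i j z = E False (i + 1) j z"
        by (cases "bary_c z = 0") (simp_all add: E_def True wedge_radius_def wedge_angle_def b m)
      then show ?thesis by simp
    next
      case False
      have "bary_a z \<in> {0..1}" using bary_nonneg[of z] bary_sum[of z] by auto
      then have "edge_pattern n (int q) (E True i j z) (E False (i + 1) j z)"
        unfolding ac_edge[OF z False] edge_pattern_def reversepath_def by blast
      then show ?thesis by (rule r_into_equivclp)
    qed
    show "z = w \<and> lift e i j z = lift e' i' j' w"
      if z: "z \<in> cell e" and w: "w \<in> cell e'" and eq: "E e i j z = E e' i' j' w" for e i j e' i' j' z w
    proof -
      define l l' where "l = j mod int q" and "l' = j' mod int q"
      have nn: "0 \<le> wedge_radius l z" "0 \<le> wedge_radius l' w"
        using bary_nonneg[of z] bary_sum[of z] bary_nonneg[of w] bary_sum[of w] by (simp_all add: wedge_radius_def)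
      note eq' = scaled_boundary_eq[OF n(1) nn eq[unfolded E_def l_def[symmetric] l'_def[symmetric]]]
      show ?thesis
      proof (cases "wedge_radius l z = 0")
        case True
        have zero: "l = 0 \<and> bary_b z = 0 \<and> bary_c z = 0" if "wedge_radius l z = 0" for l z
        proof (cases "l = 0")
          case True
          then have "bary_c z + bary_b z / 2 = 0" using that by (simp add: wedge_radius_def)
          then have "bary_b z = 0" "bary_c z = 0" using bary_nonneg[of z] by linarith+
          then show ?thesis using True by simp
        next
          case False
          then have "bary_b z = 2" using that by (simp add: wedge_radius_def)
          then show ?thesis using bary_nonneg[of z] bary_sum[of z] by linarith
        qed
        have True': "wedge_radius l' w = 0" using True eq'(1) by simp
        have za: "l = 0" "z = a_vertex" "l' = 0" "w = a_vertex"
          using zero[OF True] zero[OF True'] bary_eq_vertexD(1)[OF z] bary_eq_vertexD(1)[OF w] by blast+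
        have "lift e i j a_vertex = lift True i j a_vertex" "lift e' i' j' a_vertex = lift True i' j' a_vertex"
          by (rule ab; simp)+
        moreover have "lift True i j a_vertex = lift True i j' a_vertex"
          by (rule period) (use za in \<open>auto simp: l_def l'_def vertex_in_cell vertices_def\<close>)
        ultimately show ?thesis using za at_a by metis
      next
        case False
        then obtain d :: int where d: "mid i' + wedge_angle q e' l' w = mid i + wedge_angle q e l z + of_int (int n * d)"
          using eq'(2) by blast
        \<comment> \<open>The difference of the sectors after removal of full turns. Both angles are
          at most \<open>q - 1\<close> in absolute value, so \<open>s\<close> is 0, 1 or -1, and in
          the last two cases both angles are extreme.\<close>
        define s where "s = i' - (i + int p * d)"
        have s: "(real q - 1) * (2 * of_int s) = wedge_angle q e l z - wedge_angle q e' l' w"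
        proof -
          have "mid i' - mid (i + int p * d) = (real q - 1) * (2 * of_int s)"
            by (simp add: mid_def s_def algebra_simps)
          then show ?thesis using d unfolding mid_shift by linarith
        qed
        have R': "wedge_radius l' w \<noteq> 0" using False eq'(1) by simp
        have b1: "\<bar>wedge_angle q e l z\<bar> \<le> real q - 1"
          using wedge_angle_bound[OF q] jq False unfolding l_def by blast
        have b2: "\<bar>wedge_angle q e' l' w\<bar> \<le> real q - 1"
          using wedge_angle_bound[OF q] jq R' unfolding l'_def by blast
        have "\<bar>(real q - 1) * (2 * of_int s)\<bar> \<le> (real q - 1) * 2" unfolding s using b1 b2 by (simp add: abs_le_iff)
        moreover have "\<bar>(real q - 1) * (2 * of_int s)\<bar> = (real q - 1) * \<bar>2 * of_int s\<bar>"
          using q1 by (simp add: abs_mult)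
        ultimately have "(real q - 1) * \<bar>2 * of_int s\<bar> \<le> (real q - 1) * 2" by simp
        then have "\<bar>2 * real_of_int s\<bar> \<le> 2" by (rule mult_left_le_imp_le[OF _ q1])
        then have "s = 0 \<or> s = 1 \<or> s = -1" by linarith
        then show ?thesis
        proof (elim disjE)
          assume s0: "s = 0"
          then have T: "wedge_angle q e l z = wedge_angle q e' l' w" using s by simp
          have i: "int p dvd i - i'" using s0 by (simp add: s_def)
          have l: "0 \<le> l" "l < int q" "0 \<le> l'" "l' < int q" using jq by (auto simp: l_def l'_def)
          show ?thesis
            using neighbours[OF z w i wedge_eqD(1,2)[OF q l False eq'(1) T]] wedge_eqD(3)[OF q l False eq'(1) T]
            unfolding l_def l'_def by blast
        next
          assume s1: "s = 1"
          then have "wedge_angle q e l z - wedge_angle q e' l' w = 2 * (real q - 1)" using s by simp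
          then have T: "wedge_angle q e l z = real q - 1" "wedge_angle q e' l' w = 1 - real q"
            using abs_le_D1[OF b1] abs_le_D2[OF b1] abs_le_D1[OF b2] abs_le_D2[OF b2] by argo+
          have "(i + 1) - i' = int p * (- d)" using s1 by (simp add: s_def)
          then have "int p dvd (i + 1) - i'" by simp
          then show ?thesis using step[OF z w] T False eq'(1) unfolding l_def l'_def by blast
        next
          assume s1: "s = -1"
          then have "wedge_angle q e' l' w - wedge_angle q e l z = 2 * (real q - 1)" using s by simp
          then have T: "wedge_angle q e' l' w = real q - 1" "wedge_angle q e l z = 1 - real q"
            using abs_le_D1[OF b1] abs_le_D2[OF b1] abs_le_D1[OF b2] abs_le_D2[OF b2] by argo+
          have "(i' + 1) - i = int p * d" using s1 by (simp add: s_def)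
          then have "int p dvd (i' + 1) - i" by simp
          then have "w = z \<and> lift e' i' j' w = lift e i j z"
            using step[OF w z] T R' eq'(1) unfolding l_def l'_def by metis
          then show ?thesis by metis
        qed
      qed
    qed
    have main: "\<exists>i j z. z \<in> segment_ac \<and> edge n (2 * k) t = E True i j z \<and>
        edge n (2 * k + 2 * int q - 1) (1 - t) = E False (i + 1) j z" if t: "t \<in> {0..1}" for k t
    proof -
      obtain i j where ij: "j mod int q \<noteq> 0" "k = i * (int q - 1) + j mod int q - 1" using index by blast
      obtain z where z: "z \<in> segment_ac" "bary_a z = t" using ac_ex[OF t] by blast
      show ?thesis using ac_edge[OF z(1) ij(1), of i] z ij(2) by (intro exI[of _ i] exI[of _ j] exI[of _ z]) simp
    qed
    show "\<exists>e i j e' i' j' z. z \<in> cell e \<and> z \<in> cell e' \<and> x = E e i j z \<and> y = E e' i' j' z \<and>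
        lift e i j z = lift e' i' j' z" if pat: "edge_pattern n (int q) x y" for x y
    proof -
      from pat obtain k t where t: "t \<in> {0..1}" and
        "(x = edge n (2 * k) t \<and> y = edge n (2 * k + 2 * int q - 1) (1 - t)) \<or>
         (x = edge n (2 * k - 1) t \<and> y = edge n (2 * k - 2 * int q) (1 - t))"
        unfolding edge_pattern_def reversepath_def by blast
      then show ?thesis
      proof (elim disjE conjE)
        assume xy: "x = edge n (2 * k) t" "y = edge n (2 * k + 2 * int q - 1) (1 - t)"
        obtain i j z where z: "z \<in> segment_ac" "x = E True i j z" "y = E False (i + 1) j z"
          using main[OF t, of k] xy by metis
        then show ?thesis using lift_ac[OF z(1)] segment_subset_cell by blast
      next
        assume xy: "x = edge n (2 * k - 1) t" "y = edge n (2 * k - 2 * int q) (1 - t)"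
        have "1 - t \<in> {0..1}" using t by auto
        \<comment> \<open>The odd half of the pattern is the even half read backwards, with
          \<open>k - q\<close> for \<open>k\<close> and \<open>1 - t\<close> for
          \<open>t\<close>.\<close>
        from main[OF this, of "k - int q"] obtain i j z where
          z: "z \<in> segment_ac" "y = E True i j z" "x = E False (i + 1) j z"
          using xy by (auto simp: algebra_simps)
        then show ?thesis using lift_ac[OF z(1), symmetric] segment_subset_cell by blast
      qed
    qed
    show "segment_ac \<subseteq> cell False" by (rule segment_subset_cell)
    show "a_vertex \<in> segment_ac" "c_vertex \<in> segment_ac" by simp_all
    show "\<exists>i j. E False i j ` segment_ac = path_image (edge n k) \<and>
        E False i j a_vertex = edge n k 0 \<and> E False i j c_vertex = edge n k 1" if k: "odd k" for k
    proof -
      obtain c where c: "k = 2 * c + 1" using k by (rule oddE)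
      \<comment> \<open>Chosen so that the odd edge \<open>k\<close> is the partner of the even edge
        \<open>2 k'\<close>.\<close>
      define k' where "k' = c + 1 - int q"
      have k': "k = 2 * k' + 2 * int q - 1" by (simp add: c k'_def)
      obtain i j where ij: "j mod int q \<noteq> 0" "k' = i * (int q - 1) + j mod int q - 1" using index by blast
      have E: "E False (i + 1) j z = edge n k (1 - bary_a z)" if "z \<in> segment_ac" for z
        using ac_edge(2)[OF that ij(1), of i] unfolding k' ij(2) .
      have "(\<lambda>z. 1 - bary_a z) ` segment_ac = {0..1}"
      proof (intro equalityI subsetI)
        fix t assume "t \<in> (\<lambda>z. 1 - bary_a z) ` segment_ac"
        then obtain z where "t = 1 - bary_a z" by blast
        then show "t \<in> {0..1}" using bary_nonneg[of z] bary_sum[of z] by auto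
      next
        fix t :: real assume "t \<in> {0..1}"
        then have "1 - t \<in> {0..1}" by auto
        then obtain z where "z \<in> segment_ac" "bary_a z = 1 - t" using ac_ex by blast
        then show "t \<in> (\<lambda>z. 1 - bary_a z) ` segment_ac" by (intro image_eqI[of _ _ z]) auto
      qed
      then have "path_image (edge n k) = edge n k ` (\<lambda>z. 1 - bary_a z) ` segment_ac" by (simp add: path_image_def)
      also have "\<dots> = E False (i + 1) j ` segment_ac" unfolding image_image using E by (intro image_cong) auto
      finally show ?thesis using E by (intro exI[of _ "i + 1"] exI[of _ j]) simp
    qed
  qed
  then show ?thesis by (simp add: n_def)
qed

end

section \<open>The three singularities\<close>

theorem theorem1p7:
  fixes p q :: nat
    and X :: "'a topology"
    and A :: "('a set \<times> ('a \<Rightarrow> complex)) set"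
    and S :: "'a set"
    and \<kappa> :: "'a \<Rightarrow> complex \<times> complex"
    and pr :: "'a \<Rightarrow> complex option"
  assumes "2 \<le> p" and "2 \<le> q"
  shows
    "(compactified_milnor_fiber (fermat p q) X A S \<kappa> \<and>
      symmetry_quotient (fermat p q) (\<lambda>(x, y). x ^ p) X S \<kappa> pr \<longrightarrow>
        polygon_presentation X pr (2 * p * q - 2 * p) (int q) segment_ac a_vertex c_vertex) \<and>
     (compactified_milnor_fiber (chain_sing p q) X A S \<kappa> \<and>
      symmetry_quotient (chain_sing p q) (\<lambda>(x, y). x ^ p) X S \<kappa> pr \<longrightarrow>
        polygon_presentation X pr (2 * p * q) (int p) segment_bc c_vertex b_vertex) \<and>
     (compactified_milnor_fiber (loop_sing p q) X A S \<kappa> \<and>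
      symmetry_quotient (loop_sing p q) (\<lambda>(x, y). x ^ p * y) X S \<kappa> pr \<longrightarrow>
        polygon_presentation X pr (2 * (p * q - 1)) (int p) segment_bc c_vertex b_vertex)"
proof (intro conjI impI)
  have pos: "0 < p" "0 < q" using assms by auto
  have roots: "finite {x::complex. x ^ k = 1}" if "0 < k" for k
    using that finite_nth_roots[of k 1] by simp
  {
    assume a: "compactified_milnor_fiber (fermat p q) X A S \<kappa> \<and>
      symmetry_quotient (fermat p q) (\<lambda>(x, y). x ^ p) X S \<kappa> pr"
    interpret exponent_matrix p 0 0 q by unfold_locales (use pos in simp)
    \<comment> \<open>Both fibres meet the Milnor fiber: \<open>x = 0\<close> leaves a root of unity
      for \<open>y\<close>, and \<open>x ^ p = 1\<close> leaves \<open>y = 0\<close>.\<close>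
    have "{z. fermat p q z = 1 \<and> (case z of (x, y) \<Rightarrow> x ^ p) \<in> {0, 1}}
        \<subseteq> {0} \<times> {y. y ^ q = 1} \<union> {x. x ^ p = 1} \<times> {0}"
      using pos by (auto simp: fermat_def zero_power)
    then have "finite {z. fermat p q z = 1 \<and> (case z of (x, y) \<Rightarrow> x ^ p) \<in> {0, 1}}"
      by (rule finite_subset) (use roots pos in auto)
    then obtain lift where "triangulated_cover X pr lift (lattice p 0 0 q)"
      using triangulated_cover_of_quotient[OF conjunct1[OF a] conjunct2[OF a]] by (auto simp: fermat_def)
    then interpret triangulated_cover X pr lift "lattice p 0 0 q" .
    show "polygon_presentation X pr (2 * p * q - 2 * p) (int q) segment_ac a_vertex c_vertex"
      by (rule product_presentation) (use assms in \<open>auto simp: lattice_def dvd_def\<close>)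
  next
    assume a: "compactified_milnor_fiber (chain_sing p q) X A S \<kappa> \<and>
      symmetry_quotient (chain_sing p q) (\<lambda>(x, y). x ^ p) X S \<kappa> pr"
    interpret exponent_matrix p 0 1 q by unfold_locales (use pos in simp)
    \<comment> \<open>\<open>x = 0\<close> makes the polynomial vanish, so the points over the
      \<open>a\<close>-vertex are punctures.\<close>
    have "{z. chain_sing p q z = 1 \<and> (case z of (x, y) \<Rightarrow> x ^ p) \<in> {0, 1}} \<subseteq> {x. x ^ p = 1} \<times> {0}"
      using pos by (auto simp: chain_sing_def zero_power)
    then have "finite {z. chain_sing p q z = 1 \<and> (case z of (x, y) \<Rightarrow> x ^ p) \<in> {0, 1}}"
      by (rule finite_subset) (use roots pos in auto)
    then obtain lift where "triangulated_cover X pr lift (lattice p 0 1 q)"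
      using triangulated_cover_of_quotient[OF conjunct1[OF a] conjunct2[OF a]] by (auto simp: chain_sing_def)
    then interpret triangulated_cover X pr lift "lattice p 0 1 q" .
    \<comment> \<open>Eliminating \<open>a = j - q b\<close> from \<open>i = p a\<close> leaves
      \<open>i - p j = - p q b\<close>.\<close>
    have L: "lattice p 0 1 q i j \<longleftrightarrow> int (p * q) dvd i - int p * j" for i j
    proof
      assume "lattice p 0 1 q i j"
      then obtain a b where "i = int p * a" "j = a + int q * b" by (auto simp: lattice_def)
      then have "i - int p * j = int (p * q) * (- b)" by (simp add: algebra_simps)
      then show "int (p * q) dvd i - int p * j" by (metis dvd_triv_left)
    next
      assume "int (p * q) dvd i - int p * j"
      then obtain b where "i - int p * j = int (p * q) * b" by (auto simp: dvd_def)
      then have "i = int p * (j + int q * b) + int 0 * (- b)" "j = int 1 * (j + int q * b) + int q * (- b)"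
        by (simp_all add: algebra_simps)
      then show "lattice p 0 1 q i j" unfolding lattice_def by blast
    qed
    have "2 * 1 \<le> p * q" using assms by (intro mult_le_mono) auto
    then have "polygon_presentation X pr (2 * (p * q)) (int p) segment_bc c_vertex b_vertex"
      by (intro cyclic_presentation L) simp
    then show "polygon_presentation X pr (2 * p * q) (int p) segment_bc c_vertex b_vertex" by (simp add: mult.assoc)
  next
    assume a: "compactified_milnor_fiber (loop_sing p q) X A S \<kappa> \<and>
      symmetry_quotient (loop_sing p q) (\<lambda>(x, y). x ^ p * y) X S \<kappa> pr"
    have "2 * 2 \<le> p * q" using assms by (intro mult_le_mono) auto
    then have pq: "4 \<le> p * q" by simp
    interpret exponent_matrix p 1 1 q by unfold_locales (use pq in simp)
    \<comment> \<open>On the axes the polynomial vanishes, so all points over the three vertices are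
      punctures.\<close>
    have "{z. loop_sing p q z = 1 \<and> (case z of (x, y) \<Rightarrow> x ^ p * y) \<in> {0, 1}} = {}"
      using pos by (auto simp: loop_sing_def zero_power)
    then have "finite {z. loop_sing p q z = 1 \<and> (case z of (x, y) \<Rightarrow> x ^ p * y) \<in> {0, 1}}"
      by (metis finite.emptyI)
    then obtain lift where "triangulated_cover X pr lift (lattice p 1 1 q)"
      using triangulated_cover_of_quotient[OF conjunct1[OF a] conjunct2[OF a]] by (auto simp: loop_sing_def)
    then interpret triangulated_cover X pr lift "lattice p 1 1 q" .
    have m: "int (p * q - 1) = int p * int q - 1"
    proof -
      have "1 \<le> p * q" using pq by linarith
      then have "int (p * q - 1) = int (p * q) - int 1" by (rule of_nat_diff)
      then show ?thesis by simp
    qed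
    \<comment> \<open>Here the elimination of \<open>a = j - q b\<close> from
      \<open>i = p a + b\<close> leaves \<open>i - p j = - (p q - 1) b\<close>.\<close>
    have L: "lattice p 1 1 q i j \<longleftrightarrow> int (p * q - 1) dvd i - int p * j" for i j
    proof
      assume "lattice p 1 1 q i j"
      then obtain a b where "i = int p * a + b" "j = a + int q * b" by (auto simp: lattice_def)
      then have "i - int p * j = int (p * q - 1) * (- b)" unfolding m by (simp add: algebra_simps)
      then show "int (p * q - 1) dvd i - int p * j" by (metis dvd_triv_left)
    next
      assume "int (p * q - 1) dvd i - int p * j"
      then obtain b where "i - int p * j = int (p * q - 1) * b" by (auto simp: dvd_def)
      then have "i = int p * (j + int q * b) + int 1 * (- b)" "j = int 1 * (j + int q * b) + int q * (- b)"
        unfolding m by (simp_all add: algebra_simps)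
      then show "lattice p 1 1 q i j" unfolding lattice_def by blast
    qed
    show "polygon_presentation X pr (2 * (p * q - 1)) (int p) segment_bc c_vertex b_vertex"
      by (rule cyclic_presentation[OF L]) (use pq in simp)
  }
qed

end
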